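(* Let $K$ be a field of characteristic zero, and let $V$ and $W$ be $K$-vector spaces with $\dim(V)=\dim(W)=2$. Then the Hilbert series of the graded ring $K[\mathrm{End}(V\otimes W)]^{\mathrm{GL}(V)\times \mathrm{GL}(W)}$ is the rational function $$\frac{1 - x^2 - x^3 + 2x^4 + 2x^5 + 2x^6 - x^7 - x^8 + x^{10}}{(1-x)(1-x^2)^4(1-x^3)^3(1-x^4)^2}.$$
   Context: For a finite dimensional $K$-vector space $U$, $K[U]$ denotes the ring of polynomial functions on $U$, graded by polynomial degree. The group $\mathrm{GL}(V)\times\mathrm{GL}(W)$ acts on $V\otimes W$ by $(g,h)\cdot(v\otimes w)=gv\otimes hw$, and on $\mathrm{End}(V\otimes W)$ by conjugation; $K[\mathrm{End}(V\otimes W)]^{\mathrm{GL}(V)\times \mathrm{GL}(W)}$ is the graded subring of invariant polynomial functions. The Hilbert series of a graded algebra $A=\bigoplus_{n\geq 0}A_n$ with finite dimensional components is $H_A(x)=\sum_{n\geq 0}\dim_K(A_n)x^n\in\mathbb{Z}[[x]]$; the rational function is understood as its power series expansion in $\mathbb{Z}[[x]]$. *)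

theory Defs
  imports
    "HOL-Library.Function_Algebras"
    "HOL-Computational_Algebra.Formal_Power_Series"
begin

text \<open>
  Vector spaces over a field are given, as in \<^theory>\<open>HOL.Vector_Spaces\<close>, by a scalar
  multiplication on a type of class \<^class>\<open>ab_group_add\<close>. Spaces of functions carry the pointwise
  operations.
\<close>

definition scale_fun :: "('k \<Rightarrow> 'b \<Rightarrow> 'b) \<Rightarrow> 'k \<Rightarrow> ('x \<Rightarrow> 'b) \<Rightarrow> 'x \<Rightarrow> 'b" where
  "scale_fun s c f = (\<lambda>x. s c (f x))"

lemma vector_space_scale_fun:
  assumes "vector_space s"
  shows "vector_space (scale_fun s)"
proof -
  interpret vector_space s by fact
  show ?thesis
    by unfold_locales
      (auto simp: scale_fun_def plus_fun_def algebra_simps)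
qed

lemma vector_space_mult: "vector_space ((*) :: 'k::field \<Rightarrow> 'k \<Rightarrow> 'k)"
  by unfold_locales (auto simp: algebra_simps)


section \<open>Tensor products\<close>

definition delta :: "'x \<Rightarrow> 'x \<Rightarrow> 'k::field" where
  "delta p = (\<lambda>q. if q = p then 1 else 0)"

text \<open>
  The free vector space on \<open>V \<times> W\<close> consists of the finitely supported functions
  \<open>V \<times> W \<rightarrow> K\<close>, and \<open>V \<otimes> W\<close> is its quotient by the bilinearity relations below. Instead of
  fixing one model of the quotient, we say that a space \<open>T\<close> with a map \<open>\<tau> v w = v \<otimes> w\<close> is a
  tensor product when \<open>delta (v, w) \<mapsto> \<tau> v w\<close> induces an isomorphism from this quotient to \<open>T\<close>.
\<close>

definition tensor_relations ::
  "('k::field \<Rightarrow> 'v::ab_group_add \<Rightarrow> 'v) \<Rightarrow> ('k \<Rightarrow> 'w::ab_group_add \<Rightarrow> 'w) \<Rightarrow> ('v \<times> 'w \<Rightarrow> 'k) set"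
where
  "tensor_relations sV sW =
     {delta (v + v', w) - delta (v, w) - delta (v', w) |v v' w. True} \<union>
     {delta (v, w + w') - delta (v, w) - delta (v, w') |v w w'. True} \<union>
     {delta (sV c v, w) - scale_fun (*) c (delta (v, w)) |c v w. True} \<union>
     {delta (v, sW c w) - scale_fun (*) c (delta (v, w)) |c v w. True}"

definition free_extension ::
  "('k::field \<Rightarrow> 't::ab_group_add \<Rightarrow> 't) \<Rightarrow> ('v \<Rightarrow> 'w \<Rightarrow> 't) \<Rightarrow> ('v \<times> 'w \<Rightarrow> 'k) \<Rightarrow> 't"
where
  "free_extension sT \<tau> f = (\<Sum>(v, w) \<in> {p. f p \<noteq> 0}. sT (f (v, w)) (\<tau> v w))"

definition is_tensor_product ::
  "('k::field \<Rightarrow> 'v::ab_group_add \<Rightarrow> 'v) \<Rightarrow> ('k \<Rightarrow> 'w::ab_group_add \<Rightarrow> 'w) \<Rightarrow>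
   ('k \<Rightarrow> 't::ab_group_add \<Rightarrow> 't) \<Rightarrow> ('v \<Rightarrow> 'w \<Rightarrow> 't) \<Rightarrow> bool"
where
  "is_tensor_product sV sW sT \<tau> \<longleftrightarrow>
     vector_space sV \<and> vector_space sW \<and> vector_space sT \<and>
     free_extension sT \<tau> ` {f. finite {p. f p \<noteq> 0}} = UNIV \<and>
     {f. finite {p. f p \<noteq> 0} \<and> free_extension sT \<tau> f = 0}
       = module.span (scale_fun (*)) (tensor_relations sV sW)"

text \<open>The universal property of the tensor product follows from this definition.\<close>

lemma free_extension_superset:
  assumes "vector_space sT" "finite S" "{p. f p \<noteq> 0} \<subseteq> S"
  shows "free_extension sT \<tau> f = (\<Sum>(v, w) \<in> S. sT (f (v, w)) (\<tau> v w))"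
proof -
  interpret vector_space sT by fact
  show ?thesis unfolding free_extension_def
    by (rule sum.mono_neutral_left) (use assms in auto)
qed

lemma free_extension_add:
  assumes "vector_space sT" "finite {p. f p \<noteq> 0}" "finite {p. g p \<noteq> 0}"
  shows "free_extension sT \<tau> (f + g) = free_extension sT \<tau> f + free_extension sT \<tau> g"
proof -
  interpret vector_space sT by fact
  let ?S = "{p. f p \<noteq> 0} \<union> {p. g p \<noteq> 0}"
  have "free_extension sT \<tau> (f + g) = (\<Sum>(v, w) \<in> ?S. sT ((f + g) (v, w)) (\<tau> v w))"
    by (rule free_extension_superset) (use assms in auto)
  moreover have "free_extension sT \<tau> f = (\<Sum>(v, w) \<in> ?S. sT (f (v, w)) (\<tau> v w))"
    by (rule free_extension_superset) (use assms in auto)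
  moreover have "free_extension sT \<tau> g = (\<Sum>(v, w) \<in> ?S. sT (g (v, w)) (\<tau> v w))"
    by (rule free_extension_superset) (use assms in auto)
  ultimately show ?thesis
    by (simp add: sum.distrib[symmetric] scale_left_distrib case_prod_unfold)
qed

lemma free_extension_scale:
  assumes "vector_space sT" "finite {p. f p \<noteq> 0}"
  shows "free_extension sT \<tau> (scale_fun (*) c f) = sT c (free_extension sT \<tau> f)"
proof -
  interpret vector_space sT by fact
  have "free_extension sT \<tau> (scale_fun (*) c f)
      = (\<Sum>(v, w) \<in> {p. f p \<noteq> 0}. sT (scale_fun (*) c f (v, w)) (\<tau> v w))"
    by (rule free_extension_superset) (use assms in \<open>auto simp: scale_fun_def\<close>)
  thus ?thesis
    by (simp add: free_extension_def scale_fun_def scale_sum_right case_prod_unfold)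
qed

lemma finite_support_delta [simp]: "finite {p. delta q p \<noteq> (0 :: 'k::field)}"
  by (rule finite_subset[of _ "{q}"]) (auto simp: delta_def split: if_splits)

lemma finite_support_add:
  "finite {p. f p \<noteq> 0} \<Longrightarrow> finite {p. g p \<noteq> 0} \<Longrightarrow> finite {p. (f + g) p \<noteq> (0 :: 'k::field)}"
  by (rule finite_subset[of _ "{p. f p \<noteq> 0} \<union> {p. g p \<noteq> 0}"]) auto

lemma finite_support_scale:
  "finite {p. f p \<noteq> 0} \<Longrightarrow> finite {p. scale_fun (*) c f p \<noteq> (0 :: 'k::field)}"
  by (rule finite_subset[of _ "{p. f p \<noteq> 0}"]) (auto simp: scale_fun_def)

lemma scale_minus_one: "scale_fun (*) (-1) f = - (f :: 'x \<Rightarrow> 'k::field)"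
  by (rule ext) (simp add: scale_fun_def)

lemma finite_support_diff:
  "finite {p. f p \<noteq> 0} \<Longrightarrow> finite {p. g p \<noteq> 0} \<Longrightarrow> finite {p. (f - g) p \<noteq> (0 :: 'k::field)}"
  by (rule finite_subset[of _ "{p. f p \<noteq> 0} \<union> {p. g p \<noteq> 0}"]) auto

lemma free_extension_diff:
  assumes "vector_space sT" "finite {p. f p \<noteq> 0}" "finite {p. g p \<noteq> 0}"
  shows "free_extension sT \<tau> (f - g) = free_extension sT \<tau> f - free_extension sT \<tau> g"
proof -
  have "free_extension sT \<tau> ((f - g) + g) = free_extension sT \<tau> (f - g) + free_extension sT \<tau> g"
    by (rule free_extension_add) (use assms in \<open>auto intro: finite_support_diff simp del: minus_apply\<close>)
  thus ?thesis by simp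
qed

lemma free_extension_delta:
  assumes "vector_space sT"
  shows "free_extension sT \<tau> (delta (v, w)) = \<tau> v w"
proof -
  interpret vector_space sT by fact
  have "free_extension sT \<tau> (delta (v, w)) = (\<Sum>(v', w') \<in> {(v, w)}. sT (delta (v, w) (v', w')) (\<tau> v' w'))"
    by (rule free_extension_superset) (use assms in \<open>auto simp: delta_def split: if_splits\<close>)
  thus ?thesis by (simp add: delta_def)
qed

definition is_bilinear ::
  "('k::field \<Rightarrow> 'v::ab_group_add \<Rightarrow> 'v) \<Rightarrow> ('k \<Rightarrow> 'w::ab_group_add \<Rightarrow> 'w) \<Rightarrow>
   ('k \<Rightarrow> 'u::ab_group_add \<Rightarrow> 'u) \<Rightarrow> ('v \<Rightarrow> 'w \<Rightarrow> 'u) \<Rightarrow> bool"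
where
  "is_bilinear sV sW sU \<beta> \<longleftrightarrow>
     (\<forall>w. Vector_Spaces.linear sV sU (\<lambda>v. \<beta> v w)) \<and> (\<forall>v. Vector_Spaces.linear sW sU (\<beta> v))"

lemma free_extension_relations:
  assumes "vector_space sV" "vector_space sW" "vector_space sU" "is_bilinear sV sW sU \<beta>"
    and f: "f \<in> module.span (scale_fun (*)) (tensor_relations sV sW)"
  shows "finite {p. f p \<noteq> 0} \<and> free_extension sU \<beta> f = 0"
proof -
  interpret F: vector_space "scale_fun (*) :: 'a \<Rightarrow> ('b \<times> 'c \<Rightarrow> 'a) \<Rightarrow> _"
    by (rule vector_space_scale_fun[OF vector_space_mult])
  interpret U: vector_space sU by fact
  have b: "\<beta> (v + v') w = \<beta> v w + \<beta> v' w" "\<beta> v (w + w') = \<beta> v w + \<beta> v w'"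
    "\<beta> (sV c v) w = sU c (\<beta> v w)" "\<beta> v (sW c w) = sU c (\<beta> v w)" for v v' w w' c
    using assms(4) unfolding is_bilinear_def Vector_Spaces.linear_iff by auto
  note fin = finite_support_diff finite_support_scale finite_support_delta
  have gen: "finite {p. f p \<noteq> 0} \<and> free_extension sU \<beta> f = 0"
    if "f \<in> tensor_relations sV sW" for f
    using that unfolding tensor_relations_def
    by (auto simp: free_extension_diff[OF assms(3)] free_extension_scale[OF assms(3)]
        free_extension_delta[OF assms(3)] b fin simp del: minus_apply)
  show ?thesis using f
  proof (induction rule: F.span_induct_alt)
    case base
    then show ?case by (simp add: free_extension_def)
  next
    case (step c x y)
    with gen[of x] show ?case
      by (auto simp: free_extension_add[OF assms(3)] free_extension_scale[OF assms(3)]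
        finite_support_add finite_support_scale simp del: plus_fun_apply)
  qed
qed

lemma is_tensor_product_bilinear:
  assumes "is_tensor_product sV sW sT \<tau>"
  shows "is_bilinear sV sW sT \<tau>"
proof -
  have vs: "vector_space sV" "vector_space sW" and T: "vector_space sT"
    and ker: "{f. finite {p. f p \<noteq> 0} \<and> free_extension sT \<tau> f = 0}
       = module.span (scale_fun (*)) (tensor_relations sV sW)"
    using assms unfolding is_tensor_product_def by auto
  interpret F: vector_space "scale_fun (*) :: 'a \<Rightarrow> ('b \<times> 'c \<Rightarrow> 'a) \<Rightarrow> _"
    by (rule vector_space_scale_fun[OF vector_space_mult])
  note fin = finite_support_diff finite_support_scale finite_support_delta
  note ext = free_extension_diff[OF T] free_extension_scale[OF T] free_extension_delta[OF T]
  have z: "free_extension sT \<tau> f = 0" if "f \<in> tensor_relations sV sW" for f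
    using F.span_base[OF that] ker by blast
  have "free_extension sT \<tau> (delta (v + v', w) - delta (v, w) - delta (v', w)) = 0"
    "free_extension sT \<tau> (delta (v, w + w') - delta (v, w) - delta (v, w')) = 0"
    "free_extension sT \<tau> (delta (sV c v, w) - scale_fun (*) c (delta (v, w))) = 0"
    "free_extension sT \<tau> (delta (v, sW c w) - scale_fun (*) c (delta (v, w))) = 0" for v v' w w' c
    by (rule z; unfold tensor_relations_def; blast)+
  hence "\<tau> (v + v') w = \<tau> v w + \<tau> v' w" "\<tau> v (w + w') = \<tau> v w + \<tau> v w'"
    "\<tau> (sV c v) w = sT c (\<tau> v w)" "\<tau> v (sW c w) = sT c (\<tau> v w)" for v v' w w' c
    by (simp_all add: ext fin diff_eq_eq add.commute del: minus_apply)
  thus ?thesis using vs T unfolding is_bilinear_def Vector_Spaces.linear_iff by auto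
qed

lemma is_tensor_product_universal:
  assumes "is_tensor_product sV sW sT \<tau>" "vector_space sU" "is_bilinear sV sW sU \<beta>"
  shows "\<exists>!F. Vector_Spaces.linear sT sU F \<and> (\<forall>v w. F (\<tau> v w) = \<beta> v w)"
proof -
  have vs: "vector_space sV" "vector_space sW" and T: "vector_space sT"
    and surj: "free_extension sT \<tau> ` {f. finite {p. f p \<noteq> 0}} = UNIV"
    and ker: "{f. finite {p. f p \<noteq> 0} \<and> free_extension sT \<tau> f = 0}
       = module.span (scale_fun (*)) (tensor_relations sV sW)"
    using assms(1) unfolding is_tensor_product_def by auto
  note U = assms(2)
  let ?e = "free_extension sT \<tau>" and ?b = "free_extension sU \<beta>"
  have "\<forall>t. \<exists>f. finite {p. f p \<noteq> 0} \<and> ?e f = t" using surj by (metis (mono_tags, lifting) UNIV_I imageE mem_Collect_eq)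
  then obtain r where r: "finite {p. r t p \<noteq> 0}" "?e (r t) = t" for t by metis
  have wd: "?b f = ?b g" if "finite {p. f p \<noteq> 0}" "finite {p. g p \<noteq> 0}" "?e f = ?e g" for f g
  proof -
    have "f - g \<in> module.span (scale_fun (*)) (tensor_relations sV sW)"
      unfolding ker[symmetric] using that finite_support_diff[of f g] by (simp add: free_extension_diff[OF T] del: minus_apply)
    from free_extension_relations[OF vs U assms(3) this] show ?thesis
      using that by (simp add: free_extension_diff[OF U] del: minus_apply)
  qed
  define F where "F t = ?b (r t)" for t
  have Fe: "F (?e f) = ?b f" if "finite {p. f p \<noteq> 0}" for f
    unfolding F_def by (rule wd) (use r that in auto)
  have lin: "Vector_Spaces.linear sT sU F"
    unfolding Vector_Spaces.linear_iff
  proof (intro conjI allI T U)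
    fix x y c
    show "F (x + y) = F x + F y"
      using Fe[of "r x + r y"] r
      by (simp add: finite_support_add free_extension_add[OF T] free_extension_add[OF U] F_def del: plus_fun_apply)
    show "F (sT c x) = sU c (F x)"
      using Fe[of "scale_fun (*) c (r x)"] r
      by (simp add: finite_support_scale free_extension_scale[OF T] free_extension_scale[OF U] F_def)
  qed
  have ft: "F (\<tau> v w) = \<beta> v w" for v w
    using Fe[of "delta (v, w)"] by (simp add: free_extension_delta[OF T] free_extension_delta[OF U])
  have uniq: "G = F" if "Vector_Spaces.linear sT sU G" "\<forall>v w. G (\<tau> v w) = \<beta> v w" for G
  proof
    fix t
    interpret G: Vector_Spaces.linear sT sU G by fact
    interpret F: Vector_Spaces.linear sT sU F by fact
    obtain f where "t = ?e f" using r by metis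
    thus "G t = F t"
      by (simp add: free_extension_def G.sum F.sum case_prod_unfold G.scale F.scale that ft)
  qed
  show ?thesis using lin ft uniq by blast
qed



section \<open>Linear groups and their actions\<close>

definition general_linear_group ::
  "('k::field \<Rightarrow> 'v::ab_group_add \<Rightarrow> 'v) \<Rightarrow> ('v \<Rightarrow> 'v) set"
where
  "general_linear_group s = {g. Vector_Spaces.linear s s g \<and> bij g}"

definition endomorphisms ::
  "('k::field \<Rightarrow> 'v::ab_group_add \<Rightarrow> 'v) \<Rightarrow> ('v \<Rightarrow> 'v) set"
where
  "endomorphisms s = {A. Vector_Spaces.linear s s A}"

definition tensor_map ::
  "('k::field \<Rightarrow> 't::ab_group_add \<Rightarrow> 't) \<Rightarrow> ('v \<Rightarrow> 'w \<Rightarrow> 't) \<Rightarrow>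
   ('v \<Rightarrow> 'v) \<Rightarrow> ('w \<Rightarrow> 'w) \<Rightarrow> 't \<Rightarrow> 't"
where
  "tensor_map sT \<tau> g h =
     (THE F. Vector_Spaces.linear sT sT F \<and> (\<forall>v w. F (\<tau> v w) = \<tau> (g v) (h w)))"

lemma tensor_map_linear:
  assumes "is_tensor_product sV sW sT \<tau>"
    and "Vector_Spaces.linear sV sV g" "Vector_Spaces.linear sW sW h"
  shows "Vector_Spaces.linear sT sT (tensor_map sT \<tau> g h)"
    and "tensor_map sT \<tau> g h (\<tau> v w) = \<tau> (g v) (h w)"
proof -
  have "vector_space sT" using assms(1) unfolding is_tensor_product_def by simp
  moreover have "is_bilinear sV sW sT (\<lambda>v w. \<tau> (g v) (h w))"
    using is_tensor_product_bilinear[OF assms(1)] assms(2,3)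
    unfolding is_bilinear_def Vector_Spaces.linear_iff by auto
  ultimately have "\<exists>!F. Vector_Spaces.linear sT sT F \<and> (\<forall>v w. F (\<tau> v w) = \<tau> (g v) (h w))"
    by (rule is_tensor_product_universal[OF assms(1)])
  from theI'[OF this] show "Vector_Spaces.linear sT sT (tensor_map sT \<tau> g h)"
    and "tensor_map sT \<tau> g h (\<tau> v w) = \<tau> (g v) (h w)"
    unfolding tensor_map_def by blast+
qed

definition conjugate :: "('t \<Rightarrow> 't) \<Rightarrow> ('t \<Rightarrow> 't) \<Rightarrow> 't \<Rightarrow> 't" where
  "conjugate F A = F \<circ> A \<circ> inv F"


section \<open>Polynomial functions on a finite dimensional vector space\<close>

text \<open>
  Here \<open>U\<close> is a subspace of a vector space \<open>(E, s)\<close>; the definitions describe \<open>K[U]\<close> for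
  infinite \<open>K\<close> and finite dimensional \<open>U\<close>. A function \<open>U \<rightarrow> K\<close> is represented by its extension to
  \<open>E\<close> by zero, so that functions on \<open>U\<close> are equal iff their representatives are.
\<close>

definition linear_forms ::
  "('k::field \<Rightarrow> 'e::ab_group_add \<Rightarrow> 'e) \<Rightarrow> 'e set \<Rightarrow> ('e \<Rightarrow> 'k) set"
where
  "linear_forms s U =
     {l. (\<forall>x\<in>U. \<forall>y\<in>U. l (x + y) = l x + l y) \<and>
         (\<forall>c. \<forall>x\<in>U. l (s c x) = c * l x) \<and>
         (\<forall>x. x \<notin> U \<longrightarrow> l x = 0)}"

inductive_set polynomial_functions ::
  "('k::field \<Rightarrow> 'e::ab_group_add \<Rightarrow> 'e) \<Rightarrow> 'e set \<Rightarrow> ('e \<Rightarrow> 'k) set"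
  for s :: "'k::field \<Rightarrow> 'e::ab_group_add \<Rightarrow> 'e" and U :: "'e set"
where
  const: "(\<lambda>x. if x \<in> U then c else 0) \<in> polynomial_functions s U"
| linear_form: "l \<in> linear_forms s U \<Longrightarrow> l \<in> polynomial_functions s U"
| add: "f \<in> polynomial_functions s U \<Longrightarrow> g \<in> polynomial_functions s U \<Longrightarrow>
    (\<lambda>x. f x + g x) \<in> polynomial_functions s U"
| mult: "f \<in> polynomial_functions s U \<Longrightarrow> g \<in> polynomial_functions s U \<Longrightarrow>
    (\<lambda>x. f x * g x) \<in> polynomial_functions s U"

text \<open>The polynomial functions on \<open>U\<close> that are homogeneous of degree \<open>n\<close>:\<close>

definition homogeneous_functions ::
  "('k::field \<Rightarrow> 'e::ab_group_add \<Rightarrow> 'e) \<Rightarrow> 'e set \<Rightarrow> nat \<Rightarrow> ('e \<Rightarrow> 'k) set"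
where
  "homogeneous_functions s U n =
     module.span (scale_fun (*))
       {(\<lambda>x. if x \<in> U then (\<Prod>i<n. l i x) else 0) |l. \<forall>i<n. l i \<in> linear_forms s U}"

definition invariant_functions ::
  "('k::field \<Rightarrow> 'e::ab_group_add \<Rightarrow> 'e) \<Rightarrow> 'e set \<Rightarrow> ('e \<Rightarrow> 'e) set \<Rightarrow> ('e \<Rightarrow> 'k) set"
where
  "invariant_functions s U G =
     {f \<in> polynomial_functions s U. \<forall>a\<in>G. \<forall>x\<in>U. f (a x) = f x}"

text \<open>
  The Hilbert series of a graded subring \<open>A\<close> of \<open>K[U]\<close>, whose component of degree \<open>n\<close> is the
  intersection of \<open>A\<close> with the homogeneous functions of degree \<open>n\<close>.
\<close>

definition hilbert_series ::
  "('k::field \<Rightarrow> 'e::ab_group_add \<Rightarrow> 'e) \<Rightarrow> 'e set \<Rightarrow> ('e \<Rightarrow> 'k) set \<Rightarrow> int fps"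
where
  "hilbert_series s U A =
     Abs_fps (\<lambda>n. int (vector_space.dim (scale_fun (*)) (A \<inter> homogeneous_functions s U n)))"

text \<open>
  \<open>K[End(V \<otimes> W)]\<^sup>G\<close> for \<open>G = GL(V) \<times> GL(W)\<close>, where \<open>(T, \<tau>)\<close> is a tensor product of \<open>(V, sV)\<close>
  and \<open>(W, sW)\<close>.
\<close>

definition tensor_End_invariants ::
  "('k::field \<Rightarrow> 'v::ab_group_add \<Rightarrow> 'v) \<Rightarrow> ('k \<Rightarrow> 'w::ab_group_add \<Rightarrow> 'w) \<Rightarrow>
   ('k \<Rightarrow> 't::ab_group_add \<Rightarrow> 't) \<Rightarrow> ('v \<Rightarrow> 'w \<Rightarrow> 't) \<Rightarrow> (('t \<Rightarrow> 't) \<Rightarrow> 'k) set"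
where
  "tensor_End_invariants sV sW sT \<tau> =
     invariant_functions (scale_fun sT) (endomorphisms sT)
       {conjugate (tensor_map sT \<tau> g h) |g h.
          g \<in> general_linear_group sV \<and> h \<in> general_linear_group sW}"

end

theory Submission
  imports Defs
    "HOL-Computational_Algebra.Polynomial"
    "HOL-Computational_Algebra.Primes"
    "HOL-Library.Poly_Mapping"
    "HOL-Library.Product_Plus"
    "HOL-Library.Product_Lexorder"
begin

text \<open>
  Choose bases of \<open>V\<close> and \<open>W\<close>. An endomorphism of \<open>V \<otimes> W\<close> is then a family of 16 matrix
  entries, \<open>K[End(V \<otimes> W)]\<close> is the polynomial ring in these entries, and a pair of invertible
  matrices acts on it by conjugation. As a representation, \<open>End(V \<otimes> W)\<close> is
  \<open>(1 + 3) \<otimes> (1 + 3')\<close>, where \<open>3\<close> and \<open>3'\<close> are the adjoint representations of the two copies of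
  \<open>sl(2)\<close>. Give the entry in row \<open>(i, j)\<close> and column \<open>(i', j')\<close> the weight \<open>(i - i', j - j')\<close>, and let
  \<open>m n p\<close> be the number of monomials of degree \<open>n\<close> and weight \<open>p\<close>.
  
  Representation theory reduces the problem to these numbers. A polynomial is invariant iff it has
  weight \<open>(0, 0)\<close> and is killed by the raising operators \<open>E\<close> of both copies of \<open>sl(2)\<close>
  (\<open>matrix_invariants_eq\<close>). In characteristic zero \<open>E\<close> maps the space of weight 0 onto the space of
  weight 1 (\<open>E_surjective\<close>), so its kernel has dimension \<open>m(0) - m(1)\<close>. As the two copies commute,
  this can be applied twice, and the invariants of degree \<open>n\<close> have dimension
  \<open>m n (0,0) - m n (1,0) - m n (0,1) + m n (1,1)\<close> (\<open>dim_highest_weight_invariants\<close>).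
  
  The generating function of the \<open>m n p\<close> is \<open>P = \<Prod> 1 / (1 - x z\<^sup>a w\<^sup>b)\<close>, with one factor for each of the
  16 entries, \<open>(a, b)\<close> being its weight. The Hilbert series is therefore the constant term in \<open>z\<close> and
  \<open>w\<close> of \<open>(1 - 1/z) (1 - 1/w) P\<close>. A partial fraction decomposition in \<open>w\<close> splits \<open>(1 - 1/w) P\<close> into
  a part without \<open>w\<close>, a part with positive powers of \<open>w\<close> only, and a part with negative powers only
  (\<open>inner_partial_fractions\<close>). A decomposition in \<open>z\<close> treats the first part in the same way
  (\<open>outer_partial_fractions\<close>), and what remains is the asserted function of \<open>x\<close>. Both
  decompositions are polynomial identities with explicit numerators, and they are used in the ring of
  power series in \<open>x\<close> over the Laurent polynomials in \<open>z\<close> and \<open>w\<close>, where taking the constant term is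
  linear over \<open>\<int>[[x]]\<close> (\<open>const_term_inverse_product\<close>).
\<close>

section \<open>Dimensions of images and kernels\<close>

lemma (in vector_space) dim_injective_image:
  assumes "vector_space s2" "Vector_Spaces.linear scale s2 f" "inj_on f (span S)"
  shows "vector_space.dim s2 (f ` S) = dim S"
proof -
  interpret vs2: vector_space s2 by fact
  interpret lf: Vector_Spaces.linear scale s2 f by fact
  obtain B where B: "B \<subseteq> S" "independent B" "S \<subseteq> span B" "card B = dim S"
    using basis_exists[of S] by auto
  have span: "span S = span B"
    using B span_mono[of B S] span_mono[of S "span B"] span_span[of B] by auto
  have "card (f ` B) = card B"
    using assms(3) B span_superset[of S] by (metis card_image inj_on_subset subset_trans)
  moreover have "vs2.independent (f ` B)"
    using lf.dependent_inj_imageD[of B] B(2) assms(3) span by auto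
  moreover have "vs2.span (f ` S) = vs2.span (f ` B)"
    using lf.span_image[of S] lf.span_image[of B] span by simp
  ultimately show ?thesis
    by (metis B(4) vs2.dim_eq_card_independent vs2.dim_span)
qed

text \<open>
  Rank and nullity for a map that is linear on \<open>S\<close> only. A basis of \<open>S\<close> that extends a basis of the
  kernel turns \<open>f\<close> into a linear map \<open>g\<close> on the whole space, and the basis vectors outside the kernel
  have independent images because the two parts of a basis span subspaces that meet in 0.
\<close>

lemma (in vector_space) dim_kernel_image:
  assumes S: "subspace S" and fin: "finite A" "S \<subseteq> span A"
    and add: "\<And>x y. x \<in> S \<Longrightarrow> y \<in> S \<Longrightarrow> f (x + y) = f x + f y"
    and scale: "\<And>c x. x \<in> S \<Longrightarrow> f (scale c x) = scale c (f x)"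
  shows "dim S = dim {x \<in> S. f x = 0} + dim (f ` S)"
proof -
  let ?K = "{x \<in> S. f x = 0}"
  have f0: "f 0 = 0" using scale[of 0 0] subspace_0[OF S] by simp
  obtain B where B: "B \<subseteq> ?K" "independent B" "?K \<subseteq> span B" "card B = dim ?K"
    using basis_exists[of ?K] by auto
  obtain C where C: "B \<subseteq> C" "C \<subseteq> S" "independent C" "S \<subseteq> span C"
    using maximal_independent_subset_extend[of B S] B by auto
  have finC: "finite C"
    using independent_span_bound[OF fin(1) C(3)] C(2) fin(2) by auto
  have spanC: "span C = S"
    using C S by (simp add: span_minimal subset_antisym)
  interpret vp: vector_space_pair scale scale ..
  define g where "g = vp.construct C f"
  interpret g: Vector_Spaces.linear scale scale g
    unfolding g_def by (rule vp.linear_construct[OF C(3)])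
  have gf: "g x = f x" if "x \<in> S" for x
  proof -
    have "x \<in> S \<and> g x = f x" if "x \<in> span C" using that
    proof (induction rule: span_induct_alt)
      case base
      then show ?case using S by (simp add: subspace_0 g.zero f0)
    next
      case (step c x y)
      have "g x = f x" using vp.construct_basis[OF C(3) step(1)] by (simp add: g_def)
      moreover have "x \<in> S" using C(2) step by auto
      ultimately show ?case
        using step S by (auto simp: g.add g.scale add scale subspace_add subspace_scale)
    qed
    then show ?thesis using that spanC by simp
  qed
  have "inj_on g (span (C - B))"
  proof (subst g.inj_on_iff_eq_0)
    show "subspace (span (C - B))" by simp
    show "\<forall>x\<in>span (C - B). g x = 0 \<longrightarrow> x = 0"
    proof (intro ballI impI)
      fix x assume x: "x \<in> span (C - B)" "g x = 0"
      have xS: "x \<in> S" using x(1) span_mono[of "C - B" C] spanC by auto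
      then have xB: "x \<in> span B" using x gf B(3) by auto
      have "representation C x b = 0" for b
      proof (cases "b \<in> B")
        case True
        have "representation C x = representation (C - B) x"
          by (rule representation_extend[OF C(3) x(1)]) auto
        then show ?thesis using True representation_ne_zero[of "C - B" x b] by auto
      next
        case False
        have "representation C x = representation B x"
          by (rule representation_extend[OF C(3) xB C(1)])
        then show ?thesis using False representation_ne_zero[of B x b] by auto
      qed
      moreover have "(\<Sum>b | representation C x b \<noteq> 0. scale (representation C x b) b) = x"
        by (rule sum_nonzero_representation_eq[OF C(3)]) (use xS spanC in simp)
      ultimately show "x = 0" by simp
    qed
  qed
  moreover have "independent (C - B)" using C(3) by (rule independent_mono) auto
  ultimately have ind: "independent (g ` (C - B))"
    using g.dependent_inj_imageD by blast
  have "f ` S = span (g ` (C - B))"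
  proof -
    have "f ` S = g ` span C" using gf spanC by force
    also have "\<dots> = span (g ` C)" by (simp add: g.span_image)
    also have "\<dots> = span (g ` (C - B))"
    proof (rule subset_antisym)
      have "g ` C \<subseteq> insert 0 (g ` (C - B))"
        using B(1) gf by auto
      then show "span (g ` C) \<subseteq> span (g ` (C - B))"
        using span_mono[of "g ` C" "insert 0 (g ` (C - B))"] by (simp add: span_insert_0)
    qed (auto intro!: span_mono)
    finally show ?thesis .
  qed
  then have "dim (f ` S) = card (g ` (C - B))"
    using ind by (simp add: dim_eq_card_independent)
  also have "\<dots> = card (C - B)"
    using \<open>inj_on g (span (C - B))\<close> by (intro card_image) (meson inj_on_subset span_superset)
  also have "\<dots> = card C - card B"
    using C(1) finC by (simp add: card_Diff_subset finite_subset)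
  finally have "dim (f ` S) = card C - card B" .
  moreover have "dim S = card C"
    using dim_eq_card_independent[OF C(3)] spanC dim_span[of C] by simp
  moreover have "card B \<le> card C" using C(1) finC by (simp add: card_mono)
  ultimately show ?thesis using B(4) by simp
qed

interpretation fun_space: vector_space "scale_fun (*) :: 'k::field \<Rightarrow> ('x \<Rightarrow> 'k) \<Rightarrow> 'x \<Rightarrow> 'k"
  by (rule vector_space_scale_fun[OF vector_space_mult])

lemma scale_fun_apply: "scale_fun s c f x = s c (f x)"
  by (simp add: scale_fun_def)

section \<open>Weight spaces of representations of sl(2)\<close>

text \<open>
  The action of \<open>sl(2)\<close> on a sum of weight spaces. Weights are counted in multiples of the root, so
  \<open>[E, F]\<close> acts on \<open>N j\<close> as multiplication by \<open>2 j\<close>. Linearity is required on each \<open>N j\<close> separately,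
  as the operators below are linear on polynomial functions but not on all functions. Boundedness of
  the weights makes \<open>E\<close> and \<open>F\<close> nilpotent.
\<close>

locale sl2_weight_spaces = vector_space scale
  for scale :: "'k::field_char_0 \<Rightarrow> 'b::ab_group_add \<Rightarrow> 'b" +
  fixes N :: "int \<Rightarrow> 'b set" and E F :: "'b \<Rightarrow> 'b" and b :: int
  assumes sub: "subspace (N j)"
    and E_in: "v \<in> N j \<Longrightarrow> E v \<in> N (j + 1)" and F_in: "v \<in> N j \<Longrightarrow> F v \<in> N (j - 1)"
    and E_add: "u \<in> N j \<Longrightarrow> v \<in> N j \<Longrightarrow> E (u + v) = E u + E v"
    and E_scale: "v \<in> N j \<Longrightarrow> E (scale c v) = scale c (E v)"
    and F_add: "u \<in> N j \<Longrightarrow> v \<in> N j \<Longrightarrow> F (u + v) = F u + F v"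
    and F_scale: "v \<in> N j \<Longrightarrow> F (scale c v) = scale c (F v)"
    and commutator: "v \<in> N j \<Longrightarrow> E (F v) - F (E v) = scale (2 * of_int j) v"
    and bounded: "v \<in> N j \<Longrightarrow> \<bar>j\<bar> > b \<Longrightarrow> v = 0"
begin

text \<open>
  The symmetry that exchanges raising and lowering operators.
\<close>

lemma opposite_weight_spaces: "sl2_weight_spaces scale (\<lambda>j. N (- j)) F E b"
proof unfold_locales
  fix v j assume v: "v \<in> N (- j)"
  show "E v \<in> N (- (j - 1))" "F v \<in> N (- (j + 1))"
    using E_in[OF v] F_in[OF v] by (simp_all add: algebra_simps minus_diff_commute)
  show "F (E v) - E (F v) = scale (2 * of_int j) v"
    using commutator[OF v] by (simp add: algebra_simps)
qed (use sub E_add E_scale F_add F_scale bounded[of _ "- j" for j] in \<open>auto simp: \<close>)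

lemma power_E_in: "v \<in> N j \<Longrightarrow> (E ^^ n) v \<in> N (j + int n)"
proof (induction n)
  case (Suc n)
  then show ?case using E_in[of "(E ^^ n) v" "j + int n"] by (simp add: algebra_simps)
qed simp

lemma power_E_add: "u \<in> N j \<Longrightarrow> v \<in> N j \<Longrightarrow> (E ^^ n) (u + v) = (E ^^ n) u + (E ^^ n) v"
  by (induction n) (simp_all add: E_add[OF power_E_in power_E_in])

lemma power_E_scale: "v \<in> N j \<Longrightarrow> (E ^^ n) (scale c v) = scale c ((E ^^ n) v)"
  by (induction n) (simp_all add: E_scale[OF power_E_in])

lemma power_E_vanishes: "v \<in> N j \<Longrightarrow> \<exists>n. (E ^^ n) v = 0"
  using bounded[OF power_E_in[of v j "nat (\<bar>j\<bar> + \<bar>b\<bar> + 1)"]] by fastforce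

text \<open>
  Moving \<open>F\<close> past \<open>n + 1\<close> factors \<open>E\<close> adds up the weights \<open>2 j, 2 (j + 1), \<dots>, 2 (j + n)\<close>, whose
  sum is \<open>(n + 1) (2 j + n)\<close>.
\<close>

lemma power_commutator:
  assumes v: "v \<in> N j"
  shows "(E ^^ Suc n) (F v) = F ((E ^^ Suc n) v) +
    scale (of_nat (Suc n) * (2 * of_int j + of_nat n)) ((E ^^ n) v)"
proof (induction n)
  case 0
  then show ?case using commutator[OF v] by (simp add: algebra_simps)
next
  case (Suc n)
  let ?c = "of_nat (Suc n) * (2 * of_int j + of_nat n) :: 'k"
  let ?d = "2 * of_int (j + int (Suc n)) :: 'k"
  have in1: "(E ^^ Suc n) v \<in> N (j + int (Suc n))" by (rule power_E_in[OF v])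
  have in2: "F ((E ^^ Suc n) v) \<in> N (j + int n)" using F_in[OF in1] by simp
  have in3: "(E ^^ n) v \<in> N (j + int n)" by (rule power_E_in[OF v])
  have "(E ^^ Suc (Suc n)) (F v) = E (F ((E ^^ Suc n) v) + scale ?c ((E ^^ n) v))"
    using Suc by simp
  also have "\<dots> = E (F ((E ^^ Suc n) v)) + scale ?c ((E ^^ Suc n) v)"
    using E_add[OF in2] E_scale[OF in3] sub in3 by (simp add: subspace_scale)
  also have "E (F ((E ^^ Suc n) v)) = F ((E ^^ Suc (Suc n)) v) + scale ?d ((E ^^ Suc n) v)"
    using commutator[OF in1] by (simp add: algebra_simps)
  also have "F ((E ^^ Suc (Suc n)) v) + scale ?d ((E ^^ Suc n) v) + scale ?c ((E ^^ Suc n) v)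
      = F ((E ^^ Suc (Suc n)) v) + scale (?d + ?c) ((E ^^ Suc n) v)"
    by (simp only: scale_left_distrib add.assoc)
  also have "?d + ?c = of_nat (Suc (Suc n)) * (2 * of_int j + of_nat (Suc n))"
    by (simp add: algebra_simps)
  finally show ?case .
qed

lemma commutator_coefficient_nonzero:
  "j > 0 \<Longrightarrow> of_nat (Suc n) * (2 * of_int j + of_nat n) \<noteq> (0 :: 'k)"
proof -
  assume "j > 0"
  then have "of_int (2 * j + int n) \<noteq> (0 :: 'k)" unfolding of_int_eq_0_iff by simp
  then show ?thesis by (simp del: of_nat_Suc)
qed

text \<open>
  Induction on the number \<open>n\<close> with \<open>E\<^sup>n v = 0\<close>. If \<open>E\<^sup>n\<^sup>+\<^sup>1 v = 0\<close>, then \<open>power_commutator\<close> gives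
  \<open>E\<^sup>n (E F v) = c E\<^sup>n v\<close> with a coefficient \<open>c\<close> that is nonzero since \<open>v\<close> has positive weight. So
  \<open>v - E F v / c\<close> is killed by \<open>E\<^sup>n\<close>, hence lies in the image of \<open>E\<close>, and then so does \<open>v\<close>.
\<close>

lemma E_surjective:
  assumes "v \<in> N (j + 1)" "j \<ge> 0"
  shows "\<exists>u \<in> N j. E u = v"
proof -
  obtain n where "(E ^^ n) v = 0" using power_E_vanishes assms(1) by blast
  then show ?thesis using assms(1)
  proof (induction n arbitrary: v)
    case 0
    then show ?case using sub[of j] E_scale[of 0 j 0] by (auto simp: subspace_0 intro!: bexI[of _ 0])
  next
    case (Suc n)
    \<comment> \<open>The coefficient from \<open>power_commutator\<close> for \<open>v\<close>, which has weight \<open>j + 1\<close>.\<close>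
    let ?c = "of_nat (Suc n) * (2 * of_int (j + 1) + of_nat n) :: 'k"
    have c: "?c \<noteq> 0" using assms(2) by (intro commutator_coefficient_nonzero) simp
    have Fv: "F v \<in> N j" using F_in[OF Suc.prems(2)] by simp
    let ?u = "scale (- 1 / ?c) (F v)"
    have u: "?u \<in> N j" using Fv sub by (intro subspace_scale)
    have Eu: "E ?u = scale (- 1 / ?c) (E (F v))" by (rule E_scale[OF Fv])
    have EF: "E (F v) \<in> N (j + 1)" by (rule E_in[OF Fv])
    have F0: "F 0 = 0" using F_scale[of 0 j 0] sub[of j] by (simp add: subspace_0)
    have "(E ^^ n) (E (F v)) = (E ^^ Suc n) (F v)" by (simp add: funpow_swap1)
    also have "\<dots> = scale ?c ((E ^^ n) v)"
      unfolding power_commutator[OF Suc.prems(2)] Suc.prems(1) F0 by simp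
    finally have EnF: "(E ^^ n) (E (F v)) = scale ?c ((E ^^ n) v)" .
    have cc: "- 1 / d * d = - 1" if "d \<noteq> 0" for d :: 'k using that by simp
    have "(E ^^ n) (v + E ?u) = (E ^^ n) v + scale (- 1 / ?c) (scale ?c ((E ^^ n) v))"
      using power_E_add[OF Suc.prems(2) E_in[OF u], of n] power_E_scale[OF EF, of n "- 1 / ?c"]
      by (simp only: Eu EnF)
    also have "\<dots> = (E ^^ n) v + scale (- 1) ((E ^^ n) v)"
      by (simp only: scale_scale cc[OF c])
    finally have "(E ^^ n) (v + E ?u) = 0" by simp
    moreover have "v + E ?u \<in> N (j + 1)"
      using Suc.prems(2) E_in[OF u] sub by (simp add: subspace_add)
    ultimately obtain u' where u': "u' \<in> N j" "E u' = v + E ?u" using Suc.IH by blast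
    have "E (u' + scale (- 1) ?u) = v"
      using u' u sub by (simp only: E_add[OF u'(1) subspace_scale[OF sub u]] E_scale[OF u]) simp
    moreover have "u' + scale (- 1) ?u \<in> N j"
      by (rule subspace_add[OF sub u'(1) subspace_scale[OF sub u]])
    ultimately show ?case by blast
  qed
qed

text \<open>
  If \<open>F v = 0\<close> then \<open>E\<^sup>n\<^sup>+\<^sup>1 F v = 0\<close>, and \<open>power_commutator\<close> shows that \<open>E\<^sup>n\<^sup>+\<^sup>1 v = 0\<close> implies
  \<open>E\<^sup>n v = 0\<close>. Starting from a large \<open>n\<close> this descends to \<open>v = 0\<close>.
\<close>

lemma lowest_weight_not_positive:
  assumes v: "v \<in> N j" and "j > 0" "F v = 0"
  shows "v = 0"
proof -
  obtain n where "(E ^^ n) v = 0" using power_E_vanishes v by blast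
  then show ?thesis
  proof (induction n)
    case (Suc n)
    have F0: "F 0 = 0" using F_scale[of 0 j 0] sub[of j] by (simp add: subspace_0)
    have "(E ^^ m) 0 = 0" for m
      using power_E_scale[of 0 j m 0] sub[of j] by (simp add: subspace_0)
    then have "scale (of_nat (Suc n) * (2 * of_int j + of_nat n)) ((E ^^ n) v) = 0"
      using power_commutator[OF v, of n] Suc.prems assms(3) F0 by (simp del: funpow.simps)
    then have "(E ^^ n) v = 0"
      using commutator_coefficient_nonzero[OF assms(2), of n] by (simp only: scale_eq_0_iff) simp
    then show ?case by (rule Suc.IH)
  qed simp
qed

text \<open>
  The vector \<open>F v\<close> has weight -1, and \<open>E F v = F E v = 0\<close> since the commutator vanishes on weight 0.
  So \<open>F v\<close> is a highest weight vector of negative weight, which is 0 by the opposite of the previous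
  lemma.
\<close>

lemma highest_weight_0_invariant:
  assumes v: "v \<in> N 0" and "E v = 0"
  shows "F v = 0"
proof -
  interpret op: sl2_weight_spaces scale "\<lambda>j. N (- j)" F E b by (rule opposite_weight_spaces)
  have "F 0 = 0" using F_scale[of 0 0 0] sub[of 0] by (simp add: subspace_0)
  then have "E (F v) = 0" using commutator[OF v] assms(2) by simp
  then show ?thesis
    using op.lowest_weight_not_positive[of "F v" 1] F_in[OF v] by simp
qed

lemma dim_invariants:
  assumes "finite A" "N 0 \<subseteq> span A"
  shows "dim (N 0) = dim {v \<in> N 0. E v = 0} + dim (N 1)"
proof -
  have "E ` N 0 = N 1"
    using E_in[of _ 0] E_surjective[of _ 0] by force
  then show ?thesis
    using dim_kernel_image[OF sub assms, of E] E_add[of _ 0] E_scale[of _ 0] by simp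
qed

end

section \<open>Monomials and their weights\<close>

text \<open>
  A monomial in variables indexed by \<open>'i\<close> is represented by the multiset of its variables.
\<close>

definition weight :: "('i \<Rightarrow> int \<times> int) \<Rightarrow> 'i multiset \<Rightarrow> int \<times> int" where
  "weight wt M = (\<Sum>i\<in>#M. wt i)"

lemma weight_simps [simp]: "weight wt {#} = 0" "weight wt (add_mset i M) = wt i + weight wt M"
  by (simp_all add: weight_def)

lemma finite_multisets_of_size:
  assumes "finite J"
  shows "finite {M. size M = n \<and> set_mset M \<subseteq> J}"
proof (rule finite_subset)
  show "{M. size M = n \<and> set_mset M \<subseteq> J} \<subseteq> mset ` {xs. set xs \<subseteq> J \<and> length xs = n}"
  proof
    fix M assume M: "M \<in> {M. size M = n \<and> set_mset M \<subseteq> J}"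
    obtain xs where "mset xs = M" using ex_mset by blast
    then show "M \<in> mset ` {xs. set xs \<subseteq> J \<and> length xs = n}" using M by auto
  qed
  show "finite (mset ` {xs. set xs \<subseteq> J \<and> length xs = n})"
    using finite_lists_length_eq[OF assms, of n] by simp
qed

definition weight_count :: "('i \<Rightarrow> int \<times> int) \<Rightarrow> nat \<Rightarrow> int \<times> int \<Rightarrow> nat" where
  "weight_count wt n p = card {M. size M = n \<and> weight wt M = p}"

definition monomial :: "'i multiset \<Rightarrow> ('i \<Rightarrow> 'k::comm_monoid_mult) \<Rightarrow> 'k" where
  "monomial M x = (\<Prod>i\<in>#M. x i)"

lemma monomial_simps [simp]: "monomial {#} = (\<lambda>x. 1)" "monomial (add_mset i M) = (\<lambda>x. x i * monomial M x)"
  by (simp_all add: monomial_def fun_eq_iff)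

lemma ex_inj_primes: "\<exists>q :: 'i::finite \<Rightarrow> nat. inj q \<and> (\<forall>i. prime (q i))"
proof -
  obtain B where B: "finite B" "card B = card (UNIV :: 'i set)" "B \<subseteq> {p::nat. prime p}"
    using infinite_arbitrarily_large[OF primes_infinite] by blast
  then obtain q :: "'i \<Rightarrow> nat" where "bij_betw q UNIV B"
    using finite_same_card_bij[of "UNIV :: 'i set" B] by auto
  then have "inj q" "\<forall>i. q i \<in> B" by (auto simp: bij_betw_def)
  then show ?thesis using B(3) by blast
qed

text \<open>
  A relation between all power sums is a relation between the values of all polynomials. The
  polynomial that vanishes at every \<open>a l\<close> other than \<open>a m\<close> isolates the coefficient \<open>c m\<close>.
\<close>

lemma power_sums_independent:
  fixes c :: "'a \<Rightarrow> 'k::idom"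
  assumes "finite S" "inj_on a S" "\<And>t::nat. (\<Sum>m\<in>S. c m * a m ^ t) = 0" "m \<in> S"
  shows "c m = 0"
proof -
  have poly: "(\<Sum>m\<in>S. c m * poly q (a m)) = 0" for q
  proof -
    have "(\<Sum>m\<in>S. c m * poly q (a m)) = (\<Sum>t\<le>degree q. coeff q t * (\<Sum>m\<in>S. c m * a m ^ t))"
      by (simp add: poly_altdef sum_distrib_left sum.swap[of _ S] mult_ac)
    then show ?thesis by (simp add: assms(3))
  qed
  let ?q = "\<Prod>l\<in>S - {m}. [:- a l, 1:]"
  have "(\<Sum>l\<in>S. c l * poly ?q (a l)) = c m * poly ?q (a m)"
  proof (subst sum.remove[OF assms(1,4)], simp, rule sum.neutral, rule ballI)
    fix l assume "l \<in> S - {m}"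
    then have "(\<Prod>k\<in>S - {m}. poly [:- a k, 1:] (a l)) = 0"
      using assms(1) by (intro prod_zero) auto
    then show "c l * poly ?q (a l) = 0" by (simp add: poly_prod)
  qed
  moreover have "poly ?q (a m) \<noteq> 0"
    using assms(1,2,4) by (auto simp: poly_prod prod_zero_iff inj_on_def)
  ultimately show ?thesis using poly[of ?q] by (metis mult_eq_0_iff)
qed

text \<open>
  Substitute for the variables the \<open>t\<close>-th powers of distinct primes. By unique factorization the
  monomials take the values \<open>a M ^ t\<close> with distinct natural numbers \<open>a M\<close>, which stay distinct in
  characteristic zero, and a vanishing combination for all \<open>t\<close> has zero coefficients.
\<close>

lemma monomials_independent:
  fixes c :: "'i::finite multiset \<Rightarrow> 'k::field_char_0"
  assumes "finite S" "\<And>x. (\<Sum>M\<in>S. c M * monomial M x) = 0" "M \<in> S"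
  shows "c M = 0"
proof -
  obtain q :: "'i \<Rightarrow> nat" where q: "inj q" "\<And>i. prime (q i)" using ex_inj_primes by blast
  define a where "a M = (\<Prod>i\<in>#M. q i)" for M
  have "prime_factorization (a M) = image_mset q M" for M
    unfolding a_def by (rule prime_factorization_prod_mset_primes) (auto simp: q)
  then have inj: "inj a"
  proof (intro injI)
    fix M M' assume "a M = a M'"
    then have "image_mset q M = image_mset q M'"
      using \<open>\<And>M. prime_factorization (a M) = image_mset q M\<close> by metis
    then have "image_mset (inv q) (image_mset q M) = image_mset (inv q) (image_mset q M')" by simp
    then show "M = M'" using q(1) by (simp add: multiset.map_comp)
  qed
  have a: "monomial M (\<lambda>i. of_nat (q i) ^ t) = (of_nat (a M) :: 'k) ^ t" for M t
    by (induction M) (simp_all add: a_def power_mult_distrib)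
  show ?thesis
  proof (rule power_sums_independent[where a = "\<lambda>M. of_nat (a M) :: 'k"])
    show "(\<Sum>M\<in>S. c M * of_nat (a M) ^ t) = 0" for t
      using assms(2)[of "\<lambda>i. of_nat (q i) ^ t"] by (simp add: a)
    show "inj_on (\<lambda>M. of_nat (a M) :: 'k) S"
      using inj by (auto simp: inj_on_def inj_def)
  qed (use assms in auto)
qed

lemma inj_monomial: "inj (monomial :: 'i::finite multiset \<Rightarrow> ('i \<Rightarrow> 'k::field_char_0) \<Rightarrow> 'k)"
proof (rule injI, rule ccontr)
  fix M M' :: "'i multiset" assume eq: "monomial M = (monomial M' :: _ \<Rightarrow> 'k)" and "M \<noteq> M'"
  have "(if M = M then 1 else - 1 :: 'k) = 0"
    by (rule monomials_independent[where S = "{M, M'}" and c = "\<lambda>N. if N = M then 1 else - 1"])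
      (use \<open>M \<noteq> M'\<close> eq in auto)
  then show False by simp
qed

lemma sum_fun_apply: "(\<Sum>v\<in>T. F v) x = (\<Sum>v\<in>T. F v x)"
  by (induction T rule: infinite_finite_induct) auto

lemma independent_monomials:
  "fun_space.independent (monomial ` A :: (('i::finite \<Rightarrow> 'k::field_char_0) \<Rightarrow> 'k) set)"
proof
  assume "fun_space.dependent (monomial ` A :: (('i \<Rightarrow> 'k) \<Rightarrow> 'k) set)"
  then obtain T u v where T: "finite T" "T \<subseteq> monomial ` A" "(\<Sum>v\<in>T. scale_fun (*) (u v) v) = 0" "v \<in> T"
    and uv: "u v \<noteq> (0 :: 'k)"
    unfolding fun_space.dependent_explicit by blast
  have inj: "inj_on (monomial :: 'i multiset \<Rightarrow> ('i \<Rightarrow> 'k) \<Rightarrow> 'k) (monomial -` T)"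
    by (rule inj_on_subset[OF inj_monomial]) auto
  have img: "monomial ` (monomial -` T) = T" using T(2) by auto
  obtain M where M: "v = monomial M" using T by auto
  have fin: "finite (monomial -` T :: 'i multiset set)"
    using T(1) inj_monomial by (rule finite_vimageI)
  have sum: "(\<Sum>M\<in>monomial -` T. u (monomial M) * monomial M x) = 0" for x :: "'i \<Rightarrow> 'k"
  proof -
    have "(\<Sum>M\<in>monomial -` T. u (monomial M) * monomial M x) = (\<Sum>v\<in>T. u v * v x)"
      using sum.reindex[OF inj, of "\<lambda>v. u v * v x"] img by (simp add: comp_def)
    also have "\<dots> = (\<Sum>v\<in>T. scale_fun (*) (u v) v) x"
      by (simp add: sum_fun_apply scale_fun_def)
    finally show ?thesis by (simp add: T(3))
  qed
  have "M \<in> monomial -` T" using T(4) M by simp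
  from monomials_independent[of "monomial -` T" "\<lambda>M. u (monomial M)", OF fin sum this]
  show False using uv by (simp add: M)
qed

definition weight_space :: "('i \<Rightarrow> int \<times> int) \<Rightarrow> nat \<Rightarrow> int \<times> int \<Rightarrow> (('i \<Rightarrow> 'k::field) \<Rightarrow> 'k) set" where
  "weight_space wt n p = fun_space.span (monomial ` {M. size M = n \<and> weight wt M = p})"

lemma dim_weight_space:
  "fun_space.dim (weight_space wt n p :: (('i::finite \<Rightarrow> 'k::field_char_0) \<Rightarrow> 'k) set) = weight_count wt n p"
  unfolding weight_space_def weight_count_def
  by (subst fun_space.dim_span_eq_card_independent[OF independent_monomials], rule card_image)
    (rule inj_on_subset[OF inj_monomial], simp)

lemma subspace_weight_space: "fun_space.subspace (weight_space wt n p)"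
  by (simp add: weight_space_def)

lemma weight_space_add: "f \<in> weight_space wt n p \<Longrightarrow> g \<in> weight_space wt n p \<Longrightarrow> (\<lambda>x. f x + g x) \<in> weight_space wt n p"
  using fun_space.subspace_add[OF subspace_weight_space] by (simp add: plus_fun_def)

lemma weight_space_scale: "f \<in> weight_space wt n p \<Longrightarrow> (\<lambda>x. c * f x) \<in> weight_space wt n p"
  using fun_space.subspace_scale[OF subspace_weight_space] by (simp add: scale_fun_def)

lemma weight_space_0: "(\<lambda>x. 0) \<in> weight_space wt n p"
  using fun_space.subspace_0[OF subspace_weight_space] by (simp add: zero_fun_def)

lemma weight_space_diff: "f \<in> weight_space wt n p \<Longrightarrow> g \<in> weight_space wt n p \<Longrightarrow> (\<lambda>x. f x - g x) \<in> weight_space wt n p"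
  using weight_space_add[of f wt n p "\<lambda>x. (- 1) * g x"] weight_space_scale[of g wt n p "- 1"] by simp

lemma weight_space_coord:
  assumes "f \<in> weight_space wt n p"
  shows "(\<lambda>x. x i * f x) \<in> weight_space wt (Suc n) (wt i + p)"
  using assms unfolding weight_space_def
proof (induction rule: fun_space.span_induct_alt)
  case base
  then show ?case using weight_space_0 by (simp add: weight_space_def)
next
  case (step c f g)
  then obtain M where M: "f = monomial M" "size M = n" "weight wt M = p" by auto
  have "monomial (add_mset i M) \<in> monomial ` {M. size M = Suc n \<and> weight wt M = wt i + p}"
    using M by (intro imageI) simp
  from fun_space.span_base[OF this] have "(\<lambda>x. x i * f x) \<in> weight_space wt (Suc n) (wt i + p)"
    by (simp add: weight_space_def M)
  from weight_space_add[OF weight_space_scale[OF this, of c] step(2)[folded weight_space_def]]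
  have "(\<lambda>x. c * (x i * f x) + x i * g x) \<in> weight_space wt (Suc n) (wt i + p)" .
  moreover have "(\<lambda>x. x i * (scale_fun (*) c f + g) x) = (\<lambda>x. c * (x i * f x) + x i * g x)"
    by (simp add: scale_fun_apply algebra_simps)
  ultimately show ?case by (simp add: weight_space_def)
qed

text \<open>
  A weight space is obtained from constants by multiplying with variables and taking linear
  combinations. Properties of derivations are proved along this construction.
\<close>

lemma weight_space_induct [consumes 1, case_names zero one coord add scale]:
  assumes "f \<in> weight_space wt n p"
    and zero: "\<And>n p. P n p (\<lambda>x. 0)"
    and one: "P 0 0 (\<lambda>x. 1)"
    and coord: "\<And>n p i f. f \<in> weight_space wt n p \<Longrightarrow> P n p f \<Longrightarrow> P (Suc n) (wt i + p) (\<lambda>x. x i * f x)"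
    and add: "\<And>n p f g. f \<in> weight_space wt n p \<Longrightarrow> g \<in> weight_space wt n p \<Longrightarrow> P n p f \<Longrightarrow> P n p g \<Longrightarrow> P n p (\<lambda>x. f x + g x)"
    and scale: "\<And>n p c f. f \<in> weight_space wt n p \<Longrightarrow> P n p f \<Longrightarrow> P n p (\<lambda>x. c * f x)"
  shows "P n p f"
proof -
  have mono: "monomial M \<in> weight_space wt (size M) (weight wt M)" for M
    unfolding weight_space_def by (rule fun_space.span_base) auto
  have M: "P (size M) (weight wt M) (monomial M)" for M
  proof (induction M)
    case (add i M)
    then show ?case using coord[OF mono, of M i] by simp
  qed (use one in \<open>simp add: weight_def\<close>)
  have "f \<in> weight_space wt n p \<and> P n p f"
    using assms(1) unfolding weight_space_def
  proof (induction rule: fun_space.span_induct_alt)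
    case base
    then show ?case using zero weight_space_0 by (simp add: weight_space_def zero_fun_def)
  next
    case (step c f g)
    then have "P n p f" using M by auto
    moreover have "f \<in> weight_space wt n p" using step mono by auto
    ultimately have "P n p (\<lambda>x. c * f x)" "(\<lambda>x. c * f x) \<in> weight_space wt n p"
      by (auto intro: scale weight_space_scale)
    moreover have "P n p g" "g \<in> weight_space wt n p"
      using step by (simp_all add: weight_space_def)
    ultimately have "P n p (\<lambda>x. c * f x + g x)" "(\<lambda>x. c * f x + g x) \<in> weight_space wt n p"
      by (auto intro: add weight_space_add)
    moreover have "scale_fun (*) c f + g = (\<lambda>x. c * f x + g x)"
      by (rule ext) (simp add: scale_fun_apply)
    ultimately show ?case by (simp add: weight_space_def)
  qed
  then show ?thesis ..
qed

section \<open>Derivations generated by polynomial flows\<close>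

text \<open>
  Over an infinite field the polynomial in \<open>t\<close> to which a polynomial function restricts on a curve with
  polynomial coordinates is unique. So derivatives can be read off from this polynomial, and the
  function need not be given by an expression.
\<close>

definition polynomial_on_curves :: "(('i \<Rightarrow> 'k::field) \<Rightarrow> 'k) \<Rightarrow> bool" where
  "polynomial_on_curves f \<longleftrightarrow> (\<forall>\<gamma>. \<exists>p. \<forall>t. poly p t = f (\<lambda>i. poly (\<gamma> i) t))"

definition on_curve :: "(('i \<Rightarrow> 'k::field) \<Rightarrow> 'k) \<Rightarrow> ('i \<Rightarrow> 'k poly) \<Rightarrow> 'k poly" where
  "on_curve f \<gamma> = (THE p. \<forall>t. poly p t = f (\<lambda>i. poly (\<gamma> i) t))"

lemma on_curve_eqI:
  fixes f :: "('i \<Rightarrow> 'k::field_char_0) \<Rightarrow> 'k"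
  assumes "\<And>t. poly p t = f (\<lambda>i. poly (\<gamma> i) t)"
  shows "on_curve f \<gamma> = p"
  unfolding on_curve_def
proof (rule the_equality)
  fix q assume "\<forall>t. poly q t = f (\<lambda>i. poly (\<gamma> i) t)"
  then have "poly q = poly p" using assms by auto
  then show "q = p" by (simp add: poly_eq_poly_eq_iff)
qed (use assms in simp)

lemma poly_on_curve:
  fixes f :: "('i \<Rightarrow> 'k::field_char_0) \<Rightarrow> 'k"
  assumes "polynomial_on_curves f"
  shows "poly (on_curve f \<gamma>) t = f (\<lambda>i. poly (\<gamma> i) t)"
proof -
  obtain p where "\<And>t. poly p t = f (\<lambda>i. poly (\<gamma> i) t)"
    using assms unfolding polynomial_on_curves_def by blast
  moreover from this have "on_curve f \<gamma> = p" by (rule on_curve_eqI)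
  ultimately show ?thesis by simp
qed

lemma on_curve_coord: "on_curve (\<lambda>x. x i) \<gamma> = (\<gamma> i :: 'k::field_char_0 poly)"
  by (rule on_curve_eqI) simp

lemma polynomial_on_curves_weight_space:
  assumes "f \<in> weight_space wt n p"
  shows "polynomial_on_curves (f :: ('i \<Rightarrow> 'k::field_char_0) \<Rightarrow> 'k)"
  using assms
proof (induction rule: weight_space_induct)
  case (zero n p)
  then show ?case by (auto simp: polynomial_on_curves_def intro: exI[of _ 0])
next
  case one
  then show ?case by (auto simp: polynomial_on_curves_def intro: exI[of _ 1])
next
  case (coord n p i f)
  show ?case unfolding polynomial_on_curves_def
    by (intro allI, rule_tac x = "\<gamma> i * on_curve f \<gamma>" in exI) (simp add: poly_on_curve coord)
next
  case (add n p f g)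
  show ?case unfolding polynomial_on_curves_def
    by (intro allI, rule_tac x = "on_curve f \<gamma> + on_curve g \<gamma>" in exI) (simp add: poly_on_curve add)
next
  case (scale n p c f)
  show ?case unfolding polynomial_on_curves_def
    by (intro allI, rule_tac x = "smult c (on_curve f \<gamma>)" in exI) (simp add: poly_on_curve scale)
qed

lemma polynomial_on_curves_coord: "polynomial_on_curves (\<lambda>x. x i)"
  unfolding polynomial_on_curves_def by auto

lemma weight_space_mult:
  assumes "f \<in> weight_space wt n p" "g \<in> weight_space wt m q"
  shows "(\<lambda>x. f x * g x) \<in> weight_space wt (n + m) (p + q)"
  using assms(1)
proof (induction rule: weight_space_induct)
  case (zero n p)
  then show ?case using weight_space_0 by simp
next
  case one
  then show ?case using assms(2) by simp
next
  case (coord n p i f)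
  then show ?case using weight_space_coord[OF coord(2), of i] by (simp add: mult.assoc add.assoc)
next
  case (add n p f g)
  then show ?case using weight_space_add[OF add(3,4)] by (simp add: distrib_right)
next
  case (scale n p c f)
  then show ?case using weight_space_scale[OF scale(2), of c] by (simp add: mult.assoc)
qed

text \<open>
  \<open>u x\<close> is the orbit of \<open>x\<close> under a one-parameter group, with coordinates polynomial in the
  parameter. The operator \<open>generator u\<close> differentiates functions along these orbits at time 0; it is
  the action of the Lie algebra element that generates the group.
\<close>

definition generator :: "(('i \<Rightarrow> 'k) \<Rightarrow> 'i \<Rightarrow> 'k poly) \<Rightarrow> (('i \<Rightarrow> 'k) \<Rightarrow> 'k) \<Rightarrow> ('i \<Rightarrow> 'k) \<Rightarrow> 'k::field" where
  "generator u f x = coeff (on_curve f (u x)) 1"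

definition flow_at :: "(('i \<Rightarrow> 'k) \<Rightarrow> 'i \<Rightarrow> 'k poly) \<Rightarrow> 'k \<Rightarrow> ('i \<Rightarrow> 'k) \<Rightarrow> 'i \<Rightarrow> 'k::field" where
  "flow_at u t x i = poly (u x i) t"

text \<open>
  The last assumption says that the generator shifts the weights of the coordinate functions by \<open>\<delta>\<close>.
\<close>

locale polynomial_flow =
  fixes u :: "('i \<Rightarrow> 'k::field_char_0) \<Rightarrow> 'i \<Rightarrow> 'k poly" and wt :: "'i \<Rightarrow> int \<times> int" and \<delta> :: "int \<times> int"
  assumes flow_0: "flow_at u 0 x = x"
    and flow_flow: "flow_at u t (flow_at u s x) = flow_at u (s + t) x"
    and generator_coord_in: "generator u (\<lambda>x. x i) \<in> weight_space wt 1 (wt i + \<delta>)"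
begin

lemma generator_0: "generator u (\<lambda>x. 0) = (\<lambda>x. 0)"
  and generator_1: "generator u (\<lambda>x. 1) = (\<lambda>x. 0)"
proof -
  have "on_curve (\<lambda>x. 0) \<gamma> = 0" "on_curve (\<lambda>x. 1) \<gamma> = 1" for \<gamma> :: "'i \<Rightarrow> 'k poly"
    by (rule on_curve_eqI; simp)+
  then show "generator u (\<lambda>x. 0) = (\<lambda>x. 0)" "generator u (\<lambda>x. 1) = (\<lambda>x. 0)"
    by (simp_all add: generator_def fun_eq_iff)
qed

lemma generator_add:
  assumes "polynomial_on_curves f" "polynomial_on_curves g"
  shows "generator u (\<lambda>x. f x + g x) = (\<lambda>x. generator u f x + generator u g x)"
proof -
  have "on_curve (\<lambda>x. f x + g x) \<gamma> = on_curve f \<gamma> + on_curve g \<gamma>" for \<gamma>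
    by (rule on_curve_eqI) (simp add: poly_on_curve assms)
  then show ?thesis by (simp add: generator_def fun_eq_iff)
qed

lemma generator_scale:
  assumes "polynomial_on_curves f"
  shows "generator u (\<lambda>x. c * f x) = (\<lambda>x. c * generator u f x)"
proof -
  have "on_curve (\<lambda>x. c * f x) \<gamma> = smult c (on_curve f \<gamma>)" for \<gamma>
    by (rule on_curve_eqI) (simp add: poly_on_curve assms)
  then show ?thesis by (simp add: generator_def fun_eq_iff)
qed

lemma coeff_0_on_curve: "polynomial_on_curves f \<Longrightarrow> coeff (on_curve f (u x)) 0 = f x"
  using poly_on_curve[of f "u x" 0] flow_0[of x] by (simp add: poly_0_coeff_0 flow_at_def fun_eq_iff)

lemma generator_mult:
  assumes "polynomial_on_curves f" "polynomial_on_curves g"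
  shows "generator u (\<lambda>x. f x * g x) = (\<lambda>x. generator u f x * g x + f x * generator u g x)"
proof -
  have "on_curve (\<lambda>x. f x * g x) \<gamma> = on_curve f \<gamma> * on_curve g \<gamma>" for \<gamma>
    by (rule on_curve_eqI) (simp add: poly_on_curve assms)
  then show ?thesis
    by (simp add: generator_def fun_eq_iff coeff_mult coeff_0_on_curve assms add.commute)
qed

text \<open>
  The generator is a derivation, so it shifts the weight of every monomial by \<open>\<delta>\<close> as soon as it does
  so for the variables.
\<close>

lemma generator_in_weight_space:
  assumes "f \<in> weight_space wt n p"
  shows "generator u f \<in> weight_space wt n (p + \<delta>)"
  using assms
proof (induction rule: weight_space_induct)
  case (zero n p)
  then show ?case using weight_space_0 by (simp add: generator_0)
next
  case one
  then show ?case using weight_space_0 by (simp add: generator_1)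
next
  case (coord n p i f)
  have "generator u (\<lambda>x. x i * f x) = (\<lambda>x. generator u (\<lambda>x. x i) x * f x + x i * generator u f x)"
    using generator_mult[OF polynomial_on_curves_coord polynomial_on_curves_weight_space[OF coord(1)]] .
  moreover have "(\<lambda>x. generator u (\<lambda>x. x i) x * f x) \<in> weight_space wt (Suc n) (wt i + p + \<delta>)"
    using weight_space_mult[OF generator_coord_in coord(1), of i] by (simp add: add_ac)
  moreover have "(\<lambda>x. x i * generator u f x) \<in> weight_space wt (Suc n) (wt i + p + \<delta>)"
    using weight_space_coord[OF coord(2), of i] by (simp add: add_ac)
  ultimately show ?case by (simp add: weight_space_add)
next
  case (add n p f g)
  then show ?case by (simp add: generator_add polynomial_on_curves_weight_space weight_space_add)
next
  case (scale n p c f)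
  then show ?case by (simp add: generator_scale polynomial_on_curves_weight_space weight_space_scale)
qed

text \<open>
  By the group law the derivative of \<open>t \<mapsto> f (u\<^sub>t x)\<close> at time \<open>s\<close> is the generator applied to \<open>f\<close>
  at the point \<open>u\<^sub>s x\<close>. If it vanishes for all \<open>s\<close>, the polynomial is constant, as the
  characteristic is zero.
\<close>

lemma invariant_if_generator_0:
  assumes f: "polynomial_on_curves f" and gen: "\<And>x. generator u f x = 0"
  shows "f (flow_at u t x) = f x"
proof -
  let ?p = "on_curve f (u x)"
  have "poly (pderiv ?p) s = 0" for s
  proof -
    have "on_curve f (u (flow_at u s x)) = pcompose ?p [:s, 1:]"
    proof (rule on_curve_eqI)
      fix t
      have "poly (pcompose ?p [:s, 1:]) t = f (flow_at u (s + t) x)"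
        by (simp add: poly_pcompose poly_on_curve[OF f] flow_at_def[abs_def])
      also have "\<dots> = f (flow_at u t (flow_at u s x))" by (simp add: flow_flow)
      finally show "poly (pcompose ?p [:s, 1:]) t = f (\<lambda>i. poly (u (flow_at u s x) i) t)"
        by (simp add: flow_at_def[abs_def])
    qed
    then have "coeff (pcompose ?p [:s, 1:]) 1 = 0"
      using gen[of "flow_at u s x"] by (simp add: generator_def)
    moreover have "coeff q 1 = poly (pderiv q) 0" for q :: "'k poly"
      by (simp add: poly_0_coeff_0 coeff_pderiv)
    ultimately show ?thesis by (simp add: pderiv_pcompose poly_pcompose pderiv_pCons)
  qed
  then have "poly (pderiv ?p) = poly 0" by auto
  then have "pderiv ?p = 0" by (simp only: poly_eq_poly_eq_iff)
  then obtain c where "?p = [:c:]" by (metis degree_eq_zeroE pderiv_eq_0_iff)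
  then show ?thesis
    using poly_on_curve[OF f, of "u x" t] poly_on_curve[OF f, of "u x" 0] flow_0[of x]
    by (simp add: flow_at_def[abs_def])
qed

lemma generator_0_if_invariant:
  assumes "\<And>t x. f (flow_at u t x) = f x"
  shows "generator u f x = 0"
proof -
  have "on_curve f (u x) = [:f x:]"
    by (rule on_curve_eqI) (use assms in \<open>simp add: flow_at_def[abs_def]\<close>)
  then show ?thesis by (simp add: generator_def fun_eq_iff)
qed

end

text \<open>
  The commutator of two derivations is a derivation. If it multiplies each variable by \<open>c\<close> of its
  weight, where \<open>c\<close> is additive, it multiplies every monomial by \<open>c\<close> of its weight.
\<close>

lemma generator_commutator:
  assumes u: "polynomial_flow u wt \<delta>" and v: "polynomial_flow v wt \<epsilon>"
    and c: "c 0 = 0" "\<And>p q. c (p + q) = c p + c q"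
    and coord: "\<And>i x. generator u (generator v (\<lambda>x. x i)) x - generator v (generator u (\<lambda>x. x i)) x = c (wt i) * x i"
    and f: "f \<in> weight_space wt n p"
  shows "generator u (generator v f) x - generator v (generator u f) x = c p * f x"
proof -
  interpret u: polynomial_flow u wt \<delta> by fact
  interpret v: polynomial_flow v wt \<epsilon> by fact
  note pc = polynomial_on_curves_weight_space
  show ?thesis using f
  proof (induction arbitrary: x rule: weight_space_induct)
    case (coord n p i f)
    note X = polynomial_on_curves_coord[of i]
    note f = pc[OF coord(1)]
    note uf = pc[OF u.generator_in_weight_space[OF coord(1)]] pc[OF v.generator_in_weight_space[OF coord(1)]]
    note ui = pc[OF u.generator_coord_in[of i]] pc[OF v.generator_coord_in[of i]]
    have prod: "polynomial_on_curves (\<lambda>x. g x * h x)" if "polynomial_on_curves g" "polynomial_on_curves h"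
      for g h :: "('a \<Rightarrow> 'b) \<Rightarrow> 'b"
      unfolding polynomial_on_curves_def
      by (intro allI, rule_tac x = "on_curve g \<gamma> * on_curve h \<gamma>" in exI) (simp add: poly_on_curve that)
    have "generator u (generator v (\<lambda>x. x i * f x)) x - generator v (generator u (\<lambda>x. x i * f x)) x
       = (generator u (generator v (\<lambda>x. x i)) x - generator v (generator u (\<lambda>x. x i)) x) * f x
       + x i * (generator u (generator v f) x - generator v (generator u f) x)"
      by (simp add: u.generator_mult v.generator_mult u.generator_add v.generator_add X f uf ui prod algebra_simps)
    then show ?case using coord(2)[of x] assms(5)[of i x] by (simp add: c algebra_simps)
  next
    case (add n p f g)
    then show ?case
      by (simp add: u.generator_add v.generator_add pc pc[OF u.generator_in_weight_space] pc[OF v.generator_in_weight_space] algebra_simps)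
  next
    case (scale n p c f)
    then show ?case
      by (simp add: u.generator_scale v.generator_scale pc pc[OF u.generator_in_weight_space] pc[OF v.generator_in_weight_space] algebra_simps)
  qed (simp_all add: u.generator_0 u.generator_1 v.generator_0 v.generator_1 c)
qed

section \<open>Two commuting copies of sl(2) acting on polynomials in the matrix entries\<close>

text \<open>
  The index \<open>((i, i'), (j, j'))\<close> stands for the entry in row \<open>(i, j)\<close> and column \<open>(i', j')\<close> of an
  endomorphism of \<open>V \<otimes> W\<close>; \<open>False\<close> and \<open>True\<close> number the two basis vectors of each factor. Grouping
  the indices by factor lets \<open>prod.swap\<close> exchange the roles of \<open>V\<close> and \<open>W\<close>.
\<close>

type_synonym entry = "(bool \<times> bool) \<times> (bool \<times> bool)"

definition entry_weight :: "entry \<Rightarrow> int \<times> int" where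
  "entry_weight i = (of_bool (fst (fst i)) - of_bool (snd (fst i)), of_bool (fst (snd i)) - of_bool (snd (snd i)))"

definition swap_factors :: "(entry \<Rightarrow> 'k) \<Rightarrow> entry \<Rightarrow> 'k" where
  "swap_factors x = x \<circ> prod.swap"

text \<open>
  Conjugation by \<open>1 + t N\<close> on the factor \<open>End(V)\<close>, where \<open>N\<close> is the matrix unit in row \<open>b\<close> and column
  \<open>\<not> b\<close>: it maps \<open>X\<close> to \<open>X + t (N X - X N) - t\<^sup>2 N X N\<close>. The generator is the raising operator for
  \<open>b = False\<close> and the lowering operator for \<open>b = True\<close>.
\<close>

definition flow_V :: "bool \<Rightarrow> (entry \<Rightarrow> 'k::field) \<Rightarrow> entry \<Rightarrow> 'k poly" where
  "flow_V b x = (\<lambda>((i, i'), q).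
     [: x ((i, i'), q),
        (if i = b then x ((\<not> b, i'), q) else 0) - (if i' \<noteq> b then x ((i, b), q) else 0),
        if i = b \<and> i' \<noteq> b then - x ((\<not> b, b), q) else 0 :])"

definition flow_W :: "bool \<Rightarrow> (entry \<Rightarrow> 'k::field) \<Rightarrow> entry \<Rightarrow> 'k poly" where
  "flow_W b x e = flow_V b (swap_factors x) (prod.swap e)"

lemma generator_coord:
  fixes u :: "('i \<Rightarrow> 'k::field_char_0) \<Rightarrow> 'i \<Rightarrow> 'k poly"
  shows "generator u (\<lambda>x. x e) = (\<lambda>x. coeff (u x e) 1)"
  by (simp add: generator_def on_curve_coord fun_eq_iff)

lemma generator_flow_V:
  "generator (flow_V b) (\<lambda>x. x ((i, i'), q)) =
    (\<lambda>x. (if i = b then x ((\<not> b, i'), q) else 0) - (if i' \<noteq> b then x ((i, b), q) else 0) :: 'k::field_char_0)"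
  by (simp add: generator_coord flow_V_def fun_eq_iff)

lemma generator_flow_W:
  "generator (flow_W b) (\<lambda>x. x (q, (j, j'))) =
    (\<lambda>x. (if j = b then x (q, (\<not> b, j')) else 0) - (if j' \<noteq> b then x (q, (j, b)) else 0) :: 'k::field_char_0)"
  by (simp add: generator_coord flow_W_def flow_V_def swap_factors_def fun_eq_iff)

lemma coord_in_weight_space: "wt i = p \<Longrightarrow> (\<lambda>x. x i) \<in> weight_space wt (Suc 0) p"
  unfolding weight_space_def
  by (rule fun_space.span_base) (auto intro!: image_eqI[of _ _ "{#i#}"])

lemma coord_diff_in_weight_space:
  "(P \<Longrightarrow> wt i = p) \<Longrightarrow> (Q \<Longrightarrow> wt j = p) \<Longrightarrow>
    (\<lambda>x. (if P then x i else 0) - (if Q then x j else 0)) \<in> weight_space wt (Suc 0) p"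
  by (rule weight_space_diff; cases P; cases Q) (auto intro: coord_in_weight_space weight_space_0)

lemma flow_V_polynomial_flow:
  "polynomial_flow (flow_V b :: (entry \<Rightarrow> 'k::field_char_0) \<Rightarrow> _) entry_weight (if b then (-1, 0) else (1, 0))"
proof
  fix s t :: 'k and x :: "entry \<Rightarrow> 'k"
  show "flow_at (flow_V b) 0 x = x"
    by (auto simp: fun_eq_iff flow_at_def flow_V_def)
  show "flow_at (flow_V b) t (flow_at (flow_V b) s x) = flow_at (flow_V b) (s + t) x"
    by (rule ext, cases b) (auto simp: flow_at_def flow_V_def algebra_simps split: prod.splits)
  show "generator (flow_V b) (\<lambda>x. x e :: 'k) \<in> weight_space entry_weight 1 (entry_weight e + (if b then (-1, 0) else (1, 0)))" for e
  proof -
    obtain i i' q where e: "e = ((i, i'), q)" by (metis prod.exhaust)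
    show ?thesis unfolding e generator_flow_V One_nat_def
      by (rule coord_diff_in_weight_space) (auto simp: entry_weight_def split: if_splits)
  qed
qed

lemma flow_W_polynomial_flow:
  "polynomial_flow (flow_W b :: (entry \<Rightarrow> 'k::field_char_0) \<Rightarrow> _) entry_weight (if b then (0, -1) else (0, 1))"
proof
  fix s t :: 'k and x :: "entry \<Rightarrow> 'k"
  show "flow_at (flow_W b) 0 x = x"
    by (auto simp: fun_eq_iff flow_at_def flow_V_def flow_W_def swap_factors_def)
  show "flow_at (flow_W b) t (flow_at (flow_W b) s x) = flow_at (flow_W b) (s + t) x"
    by (rule ext, cases b) (auto simp: flow_at_def flow_W_def flow_V_def swap_factors_def algebra_simps split: prod.splits)
  show "generator (flow_W b) (\<lambda>x. x e :: 'k) \<in> weight_space entry_weight 1 (entry_weight e + (if b then (0, -1) else (0, 1)))" for e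
  proof -
    obtain j j' q where e: "e = (q, (j, j'))" by (metis prod.exhaust)
    show ?thesis unfolding e generator_flow_W One_nat_def
      by (rule coord_diff_in_weight_space) (auto simp: entry_weight_def split: if_splits)
  qed
qed

lemma (in polynomial_flow) generator_coord_diff:
  "generator u (\<lambda>x. (if P then x i else 0) - (if Q then x j else 0)) =
    (\<lambda>x. (if P then generator u (\<lambda>x. x i) x else 0) - (if Q then generator u (\<lambda>x. x j) x else 0))"
proof -
  have "on_curve (\<lambda>x. (if P then x i else 0) - (if Q then x j else 0)) \<gamma> = (if P then \<gamma> i else 0) - (if Q then \<gamma> j else 0)"
    for \<gamma> :: "'i \<Rightarrow> 'k poly"
    by (rule on_curve_eqI) simp
  then show ?thesis by (simp add: generator_def on_curve_coord fun_eq_iff)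
qed

lemma commutator_V:
  assumes "f \<in> weight_space entry_weight n p"
  shows "generator (flow_V False) (generator (flow_V True) f) x - generator (flow_V True) (generator (flow_V False) f) x
    = (2 * of_int (fst p)) * (f x :: 'k::field_char_0)"
proof (rule generator_commutator[OF flow_V_polynomial_flow flow_V_polynomial_flow _ _ _ assms])
  fix e :: entry and x :: "entry \<Rightarrow> 'k"
  obtain i i' q where e: "e = ((i, i'), q)" by (metis prod.exhaust)
  show "generator (flow_V False) (generator (flow_V True) (\<lambda>x. x e)) x
      - generator (flow_V True) (generator (flow_V False) (\<lambda>x. x e)) x = 2 * of_int (fst (entry_weight e)) * x e"
    unfolding e generator_flow_V polynomial_flow.generator_coord_diff[OF flow_V_polynomial_flow]
    by (cases i; cases i') (simp_all add: entry_weight_def)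
qed (simp_all add: algebra_simps)

lemma commutator_W:
  assumes "f \<in> weight_space entry_weight n p"
  shows "generator (flow_W False) (generator (flow_W True) f) x - generator (flow_W True) (generator (flow_W False) f) x
    = (2 * of_int (snd p)) * (f x :: 'k::field_char_0)"
proof (rule generator_commutator[OF flow_W_polynomial_flow flow_W_polynomial_flow _ _ _ assms])
  fix e :: entry and x :: "entry \<Rightarrow> 'k"
  obtain j j' q where e: "e = (q, (j, j'))" by (metis prod.exhaust)
  show "generator (flow_W False) (generator (flow_W True) (\<lambda>x. x e)) x
      - generator (flow_W True) (generator (flow_W False) (\<lambda>x. x e)) x = 2 * of_int (snd (entry_weight e)) * x e"
    unfolding e generator_flow_W polynomial_flow.generator_coord_diff[OF flow_W_polynomial_flow]
    by (cases j; cases j') (simp_all add: entry_weight_def)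
qed (simp_all add: algebra_simps)

lemma commutator_V_W:
  assumes "f \<in> weight_space entry_weight n p"
  shows "generator (flow_V b) (generator (flow_W c) f) = (generator (flow_W c) (generator (flow_V b) f) :: _ \<Rightarrow> 'k::field_char_0)"
proof
  fix x
  have "generator (flow_V b) (generator (flow_W c) f) x - generator (flow_W c) (generator (flow_V b) f) x = 0 * f x"
  proof (rule generator_commutator[OF flow_V_polynomial_flow flow_W_polynomial_flow _ _ _ assms])
    fix e :: entry and x :: "entry \<Rightarrow> 'k"
    obtain i i' j j' where e: "e = ((i, i'), (j, j'))" by (metis prod.exhaust)
    show "generator (flow_V b) (generator (flow_W c) (\<lambda>x. x e)) x
        - generator (flow_W c) (generator (flow_V b) (\<lambda>x. x e)) x = 0 * x e"
      unfolding e generator_flow_V generator_flow_W polynomial_flow.generator_coord_diff[OF flow_V_polynomial_flow]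
        polynomial_flow.generator_coord_diff[OF flow_W_polynomial_flow]
      by simp
  qed simp_all
  then show "generator (flow_V b) (generator (flow_W c) f) x = generator (flow_W c) (generator (flow_V b) f) x" by simp
qed

lemma weight_bounded:
  assumes "\<And>i. \<bar>fst (wt i)\<bar> \<le> 1 \<and> \<bar>snd (wt i)\<bar> \<le> 1"
  shows "\<bar>fst (weight wt M)\<bar> \<le> int (size M) \<and> \<bar>snd (weight wt M)\<bar> \<le> int (size M)"
proof (induction M)
  case (add i M)
  then show ?case using assms[of i] by (auto simp: weight_simps)
qed (simp add: weight_def)

text \<open>
  Each variable has weight at most 1 in absolute value, so a monomial of degree \<open>n\<close> has weight at most
  \<open>n\<close>.
\<close>

lemma weight_space_bounded:
  assumes "f \<in> weight_space entry_weight n p" "\<bar>fst p\<bar> > int n \<or> \<bar>snd p\<bar> > int n"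
  shows "f = (\<lambda>x. 0 :: 'k::field)"
proof -
  have "{M. size M = n \<and> weight entry_weight M = p} = {}"
  proof -
    have "\<bar>fst (entry_weight i)\<bar> \<le> 1 \<and> \<bar>snd (entry_weight i)\<bar> \<le> 1" for i
      by (auto simp: entry_weight_def)
    from weight_bounded[of entry_weight, OF this]
    have "\<not> (size M = n \<and> weight entry_weight M = p)" for M
      using assms(2) by (metis not_less)
    then show ?thesis by blast
  qed
  then have "f \<in> fun_space.span {}" using assms(1) unfolding weight_space_def by (simp only: image_empty)
  then show ?thesis by (simp add: zero_fun_def)
qed

lemma sl2_V:
  "sl2_weight_spaces (scale_fun (*) :: 'k::field_char_0 \<Rightarrow> _) (\<lambda>j. weight_space entry_weight n (j, k))
    (generator (flow_V False)) (generator (flow_V True)) (int n)"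
proof
  interpret E: polynomial_flow "flow_V False :: (entry \<Rightarrow> 'k) \<Rightarrow> _" entry_weight "(1, 0)"
    using flow_V_polynomial_flow[of False] by simp
  interpret F: polynomial_flow "flow_V True :: (entry \<Rightarrow> 'k) \<Rightarrow> _" entry_weight "(-1, 0)"
    using flow_V_polynomial_flow[of True] by simp
  fix f g :: "(entry \<Rightarrow> 'k) \<Rightarrow> 'k" and j and c :: 'k
  show "fun_space.subspace (weight_space entry_weight n (j, k) :: ((entry \<Rightarrow> 'k) \<Rightarrow> 'k) set)"
    by (rule subspace_weight_space)
  assume f: "f \<in> weight_space entry_weight n (j, k)"
  note pf = polynomial_on_curves_weight_space[OF f]
  show "generator (flow_V False) f \<in> weight_space entry_weight n (j + 1, k)"
    using E.generator_in_weight_space[OF f] by simp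
  show "generator (flow_V True) f \<in> weight_space entry_weight n (j - 1, k)"
    using F.generator_in_weight_space[OF f] by simp
  show "generator (flow_V False) (scale_fun (*) c f) = scale_fun (*) c (generator (flow_V False) f)"
    "generator (flow_V True) (scale_fun (*) c f) = scale_fun (*) c (generator (flow_V True) f)"
    using E.generator_scale[OF pf] F.generator_scale[OF pf] by (simp_all add: scale_fun_def)
  show "generator (flow_V False) (generator (flow_V True) f) - generator (flow_V True) (generator (flow_V False) f) =
      scale_fun (*) (2 * of_int j) f"
    using commutator_V[OF f] by (simp add: fun_eq_iff scale_fun_apply)
  show "f = 0" if "\<bar>j\<bar> > int n"
    using weight_space_bounded[OF f] that by (simp add: zero_fun_def)
  assume g: "g \<in> weight_space entry_weight n (j, k)"
  note pg = polynomial_on_curves_weight_space[OF g]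
  show "generator (flow_V False) (f + g) = generator (flow_V False) f + generator (flow_V False) g"
    "generator (flow_V True) (f + g) = generator (flow_V True) f + generator (flow_V True) g"
    using E.generator_add[OF pf pg] F.generator_add[OF pf pg] by (simp_all add: plus_fun_def)
qed


text \<open>
  The copy of \<open>sl(2)\<close> that belongs to \<open>W\<close> acts on the invariants of the other copy, because the two
  commute.
\<close>

lemma sl2_W:
  "sl2_weight_spaces (scale_fun (*) :: 'k::field_char_0 \<Rightarrow> _)
    (\<lambda>k. {f \<in> weight_space entry_weight n (0, k). generator (flow_V False) f = 0})
    (generator (flow_W False)) (generator (flow_W True)) (int n)"
proof
  interpret V: polynomial_flow "flow_V False :: (entry \<Rightarrow> 'k) \<Rightarrow> _" entry_weight "(1, 0)"
    using flow_V_polynomial_flow[of False] by simp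
  interpret E: polynomial_flow "flow_W False :: (entry \<Rightarrow> 'k) \<Rightarrow> _" entry_weight "(0, 1)"
    using flow_W_polynomial_flow[of False] by simp
  interpret F: polynomial_flow "flow_W True :: (entry \<Rightarrow> 'k) \<Rightarrow> _" entry_weight "(0, -1)"
    using flow_W_polynomial_flow[of True] by simp
  fix f g :: "(entry \<Rightarrow> 'k) \<Rightarrow> 'k" and j :: int and c :: 'k
  let ?N = "\<lambda>j. {f \<in> weight_space entry_weight n (0, j). generator (flow_V False) f = 0} :: ((entry \<Rightarrow> 'k) \<Rightarrow> 'k) set"
  interpret sV: sl2_weight_spaces "scale_fun (*) :: 'k \<Rightarrow> _" "\<lambda>i. weight_space entry_weight n (i, j)"
    "generator (flow_V False)" "generator (flow_V True)" "int n" by (rule sl2_V)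
  have V0: "generator (flow_V False) 0 = (0 :: (entry \<Rightarrow> 'k) \<Rightarrow> 'k)"
    using V.generator_0 by (simp add: zero_fun_def)
  have E0: "generator (flow_W b) 0 = (0 :: (entry \<Rightarrow> 'k) \<Rightarrow> 'k)" for b
    using E.generator_0 F.generator_0 by (cases b) (simp_all add: zero_fun_def)
  show "fun_space.subspace (?N j)"
    by (rule fun_space.subspaceI)
      (auto simp: V0 sV.E_add[of _ 0] sV.E_scale[of _ 0] fun_space.subspace_0 fun_space.subspace_add fun_space.subspace_scale
        subspace_weight_space)
  assume "f \<in> ?N j"
  then have f: "f \<in> weight_space entry_weight n (0, j)" and fV: "generator (flow_V False) f = 0" by auto
  note pf = polynomial_on_curves_weight_space[OF f]
  show "generator (flow_W False) f \<in> ?N (j + 1)"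
    using E.generator_in_weight_space[OF f] commutator_V_W[OF f, of False False] fV by (simp add: E0)
  show "generator (flow_W True) f \<in> ?N (j - 1)"
    using F.generator_in_weight_space[OF f] commutator_V_W[OF f, of False True] fV by (simp add: E0)
  show "generator (flow_W False) (scale_fun (*) c f) = scale_fun (*) c (generator (flow_W False) f)"
    "generator (flow_W True) (scale_fun (*) c f) = scale_fun (*) c (generator (flow_W True) f)"
    using E.generator_scale[OF pf] F.generator_scale[OF pf] by (simp_all add: scale_fun_def)
  show "generator (flow_W False) (generator (flow_W True) f) - generator (flow_W True) (generator (flow_W False) f) =
      scale_fun (*) (2 * of_int j) f"
    using commutator_W[OF f] by (simp add: fun_eq_iff scale_fun_apply)
  show "f = 0" if "\<bar>j\<bar> > int n"
    using weight_space_bounded[OF f] that by (simp add: zero_fun_def)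
  assume "g \<in> ?N j"
  then have g: "g \<in> weight_space entry_weight n (0, j)" by auto
  note pg = polynomial_on_curves_weight_space[OF g]
  show "generator (flow_W False) (f + g) = generator (flow_W False) f + generator (flow_W False) g"
    "generator (flow_W True) (f + g) = generator (flow_W True) f + generator (flow_W True) g"
    using E.generator_add[OF pf pg] F.generator_add[OF pf pg] by (simp_all add: plus_fun_def)
qed

definition highest_weight_invariants :: "nat \<Rightarrow> ((entry \<Rightarrow> 'k::field_char_0) \<Rightarrow> 'k) set" where
  "highest_weight_invariants n = {f \<in> weight_space entry_weight n (0, 0).
     generator (flow_V False) f = 0 \<and> generator (flow_W False) f = 0}"

lemma finite_weight_monomials: "finite (monomial ` {M :: 'i::finite multiset. size M = n \<and> weight wt M = p})"
  by (rule finite_imageI, rule finite_subset[OF _ finite_multisets_of_size[of UNIV n]]) auto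

text \<open>
  Each application of \<open>dim_invariants\<close> replaces a weight multiplicity by the difference of the
  multiplicities in weights 0 and 1: first in the direction of \<open>V\<close>, then in that of \<open>W\<close>.
\<close>

lemma dim_highest_weight_invariants:
  "int (fun_space.dim (highest_weight_invariants n :: ((entry \<Rightarrow> 'k::field_char_0) \<Rightarrow> 'k) set)) =
    int (weight_count entry_weight n (0, 0)) - int (weight_count entry_weight n (1, 0))
      - int (weight_count entry_weight n (0, 1)) + int (weight_count entry_weight n (1, 1))"
proof -
  let ?N = "\<lambda>k. {f \<in> weight_space entry_weight n (0, k). generator (flow_V False) f = 0} :: ((entry \<Rightarrow> 'k) \<Rightarrow> 'k) set"
  let ?B = "\<lambda>p. monomial ` {M. size M = n \<and> weight entry_weight M = p} :: ((entry \<Rightarrow> 'k) \<Rightarrow> 'k) set"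
  have fin: "finite (?B p)" for p by (rule finite_weight_monomials)
  have V: "weight_count entry_weight n (0, k) = fun_space.dim (?N k) + weight_count entry_weight n (1, k)" for k
  proof -
    interpret V: sl2_weight_spaces "scale_fun (*) :: 'k \<Rightarrow> _" "\<lambda>i. weight_space entry_weight n (i, k)"
      "generator (flow_V False)" "generator (flow_V True)" "int n" by (rule sl2_V)
    have "weight_space entry_weight n (0, k) \<subseteq> fun_space.span (?B (0, k))"
      by (simp add: weight_space_def)
    from V.dim_invariants[OF fin this] show ?thesis by (simp only: dim_weight_space)
  qed
  interpret W: sl2_weight_spaces "scale_fun (*) :: 'k \<Rightarrow> _" ?N
      "generator (flow_W False)" "generator (flow_W True)" "int n" by (rule sl2_W)
  have sub: "?N 0 \<subseteq> fun_space.span (?B (0, 0))"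
    by (auto simp: weight_space_def)
  have eq: "{v \<in> ?N 0. generator (flow_W False) v = 0} = highest_weight_invariants n"
    unfolding highest_weight_invariants_def by blast
  have "fun_space.dim (?N 0) = fun_space.dim (highest_weight_invariants n :: ((entry \<Rightarrow> 'k) \<Rightarrow> 'k) set) + fun_space.dim (?N 1)"
    using W.dim_invariants[OF fin sub] unfolding eq .
  then show ?thesis using V[of 0] V[of 1] by simp
qed

lemma highest_weight_invariants_flow:
  assumes "f \<in> highest_weight_invariants n"
  shows "f (flow_at (flow_V b) t x) = (f x :: 'k::field_char_0)" "f (flow_at (flow_W b) t x) = f x"
proof -
  have f: "f \<in> weight_space entry_weight n (0, 0)" "generator (flow_V False) f = 0" "generator (flow_W False) f = 0"
    using assms by (auto simp: highest_weight_invariants_def)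
  note pf = polynomial_on_curves_weight_space[OF f(1)]
  interpret V: sl2_weight_spaces "scale_fun (*) :: 'k \<Rightarrow> _" "\<lambda>i. weight_space entry_weight n (i, 0)"
    "generator (flow_V False)" "generator (flow_V True)" "int n" by (rule sl2_V)
  interpret W: sl2_weight_spaces "scale_fun (*) :: 'k \<Rightarrow> _"
    "\<lambda>k. {f \<in> weight_space entry_weight n (0, k). generator (flow_V False) f = 0}"
    "generator (flow_W False)" "generator (flow_W True)" "int n" by (rule sl2_W)
  have "generator (flow_V True) f = 0"
    using V.highest_weight_0_invariant f by blast
  then have "generator (flow_V b) f = 0" for b using f(2) by (cases b) auto
  then show "f (flow_at (flow_V b) t x) = f x"
    using polynomial_flow.invariant_if_generator_0[OF flow_V_polynomial_flow[of b] pf] by simp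
  have "f \<in> {f \<in> weight_space entry_weight n (0, 0). generator (flow_V False) f = 0}"
    using f by simp
  then have "generator (flow_W True) f = 0"
    using W.highest_weight_0_invariant f(3) by blast
  then have "generator (flow_W b) f = 0" for b using f(3) by (cases b) auto
  then show "f (flow_at (flow_W b) t x) = f x"
    using polynomial_flow.invariant_if_generator_0[OF flow_W_polynomial_flow[of b] pf] by simp
qed

section \<open>From the Lie algebra to invertible matrices\<close>

definition conj_V :: "(bool \<Rightarrow> bool \<Rightarrow> 'k::field) \<Rightarrow> (bool \<Rightarrow> bool \<Rightarrow> 'k) \<Rightarrow> (entry \<Rightarrow> 'k) \<Rightarrow> entry \<Rightarrow> 'k" where
  "conj_V g g' x = (\<lambda>((i, i'), q). \<Sum>k\<in>UNIV. \<Sum>k'\<in>UNIV. g i k * x ((k, k'), q) * g' k' i')"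

definition conj_W :: "(bool \<Rightarrow> bool \<Rightarrow> 'k::field) \<Rightarrow> (bool \<Rightarrow> bool \<Rightarrow> 'k) \<Rightarrow> (entry \<Rightarrow> 'k) \<Rightarrow> entry \<Rightarrow> 'k" where
  "conj_W h h' x = swap_factors (conj_V h h' (swap_factors x))"

definition mat_mult :: "(bool \<Rightarrow> bool \<Rightarrow> 'k::field) \<Rightarrow> (bool \<Rightarrow> bool \<Rightarrow> 'k) \<Rightarrow> bool \<Rightarrow> bool \<Rightarrow> 'k" where
  "mat_mult g h i j = (\<Sum>k\<in>UNIV. g i k * h k j)"

definition mat_one :: "bool \<Rightarrow> bool \<Rightarrow> 'k::field" where
  "mat_one i j = of_bool (i = j)"

text \<open>
  Group elements are given together with their inverses, since conjugation uses both.
\<close>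

definition inverse_mats :: "(bool \<Rightarrow> bool \<Rightarrow> 'k::field) \<Rightarrow> (bool \<Rightarrow> bool \<Rightarrow> 'k) \<Rightarrow> bool" where
  "inverse_mats g g' \<longleftrightarrow> mat_mult g g' = mat_one \<and> mat_mult g' g = mat_one"

definition transvection :: "bool \<Rightarrow> 'k::field \<Rightarrow> bool \<Rightarrow> bool \<Rightarrow> 'k" where
  "transvection b t i k = (if i = k then 1 else if i = b then t else 0)"

definition diagonal :: "'k::field \<Rightarrow> 'k \<Rightarrow> bool \<Rightarrow> bool \<Rightarrow> 'k" where
  "diagonal a d i k = (if i = k then (if i then d else a) else 0)"

lemma swap_swap [simp]: "swap_factors (swap_factors x) = x"
  by (simp add: swap_factors_def comp_def)

lemma conj_V_conj_V: "conj_V g g' (conj_V h h' x) = conj_V (mat_mult g h) (mat_mult h' g') x"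
  by (rule ext) (auto simp: conj_V_def mat_mult_def UNIV_bool algebra_simps)

lemma conj_V_one [simp]: "conj_V mat_one mat_one x = x"
proof
  fix e :: entry
  obtain i i' q where "e = ((i, i'), q)" by (metis prod.exhaust)
  then show "conj_V mat_one mat_one x e = x e"
    by (cases i; cases i') (simp_all add: conj_V_def mat_one_def UNIV_bool)
qed

lemma conj_W_one [simp]: "conj_W mat_one mat_one x = x"
  by (simp add: conj_W_def)

lemma flow_V_eq_conj_V: "flow_at (flow_V b) t x = conj_V (transvection b t) (transvection b (- t)) x"
proof
  fix e :: entry
  obtain i i' q where "e = ((i, i'), q)" by (metis prod.exhaust)
  then show "flow_at (flow_V b) t x e = conj_V (transvection b t) (transvection b (- t)) x e"
    by (cases i; cases i'; cases b)
      (simp_all add: conj_V_def flow_at_def flow_V_def transvection_def UNIV_bool algebra_simps)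
qed

lemma flow_W_eq_swap: "flow_at (flow_W b) t x = swap_factors (flow_at (flow_V b) t (swap_factors x))"
  by (simp add: fun_eq_iff flow_at_def flow_W_def swap_factors_def)

lemma flow_W_eq_conj_W: "flow_at (flow_W b) t x = conj_W (transvection b t) (transvection b (- t)) x"
  by (simp add: flow_W_eq_swap conj_W_def flow_V_eq_conj_V)

lemma inverse_mats_transvection: "inverse_mats (transvection b t) (transvection b (- t))"
  unfolding inverse_mats_def
  by (cases b) (auto simp: fun_eq_iff mat_mult_def mat_one_def transvection_def UNIV_bool)

lemma inverse_mats_diagonal: "a \<noteq> 0 \<Longrightarrow> d \<noteq> 0 \<Longrightarrow> inverse_mats (diagonal a d) (diagonal (1 / a) (1 / d))"
  unfolding inverse_mats_def
  by (auto simp: fun_eq_iff mat_mult_def mat_one_def diagonal_def UNIV_bool)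

lemma inverse_mats_one: "inverse_mats mat_one mat_one"
  unfolding inverse_mats_def by (auto simp: fun_eq_iff mat_mult_def mat_one_def UNIV_bool)

definition scale_V :: "'k::field \<Rightarrow> (entry \<Rightarrow> 'k) \<Rightarrow> entry \<Rightarrow> 'k" where
  "scale_V a x e = a powi fst (entry_weight e) * x e"

lemma conj_V_diagonal:
  assumes "a \<noteq> 0" "d \<noteq> 0"
  shows "conj_V (diagonal a d) (diagonal (1 / a) (1 / d)) x = scale_V (d / a) x"
proof
  fix e :: entry
  obtain i i' q where "e = ((i, i'), q)" by (metis prod.exhaust)
  then show "conj_V (diagonal a d) (diagonal (1 / a) (1 / d)) x e = scale_V (d / a) x e"
    using assms by (cases i; cases i')
      (simp_all add: conj_V_def diagonal_def scale_V_def entry_weight_def UNIV_bool power_int_minus field_simps)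
qed

text \<open>
  Matrices with nonzero upper left entry are products of a lower triangular transvection, a diagonal
  matrix and an upper triangular transvection. If the upper left entry vanishes, the lower left entry
  does not, and one further transvection reduces to the first case.
\<close>

lemma invariant_conj_V:
  assumes flow: "\<And>b t x. f (flow_at (flow_V b) t x) = f x"
    and torus: "\<And>a x. a \<noteq> 0 \<Longrightarrow> f (scale_V a x) = f x"
    and inv: "inverse_mats g g'"
  shows "f (conj_V g g' x) = f x"
proof -
  have generic: "f (conj_V g g' x) = f x" if inv: "inverse_mats g g'" and p: "g False False \<noteq> 0" for g g' x
  proof -
    define D where "D = g False False * g True True - g False True * g True False"
    have e: "g i False * g' False j + g i True * g' True j = of_bool (i = j)"
      "g' i False * g False j + g' i True * g True j = of_bool (i = j)" for i j
      using inv unfolding inverse_mats_def by (auto simp: fun_eq_iff mat_mult_def mat_one_def UNIV_bool)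
    have "D * (g' False False * g' True True - g' False True * g' True False) = 1"
      unfolding D_def using e(1)[of False False] e(1)[of False True] e(1)[of True False] e(1)[of True True]
      by simp algebra
    then have D: "D \<noteq> 0" by auto
    have g': "D * g' False False = g True True" "D * g' False True = - g False True"
      "D * g' True False = - g True False" "D * g' True True = g False False"
      unfolding D_def using e(1)[of False False] e(1)[of False True] e(1)[of True False] e(1)[of True True]
      by (simp_all, algebra+)
    \<comment> \<open>\<open>g\<close> is \<open>[[p, q], [r, s]]\<close> with determinant \<open>D\<close>; the factors are those of Gaussian elimination.\<close>
    let ?p = "g False False" and ?q = "g False True" and ?r = "g True False"
    have gE: "g = mat_mult (transvection True (?r / ?p)) (mat_mult (diagonal ?p (D / ?p)) (transvection False (?q / ?p)))"
      using p by (intro ext)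
        (auto simp: mat_mult_def transvection_def diagonal_def UNIV_bool D_def field_simps)
    have gE': "g' = mat_mult (mat_mult (transvection False (- (?q / ?p))) (diagonal (1 / ?p) (1 / (D / ?p)))) (transvection True (- (?r / ?p)))"
    proof (intro ext)
      fix i j
      have "g' False False = g True True / D" "g' False True = - ?q / D" "g' True False = - ?r / D" "g' True True = ?p / D"
        using g' D by (simp_all add: field_simps)
      then show "g' i j = mat_mult (mat_mult (transvection False (- (?q / ?p))) (diagonal (1 / ?p) (1 / (D / ?p)))) (transvection True (- (?r / ?p))) i j"
        using p D by (cases i; cases j)
          (simp_all add: mat_mult_def transvection_def diagonal_def UNIV_bool field_simps, simp_all add: D_def algebra_simps)
    qed
    have "conj_V g g' x = flow_at (flow_V True) (?r / ?p) (scale_V (D / ?p / ?p) (flow_at (flow_V False) (?q / ?p) x))"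
      using arg_cong2[OF gE gE', of "\<lambda>a b. conj_V a b x"] p D
      by (simp only: flow_V_eq_conj_V conj_V_diagonal[symmetric] conj_V_conj_V divide_eq_0_iff simp_thms)
    then show ?thesis using p D by (simp add: flow torus)
  qed
  show ?thesis
  proof (cases "g False False = 0")
    case False
    then show ?thesis by (rule generic[OF inv])
  next
    case True
    have e: "g i False * g' False j + g i True * g' True j = of_bool (i = j)"
      "g' i False * g False j + g' i True * g True j = of_bool (i = j)" for i j
      using inv unfolding inverse_mats_def by (auto simp: fun_eq_iff mat_mult_def mat_one_def UNIV_bool)
    have r: "g True False \<noteq> 0"
      using e(2)[of False False] True by auto
    \<comment> \<open>Adding the second row to the first moves the nonzero entry into the upper left corner.\<close>
    let ?h = "mat_mult (transvection False 1) g" and ?h' = "mat_mult g' (transvection False (- 1))"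
    have "inverse_mats ?h ?h'"
      unfolding inverse_mats_def
    proof (intro conjI ext)
      fix i j
      show "mat_mult ?h ?h' i j = mat_one i j"
        using e(1)[of False False] e(1)[of False True] e(1)[of True False] e(1)[of True True]
        by (cases i; cases j) (simp_all add: mat_mult_def transvection_def UNIV_bool mat_one_def, algebra+)
      show "mat_mult ?h' ?h i j = mat_one i j"
        using e(2)[of False False] e(2)[of False True] e(2)[of True False] e(2)[of True True]
        by (cases i; cases j) (simp_all add: mat_mult_def transvection_def UNIV_bool mat_one_def, algebra+)
    qed
    moreover have "?h False False \<noteq> 0"
      using r True by (simp add: mat_mult_def transvection_def UNIV_bool)
    ultimately have "f (conj_V ?h ?h' x) = f x" by (rule generic)
    then show ?thesis
      using flow[of False 1 "conj_V g g' x"] by (simp add: flow_V_eq_conj_V conj_V_conj_V)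
  qed
qed

definition homogeneous :: "nat \<Rightarrow> (('i \<Rightarrow> 'k::field) \<Rightarrow> 'k) set" where
  "homogeneous n = fun_space.span (monomial ` {M. size M = n})"

lemma weight_space_subset_homogeneous: "weight_space wt n p \<subseteq> homogeneous n"
  unfolding weight_space_def homogeneous_def by (rule fun_space.span_mono) auto

lemma homogeneous_expansion:
  fixes f :: "('i::finite \<Rightarrow> 'k::field_char_0) \<Rightarrow> 'k"
  assumes "f \<in> homogeneous n"
  shows "\<exists>c. \<forall>x. f x = (\<Sum>M | size M = n. c M * monomial M x)"
  using assms unfolding homogeneous_def
proof (induction rule: fun_space.span_induct_alt)
  case base
  then show ?case by (auto intro: exI[of _ "\<lambda>_. 0"])
next
  case (step a g h)
  then obtain N c where N: "g = monomial N" "size N = n" and c: "\<And>x. h x = (\<Sum>M | size M = n. c M * monomial M x)"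
    by auto
  have fin: "finite {M :: 'i multiset. size M = n}"
    using finite_multisets_of_size[of "UNIV :: 'i set" n] by simp
  have "(scale_fun (*) a g + h) x = (\<Sum>M | size M = n. (c M + (if M = N then a else 0)) * monomial M x)" for x
  proof -
    have "(\<Sum>M | size M = n. (if M = N then a else 0) * monomial M x) = (\<Sum>M | size M = n. if M = N then a * monomial M x else 0)"
      by (rule sum.cong) auto
    also have "\<dots> = a * monomial N x"
      using fin N(2) by (simp add: sum.delta)
    finally show ?thesis by (simp add: distrib_right sum.distrib c N(1) scale_fun_apply)
  qed
  then show ?case by (intro exI[of _ "\<lambda>M. c M + (if M = N then a else 0)"] allI)
qed

lemma monomial_scaled: "monomial M (\<lambda>i. s i * x i) = monomial M s * monomial M x"
  by (induction M) (simp_all add: mult_ac)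

text \<open>
  The substitution \<open>x i \<mapsto> s i * x i\<close> multiplies the coefficient of a monomial by the value of this
  monomial at \<open>s\<close>, and monomials are linearly independent.
\<close>

lemma scaling_invariant_coeff:
  fixes c :: "'i::finite multiset \<Rightarrow> 'k::field_char_0"
  assumes f: "\<And>x. f x = (\<Sum>M | size M = n. c M * monomial M x)"
    and inv: "\<And>x. f (\<lambda>i. s i * x i) = f x" and M: "size M = n" "c M \<noteq> 0"
  shows "monomial M s = 1"
proof -
  have fin: "finite {M :: 'i multiset. size M = n}"
    using finite_multisets_of_size[of "UNIV :: 'i set" n] by simp
  have "c M * (monomial M s - 1) = 0"
  proof (rule monomials_independent[OF fin])
    fix x :: "'i \<Rightarrow> 'k"
    have "(\<Sum>M | size M = n. c M * (monomial M s - 1) * monomial M x) = f (\<lambda>i. s i * x i) - f x"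
      unfolding f monomial_scaled by (simp add: sum_subtractf[symmetric] algebra_simps)
    then show "(\<Sum>M | size M = n. c M * (monomial M s - 1) * monomial M x) = 0" by (simp add: inv)
  qed (use M in simp)
  then show ?thesis using M(2) by simp
qed

lemma two_powi_eq_1: "(2 :: 'k::field_char_0) powi k = 1 \<longleftrightarrow> k = 0"
proof
  have nat: "n = 0" if "(2 :: 'k) ^ n = 1" for n
  proof -
    have "of_nat (2 ^ n) = (of_nat 1 :: 'k)" using that by simp
    then have "2 ^ n = (1::nat)" by (simp only: of_nat_eq_iff)
    then show ?thesis by simp
  qed
  assume "(2 :: 'k) powi k = 1"
  then have "(2 :: 'k) ^ nat \<bar>k\<bar> = 1"
    by (cases "k \<ge> 0") (auto simp: power_int_def power_one_over)
  then show "k = 0" using nat by force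
qed simp

lemma monomial_powi:
  assumes "a \<noteq> (0 :: 'k::field)"
  shows "monomial M (\<lambda>i. a powi w i) = a powi (\<Sum>i\<in>#M. w i)"
  using assms by (induction M) (simp_all add: power_int_add)

lemma weight_components:
  "fst (weight wt M) = (\<Sum>i\<in>#M. fst (wt i))" "snd (weight wt M) = (\<Sum>i\<in>#M. snd (wt i))"
  by (induction M) simp_all

definition scale_W :: "'k::field \<Rightarrow> (entry \<Rightarrow> 'k) \<Rightarrow> entry \<Rightarrow> 'k" where
  "scale_W a x = swap_factors (scale_V a (swap_factors x))"

lemma scale_W_apply: "scale_W a x e = a powi snd (entry_weight e) * x e"
  by (simp add: scale_W_def scale_V_def swap_factors_def entry_weight_def)

text \<open>
  A single element of infinite order suffices in each torus: the monomial \<open>M\<close> is multiplied by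
  \<open>2\<close> to the power of its weight, which is 1 only if the weight is 0.
\<close>

lemma torus_invariant_weight_0:
  fixes f :: "(entry \<Rightarrow> 'k::field_char_0) \<Rightarrow> 'k"
  assumes f: "f \<in> homogeneous n"
    and V: "\<And>x. f (scale_V 2 x) = f x" and W: "\<And>x. f (scale_W 2 x) = f x"
  shows "f \<in> weight_space entry_weight n (0, 0)"
proof -
  obtain c where c: "\<And>x. f x = (\<Sum>M | size M = n. c M * monomial M x)"
    using homogeneous_expansion[OF f] by blast
  have "weight entry_weight M = (0, 0)" if M: "size M = n" "c M \<noteq> 0" for M
  proof -
    have "monomial M (\<lambda>e. 2 powi fst (entry_weight e) :: 'k) = 1"
      by (rule scaling_invariant_coeff[OF c _ M]) (use V in \<open>simp add: scale_V_def[abs_def]\<close>)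
    moreover have "monomial M (\<lambda>e. 2 powi snd (entry_weight e) :: 'k) = 1"
      by (rule scaling_invariant_coeff[OF c _ M]) (use W in \<open>simp add: scale_W_apply[abs_def]\<close>)
    ultimately show ?thesis
      by (simp add: monomial_powi two_powi_eq_1 weight_components prod_eq_iff)
  qed
  then have "f = (\<Sum>M | size M = n \<and> weight entry_weight M = (0, 0). scale_fun (*) (c M) (monomial M))"
    using finite_multisets_of_size[of "UNIV :: entry set" n]
    by (intro ext) (auto simp: sum_fun_apply scale_fun_apply c intro!: sum.mono_neutral_cong_right)
  also have "\<dots> \<in> weight_space entry_weight n (0, 0)"
    unfolding weight_space_def
    by (intro fun_space.span_sum fun_space.span_scale fun_space.span_base) auto
  finally show ?thesis .
qed

lemma weight_0_scaling_invariant: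
  assumes "f \<in> weight_space wt n p" and one: "\<And>M. weight wt M = p \<Longrightarrow> monomial M s = 1"
  shows "f (\<lambda>i. s i * x i) = f x"
  using assms(1) unfolding weight_space_def
proof (induction rule: fun_space.span_induct_alt)
  case (step c g h)
  then show ?case using one by (auto simp: monomial_scaled scale_fun_apply)
qed simp

lemma weight_0_torus_invariant:
  fixes f :: "(entry \<Rightarrow> 'k::field_char_0) \<Rightarrow> 'k"
  assumes f: "f \<in> weight_space entry_weight n (0, 0)" and a: "a \<noteq> 0"
  shows "f (scale_V a x) = f x" "f (scale_W a x) = f x"
proof -
  have "weight entry_weight M = (0, 0) \<Longrightarrow> monomial M (\<lambda>e. a powi fst (entry_weight e)) = 1"
    "weight entry_weight M = (0, 0) \<Longrightarrow> monomial M (\<lambda>e. a powi snd (entry_weight e)) = 1" for M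
    by (simp_all add: monomial_powi a weight_components[symmetric])
  from weight_0_scaling_invariant[OF f this(1)] weight_0_scaling_invariant[OF f this(2)]
  show "f (scale_V a x) = f x" "f (scale_W a x) = f x"
    by (simp_all add: scale_V_def[abs_def] scale_W_apply[abs_def])
qed

definition matrix_invariants :: "nat \<Rightarrow> ((entry \<Rightarrow> 'k::field) \<Rightarrow> 'k) set" where
  "matrix_invariants n = {f \<in> homogeneous n. \<forall>g g' h h' x. inverse_mats g g' \<longrightarrow> inverse_mats h h' \<longrightarrow>
     f (conj_V g g' (conj_W h h' x)) = f x}"

text \<open>
  An invariant polynomial has weight 0, and its derivatives along the unipotent subgroups vanish.
  Conversely, a polynomial of weight 0 that is killed by the raising operators is also killed by the
  lowering operators (\<open>highest_weight_0_invariant\<close>), hence is invariant under the torus and all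
  transvections, which generate the group.
\<close>

lemma matrix_invariants_eq: "matrix_invariants n = (highest_weight_invariants n :: ((entry \<Rightarrow> 'k::field_char_0) \<Rightarrow> 'k) set)"
proof (intro equalityI subsetI)
  fix f :: "(entry \<Rightarrow> 'k) \<Rightarrow> 'k" assume "f \<in> matrix_invariants n"
  then have f: "f \<in> homogeneous n"
    and inv: "\<And>g g' h h' x. inverse_mats g g' \<Longrightarrow> inverse_mats h h' \<Longrightarrow> f (conj_V g g' (conj_W h h' x)) = f x"
    by (auto simp: matrix_invariants_def)
  have V: "f (conj_V g g' x) = f x" if "inverse_mats g g'" for g g' x
    using inv[OF that inverse_mats_one] by simp
  have W: "f (conj_W g g' x) = f x" if "inverse_mats g g'" for g g' x
    using inv[OF inverse_mats_one that] by simp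
  \<comment> \<open>Conjugation by this diagonal matrix scales each entry by 2 to the power of its weight.\<close>
  have diag: "inverse_mats (diagonal 1 2) (diagonal (1 / 1) (1 / 2 :: 'k))"
    by (rule inverse_mats_diagonal) simp_all
  have "f (scale_V 2 x) = f x" "f (scale_W 2 x) = f x" for x
    using V[OF diag, of x] W[OF diag, of x] conj_V_diagonal[of 1 2 x] conj_V_diagonal[of 1 2 "swap_factors x"]
    by (simp_all add: scale_W_def conj_W_def)
  then have "f \<in> weight_space entry_weight n (0, 0)"
    by (rule torus_invariant_weight_0[OF f])
  moreover have "generator (flow_V False) f = 0"
    by (rule ext, subst zero_fun_apply, rule polynomial_flow.generator_0_if_invariant[OF flow_V_polynomial_flow])
      (simp add: flow_V_eq_conj_V V inverse_mats_transvection)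
  moreover have "generator (flow_W False) f = 0"
    by (rule ext, subst zero_fun_apply, rule polynomial_flow.generator_0_if_invariant[OF flow_W_polynomial_flow])
      (simp add: flow_W_eq_conj_W W inverse_mats_transvection)
  ultimately show "f \<in> highest_weight_invariants n"
    by (simp add: highest_weight_invariants_def)
next
  fix f :: "(entry \<Rightarrow> 'k) \<Rightarrow> 'k" assume f: "f \<in> highest_weight_invariants n"
  then have ws: "f \<in> weight_space entry_weight n (0, 0)" by (simp add: highest_weight_invariants_def)
  have V: "f (conj_V g g' x) = f x" if "inverse_mats g g'" for g g' x
    by (rule invariant_conj_V[OF _ _ that]) (simp_all add: highest_weight_invariants_flow[OF f] weight_0_torus_invariant[OF ws])
  have W: "f (conj_W g g' x) = f x" if "inverse_mats g g'" for g g' x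
  proof -
    have "(f \<circ> swap_factors) (conj_V g g' (swap_factors x)) = (f \<circ> swap_factors) (swap_factors x)"
    proof (rule invariant_conj_V[OF _ _ that])
      show "(f \<circ> swap_factors) (flow_at (flow_V b) t x) = (f \<circ> swap_factors) x" for b t x
        using highest_weight_invariants_flow(2)[OF f, of b t "swap_factors x"] by (simp add: flow_W_eq_swap)
      show "(f \<circ> swap_factors) (scale_V a x) = (f \<circ> swap_factors) x" if "a \<noteq> 0" for a x
        using weight_0_torus_invariant(2)[OF ws that, of "swap_factors x"] by (simp add: scale_W_def)
    qed
    then show ?thesis by (simp add: conj_W_def)
  qed
  show "f \<in> matrix_invariants n"
    using subsetD[OF weight_space_subset_homogeneous ws] V W by (auto simp: matrix_invariants_def)
qed

text \<open>
  With all weights equal to 0, statements on weight spaces apply to homogeneous polynomials.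
\<close>

lemma homogeneous_eq_weight_space: "homogeneous n = weight_space (\<lambda>_. 0) n 0"
proof -
  have "weight (\<lambda>_. 0) M = 0" for M :: "'a multiset" by (induction M) simp_all
  then show ?thesis by (simp add: homogeneous_def weight_space_def)
qed

lemma product_of_linear_forms_homogeneous:
  fixes l :: "nat \<Rightarrow> ('i::finite \<Rightarrow> 'k::field_char_0) \<Rightarrow> 'k"
  assumes "\<forall>m<n. l m = (\<lambda>x. \<Sum>p\<in>UNIV. a m p * x p)"
  shows "(\<lambda>x. \<Prod>m<n. l m x) \<in> homogeneous n"
  using assms
proof (induction n)
  case 0
  have "monomial {#} \<in> homogeneous 0"
    unfolding homogeneous_def by (rule fun_space.span_base) auto
  then show ?case by simp
next
  case (Suc n)
  have "(\<lambda>x. \<Sum>p\<in>S. a n p * x p) \<in> weight_space (\<lambda>_. 0) 1 0" for S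
  proof (induction S rule: infinite_finite_induct)
    case (insert p S)
    have "(\<lambda>x. x p) \<in> weight_space (\<lambda>_. 0) 1 0"
      using coord_in_weight_space[of "\<lambda>_. 0" p 0] by simp
    from weight_space_add[OF weight_space_scale[OF this] insert.IH] show ?case
      using insert.hyps by simp
  qed (simp_all add: weight_space_0)
  then have "l n \<in> weight_space (\<lambda>_. 0) 1 0" using Suc.prems by simp
  from weight_space_mult[OF Suc.IH[unfolded homogeneous_eq_weight_space] this] Suc.prems
  show ?case by (simp add: homogeneous_eq_weight_space)
qed

section \<open>From endomorphisms of the tensor product to matrix entries\<close>

lemma (in vector_space) two_dim_coordinates:
  assumes "dim UNIV = 2"
  shows "\<exists>(e :: bool \<Rightarrow> 'b) c. (\<forall>i. Vector_Spaces.linear scale (*) (c i)) \<and>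
    (\<forall>v. v = (\<Sum>i\<in>UNIV. scale (c i v) (e i))) \<and> (\<forall>i j. c i (e j) = of_bool (i = j))"
proof -
  obtain B where B: "independent B" "UNIV \<subseteq> span B" "card B = 2"
    using basis_exists[of UNIV] assms by auto
  then obtain a b where ab: "B = {a, b}" "a \<noteq> b" by (auto simp: card_2_iff)
  define e where "e i = (if i then b else a)" for i :: bool
  have in_span: "v \<in> span B" for v using B(2) by auto
  define c where "c i v = representation B v (e i)" for i v
  have "Vector_Spaces.linear scale (*) (c i)" for i
    unfolding Vector_Spaces.linear_iff c_def
    using B(1) in_span by (auto simp: representation_add representation_scale vector_space_mult vector_space_axioms)
  moreover have "v = (\<Sum>i\<in>UNIV. scale (c i v) (e i))" for v
    using sum_representation_eq[OF B(1) in_span _ subset_refl, of v] ab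
    by (simp add: UNIV_bool c_def e_def add.commute)
  moreover have "c i (e j) = of_bool (i = j)" for i j
    using representation_basis[OF B(1), of "e j"] ab by (auto simp: c_def e_def)
  ultimately show ?thesis by blast
qed

text \<open>
  Bases \<open>e\<close> of \<open>V\<close> and \<open>f\<close> of \<open>W\<close> together with their dual bases \<open>c\<close> and \<open>d\<close>.
\<close>

locale tensor_with_coordinates =
  fixes sV :: "'k::field_char_0 \<Rightarrow> 'v::ab_group_add \<Rightarrow> 'v"
    and sW :: "'k \<Rightarrow> 'w::ab_group_add \<Rightarrow> 'w"
    and sT :: "'k \<Rightarrow> 't::ab_group_add \<Rightarrow> 't"
    and \<tau> :: "'v \<Rightarrow> 'w \<Rightarrow> 't"
    and e :: "bool \<Rightarrow> 'v" and c :: "bool \<Rightarrow> 'v \<Rightarrow> 'k"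
    and f :: "bool \<Rightarrow> 'w" and d :: "bool \<Rightarrow> 'w \<Rightarrow> 'k"
  assumes tensor: "is_tensor_product sV sW sT \<tau>"
    and lin_c: "Vector_Spaces.linear sV (*) (c i)" and c_e: "c i (e j) = of_bool (i = j)"
    and expand_V: "v = (\<Sum>i\<in>UNIV. sV (c i v) (e i))"
    and lin_d: "Vector_Spaces.linear sW (*) (d i)" and d_f: "d i (f j) = of_bool (i = j)"
    and expand_W: "w = (\<Sum>i\<in>UNIV. sW (d i w) (f i))"
begin

sublocale V: vector_space sV using tensor by (simp add: is_tensor_product_def)
sublocale W: vector_space sW using tensor by (simp add: is_tensor_product_def)
sublocale T: vector_space sT using tensor by (simp add: is_tensor_product_def)

lemma tau_bilinear: "\<tau> (v + v') w = \<tau> v w + \<tau> v' w" "\<tau> v (w + w') = \<tau> v w + \<tau> v w'"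
    "\<tau> (sV a v) w = sT a (\<tau> v w)" "\<tau> v (sW a w) = sT a (\<tau> v w)"
  using is_tensor_product_bilinear[OF tensor] unfolding is_bilinear_def Vector_Spaces.linear_iff by auto

text \<open>
  The coordinates on the tensor product with respect to the vectors \<open>\<tau> (e i) (f j)\<close>; they exist by
  the universal property, applied to the bilinear form \<open>c i v * d j w\<close>.
\<close>

definition coord_T :: "bool \<Rightarrow> bool \<Rightarrow> 't \<Rightarrow> 'k" where
  "coord_T i j = (SOME F. Vector_Spaces.linear sT (*) F \<and> (\<forall>v w. F (\<tau> v w) = c i v * d j w))"

lemma coord_T: "Vector_Spaces.linear sT (*) (coord_T i j)" "coord_T i j (\<tau> v w) = c i v * d j w"
proof -
  have "is_bilinear sV sW (*) (\<lambda>v w. c i v * d j w)"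
    using lin_c lin_d unfolding is_bilinear_def Vector_Spaces.linear_iff by (auto simp: algebra_simps)
  from is_tensor_product_universal[OF tensor vector_space_mult this]
  have "\<exists>F. Vector_Spaces.linear sT (*) F \<and> (\<forall>v w. F (\<tau> v w) = c i v * d j w)" by blast
  from someI_ex[OF this] show "Vector_Spaces.linear sT (*) (coord_T i j)" "coord_T i j (\<tau> v w) = c i v * d j w"
    unfolding coord_T_def by auto
qed

lemma coord_T_add: "coord_T i j (s + t) = coord_T i j s + coord_T i j t" and coord_T_scale: "coord_T i j (sT a t) = a * coord_T i j t"
  using coord_T(1)[of i j] by (auto simp: Vector_Spaces.linear_iff)

text \<open>
  The uniqueness part of the universal property.
\<close>

lemma linear_eqI:
  assumes "Vector_Spaces.linear sT sT F" "Vector_Spaces.linear sT sT G" "\<And>v w. F (\<tau> v w) = G (\<tau> v w)"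
  shows "F = G"
proof -
  have "is_bilinear sV sW sT (\<lambda>v w. G (\<tau> v w))"
    using assms(2) V.vector_space_axioms W.vector_space_axioms T.vector_space_axioms
    unfolding is_bilinear_def Vector_Spaces.linear_iff by (auto simp: tau_bilinear)
  from is_tensor_product_universal[OF tensor T.vector_space_axioms this]
  show ?thesis using assms by blast
qed

text \<open>
  Both sides are linear in \<open>t\<close> and agree on \<open>\<tau> v w\<close>. This is how the vectors \<open>\<tau> (e i) (f j)\<close> are
  seen to span the tensor product.
\<close>

lemma expand_T: "t = (\<Sum>i\<in>UNIV. \<Sum>j\<in>UNIV. sT (coord_T i j t) (\<tau> (e i) (f j)))"
proof -
  let ?G = "\<lambda>t. \<Sum>i\<in>UNIV. \<Sum>j\<in>UNIV. sT (coord_T i j t) (\<tau> (e i) (f j))"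
  have "(\<lambda>t. t) = ?G"
  proof (rule linear_eqI)
    show "Vector_Spaces.linear sT sT (\<lambda>t. t)"
      by (simp add: Vector_Spaces.linear_iff T.vector_space_axioms)
    show "Vector_Spaces.linear sT sT ?G"
      by (simp add: Vector_Spaces.linear_iff T.vector_space_axioms coord_T_add coord_T_scale T.scale_left_distrib
          UNIV_bool T.scale_right_distrib)
    fix v w
    have "\<tau> v w = \<tau> (\<Sum>i\<in>UNIV. sV (c i v) (e i)) (\<Sum>j\<in>UNIV. sW (d j w) (f j))"
      by (simp only: expand_V[symmetric] expand_W[symmetric])
    also have "\<dots> = ?G (\<tau> v w)"
      by (simp add: UNIV_bool tau_bilinear coord_T(2) T.scale_right_distrib mult_ac add_ac)
    finally show "\<tau> v w = ?G (\<tau> v w)" .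
  qed
  then show ?thesis by metis
qed

definition entries :: "('t \<Rightarrow> 't) \<Rightarrow> entry \<Rightarrow> 'k" where
  "entries A = (\<lambda>((i, i'), (j, j')). coord_T i j (A (\<tau> (e i') (f j'))))"

definition from_entries :: "(entry \<Rightarrow> 'k) \<Rightarrow> 't \<Rightarrow> 't" where
  "from_entries x t = (\<Sum>i'\<in>UNIV. \<Sum>j'\<in>UNIV. sT (coord_T i' j' t)
     (\<Sum>i\<in>UNIV. \<Sum>j\<in>UNIV. sT (x ((i, i'), (j, j'))) (\<tau> (e i) (f j))))"

abbreviation "U \<equiv> endomorphisms sT"
abbreviation "sE \<equiv> scale_fun sT"

lemma from_entries_in: "from_entries x \<in> U"
  unfolding endomorphisms_def mem_Collect_eq Vector_Spaces.linear_iff from_entries_def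
  by (simp add: T.vector_space_axioms coord_T_add coord_T_scale T.scale_left_distrib T.scale_right_distrib sum.distrib T.scale_sum_right distrib_right mult.assoc)

lemma entries_from_entries: "entries (from_entries x) = x"
proof
  fix p :: entry
  obtain i i' j j' where p: "p = ((i, i'), (j, j'))" by (metis prod.exhaust)
  show "entries (from_entries x) p = x p"
    unfolding p entries_def from_entries_def
    by (cases i; cases i'; cases j; cases j') (simp_all add: UNIV_bool coord_T coord_T_add coord_T_scale c_e d_f)
qed

lemma endomorphism_linear: "A \<in> U \<Longrightarrow> A (s + t) = A s + A t" "A \<in> U \<Longrightarrow> A (sT a t) = sT a (A t)"
  unfolding endomorphisms_def Vector_Spaces.linear_iff by auto

lemma apply_basis: "A (\<tau> (e i') (f j')) = (\<Sum>i\<in>UNIV. \<Sum>j\<in>UNIV. sT (entries A ((i, i'), (j, j'))) (\<tau> (e i) (f j)))"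
  unfolding entries_def prod.case by (rule expand_T)

lemma from_entries_entries:
  assumes "A \<in> U"
  shows "from_entries (entries A) = A"
proof
  fix t
  have "A t = A (\<Sum>i\<in>UNIV. \<Sum>j\<in>UNIV. sT (coord_T i j t) (\<tau> (e i) (f j)))"
    by (simp only: expand_T[symmetric])
  also have "\<dots> = (\<Sum>i\<in>UNIV. \<Sum>j\<in>UNIV. sT (coord_T i j t) (A (\<tau> (e i) (f j))))"
    by (simp add: UNIV_bool endomorphism_linear[OF assms])
  also have "\<dots> = from_entries (entries A) t"
    unfolding from_entries_def apply_basis[of A] ..
  finally show "from_entries (entries A) t = A t" ..
qed

lemma entries_add: "entries (A + B) p = entries A p + entries B p"
  and entries_scale: "entries (sE a A) p = a * entries A p"
  by (simp_all add: entries_def coord_T_add coord_T_scale scale_fun_apply split: prod.splits)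

lemma U_add: "A \<in> U \<Longrightarrow> B \<in> U \<Longrightarrow> A + B \<in> U" and U_scale: "A \<in> U \<Longrightarrow> sE a A \<in> U"
  unfolding endomorphisms_def Vector_Spaces.linear_iff
  by (auto simp: scale_fun_apply T.scale_right_distrib add_ac mult.commute)

text \<open>
  A function of the matrix entries, seen as a function on the endomorphisms that is extended by 0 to
  all maps.
\<close>

definition pullback :: "((entry \<Rightarrow> 'k) \<Rightarrow> 'k) \<Rightarrow> ('t \<Rightarrow> 't) \<Rightarrow> 'k" where
  "pullback g A = (if A \<in> U then g (entries A) else 0)"

lemma pullback_from_entries: "pullback g (from_entries x) = g x"
  by (simp add: pullback_def from_entries_in entries_from_entries)

lemma pullback_linear: "Vector_Spaces.linear (scale_fun (*)) (scale_fun (*)) pullback"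
  unfolding Vector_Spaces.linear_iff
  by (auto simp: fun_space.vector_space_axioms pullback_def scale_fun_apply fun_eq_iff)

lemma inj_pullback: "inj pullback"
proof (rule injI)
  fix g h assume "pullback g = pullback h"
  then have "pullback g (from_entries x) = pullback h (from_entries x)" for x by simp
  then show "g = h" by (auto simp: pullback_from_entries)
qed

lemma pullback_coord_linear_form: "pullback (\<lambda>x. x p) \<in> linear_forms sE U"
  by (auto simp: linear_forms_def pullback_def U_add U_scale entries_add entries_scale)

text \<open>
  The coefficient of the entry \<open>p\<close> is the value of the form on the endomorphism whose only nonzero
  entry is a 1 at \<open>p\<close>.
\<close>

lemma linear_form_eq_pullback:
  assumes l: "l \<in> linear_forms sE U"
  shows "\<exists>a. l = pullback (\<lambda>x. \<Sum>p\<in>UNIV. a p * x p)"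
proof -
  have add: "l (A + B) = l A + l B" if "A \<in> U" "B \<in> U" for A B
    using l that by (simp add: linear_forms_def)
  have scale: "l (sE a A) = a * l A" if "A \<in> U" for A a
    using l that by (simp add: linear_forms_def)
  define unit :: "entry \<Rightarrow> entry \<Rightarrow> 'k" where "unit p = (\<lambda>q. of_bool (q = p))" for p
  define a where "a p = l (from_entries (unit p))" for p
  have fe_add: "from_entries (\<lambda>p. x p + y p) = from_entries x + from_entries y" for x y
    by (rule ext) (simp add: from_entries_def T.scale_left_distrib T.scale_right_distrib sum.distrib)
  have fe_scale: "from_entries (\<lambda>p. b * x p) = sE b (from_entries x)" for x b
    by (rule ext) (simp add: from_entries_def scale_fun_apply T.scale_sum_right mult_ac)
  have "l (from_entries (\<lambda>q. \<Sum>p\<in>S. x p * unit p q)) = (\<Sum>p\<in>S. a p * x p)" if "finite S" for S x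
    using that
  proof (induction S)
    case empty
    have "from_entries (\<lambda>q. 0) = sE 0 (from_entries (\<lambda>q. 0))"
      using fe_scale[of 0 "\<lambda>q. 0"] by simp
    then show ?case using scale[OF from_entries_in, of 0 "\<lambda>q. 0"] by simp
  next
    case (insert p S)
    have "(\<lambda>q. \<Sum>p'\<in>insert p S. x p' * unit p' q) = (\<lambda>q. x p * unit p q + (\<Sum>p'\<in>S. x p' * unit p' q))"
      using insert by simp
    then have "from_entries (\<lambda>q. \<Sum>p'\<in>insert p S. x p' * unit p' q) = sE (x p) (from_entries (unit p)) + from_entries (\<lambda>q. \<Sum>p'\<in>S. x p' * unit p' q)"
      by (simp only: fe_add fe_scale)
    then have "l (from_entries (\<lambda>q. \<Sum>p'\<in>insert p S. x p' * unit p' q)) = x p * a p + (\<Sum>p\<in>S. a p * x p)"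
      using insert.IH by (simp only: add[OF U_scale[OF from_entries_in] from_entries_in] scale[OF from_entries_in] a_def)
    then show ?case using insert by (simp add: mult.commute)
  qed
  then have sum: "l (from_entries (\<lambda>q. \<Sum>p\<in>UNIV. x p * unit p q)) = (\<Sum>p\<in>UNIV. a p * x p)" for x
    by simp
  have unit: "(\<lambda>q. \<Sum>p\<in>UNIV. x p * unit p q) = x" for x
  proof
    fix q
    have "(\<Sum>p\<in>UNIV. x p * unit p q) = (\<Sum>p\<in>UNIV. if p = q then x p else 0)"
      by (rule sum.cong) (auto simp: unit_def)
    then show "(\<Sum>p\<in>UNIV. x p * unit p q) = x q" by simp
  qed
  note expand = sum[unfolded unit]
  have "l A = pullback (\<lambda>x. \<Sum>p\<in>UNIV. a p * x p) A" for A
  proof (cases "A \<in> U")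
    case True
    then show ?thesis using expand[of "entries A"] unfolding from_entries_entries[OF True] by (simp only: pullback_def if_True)
  next
    case False
    then show ?thesis using l by (simp add: linear_forms_def pullback_def)
  qed
  then have "l = pullback (\<lambda>x. \<Sum>p\<in>UNIV. a p * x p)" by (rule ext)
  then show ?thesis by (rule exI[of _ a])
qed

text \<open>
  A product of \<open>n\<close> linear forms expands into monomials of degree \<open>n\<close> in the entries, and the entries
  themselves are linear forms.
\<close>

lemma homogeneous_functions_eq: "homogeneous_functions sE U n = pullback ` homogeneous n"
proof -
  let ?G = "{(\<lambda>x. if x \<in> U then (\<Prod>i<n. l i x) else 0) |l. \<forall>i<n. l i \<in> linear_forms sE U}"
  have sub: "fun_space.subspace (pullback ` homogeneous n)"
    by (rule module_hom.subspace_image[OF pullback_linear[THEN Vector_Spaces.linear.axioms(3)]])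
      (simp add: homogeneous_def)
  have "?G \<subseteq> pullback ` homogeneous n"
  proof
    fix g assume "g \<in> ?G"
    then obtain l where g: "g = (\<lambda>x. if x \<in> U then (\<Prod>i<n. l i x) else 0)" and l: "\<forall>i<n. l i \<in> linear_forms sE U"
      by blast
    define a where "a i = (SOME a. l i = pullback (\<lambda>x. \<Sum>p\<in>UNIV. a p * x p))" for i
    have a: "l i = pullback (\<lambda>x. \<Sum>p\<in>UNIV. a i p * x p)" if "i < n" for i
      unfolding a_def using l that by (intro someI_ex[OF linear_form_eq_pullback]) blast
    have "g = pullback (\<lambda>x. \<Prod>i<n. \<Sum>p\<in>UNIV. a i p * x p)"
      by (rule ext) (simp add: g a pullback_def)
    moreover have "(\<lambda>x. \<Prod>i<n. \<Sum>p\<in>UNIV. a i p * x p) \<in> homogeneous n"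
      by (rule product_of_linear_forms_homogeneous[where a = a]) simp
    ultimately show "g \<in> pullback ` homogeneous n" by blast
  qed
  then have "homogeneous_functions sE U n \<subseteq> pullback ` homogeneous n"
    unfolding homogeneous_functions_def by (rule fun_space.span_minimal[OF _ sub])
  moreover have "pullback ` homogeneous n \<subseteq> homogeneous_functions sE U n"
  proof -
    have "pullback (monomial M) \<in> ?G" if "size M = n" for M
    proof -
      obtain ps where ps: "mset ps = M" using ex_mset by blast
      then have len: "length ps = n" using that by auto
      have "monomial M x = (\<Prod>i<n. x (ps ! i))" for x :: "entry \<Rightarrow> 'k"
      proof -
        have "monomial M x = prod_list (map x ps)"
          by (simp add: monomial_def ps[symmetric] prod_mset_prod_list[symmetric])
        also have "\<dots> = (\<Prod>i<n. x (ps ! i))"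
          using len by (simp add: prod.list_conv_set_nth atLeast0LessThan)
        finally show ?thesis .
      qed
      then have "pullback (monomial M) = (\<lambda>A. if A \<in> U then (\<Prod>i<n. pullback (\<lambda>x. x (ps ! i)) A) else 0)"
        by (auto simp: pullback_def fun_eq_iff)
      moreover have "\<forall>i<n. pullback (\<lambda>x. x (ps ! i)) \<in> linear_forms sE U"
        using pullback_coord_linear_form by simp
      ultimately show ?thesis
        by (intro CollectI exI[of _ "\<lambda>i. pullback (\<lambda>x. x (ps ! i))"] conjI)
    qed
    then have "pullback ` monomial ` {M. size M = n} \<subseteq> homogeneous_functions sE U n"
      unfolding homogeneous_functions_def using fun_space.span_base by blast
    then have "fun_space.span (pullback ` monomial ` {M. size M = n}) \<subseteq> homogeneous_functions sE U n"
      by (rule fun_space.span_minimal) (simp add: homogeneous_functions_def)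
    then show ?thesis
      unfolding homogeneous_def module_hom.span_image[OF pullback_linear[THEN Vector_Spaces.linear.axioms(3)]] .
  qed
  ultimately show ?thesis by blast
qed

lemma homogeneous_functions_polynomial: "homogeneous_functions sE U n \<subseteq> polynomial_functions sE U"
proof
  fix g assume "g \<in> homogeneous_functions sE U n"
  then show "g \<in> polynomial_functions sE U"
    unfolding homogeneous_functions_def
  proof (induction rule: fun_space.span_induct_alt)
    case base
    have "(\<lambda>x. if x \<in> U then 0 else 0) \<in> polynomial_functions sE U"
      by (rule polynomial_functions.const)
    then show ?case by (simp add: zero_fun_def)
  next
    case (step a g h)
    then obtain l where g: "g = (\<lambda>x. if x \<in> U then (\<Prod>i<n. l i x) else 0)" and l: "\<forall>i<n. l i \<in> linear_forms sE U"
      by blast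
    have "(\<lambda>x. if x \<in> U then (\<Prod>i<m. l i x) else 0) \<in> polynomial_functions sE U" if "m \<le> n" for m
      using that
    proof (induction m)
      case 0
      then show ?case using polynomial_functions.const[of U 1 sE] by (simp cong: if_cong)
    next
      case (Suc m)
      then have "(\<lambda>x. (if x \<in> U then (\<Prod>i<m. l i x) else 0) * l m x) \<in> polynomial_functions sE U"
        using l by (intro polynomial_functions.mult[OF _ polynomial_functions.linear_form]) auto
      moreover have "(\<lambda>x. (if x \<in> U then (\<Prod>i<m. l i x) else 0) * l m x) =
          (\<lambda>x. if x \<in> U then (\<Prod>i<Suc m. l i x) else 0)"
        by (rule ext) simp
      ultimately show ?case by simp
    qed
    then have "g \<in> polynomial_functions sE U" by (simp add: g)
    then have "(\<lambda>x. (if x \<in> U then a else 0) * g x + h x) \<in> polynomial_functions sE U"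
      by (intro polynomial_functions.add polynomial_functions.mult polynomial_functions.const step)
    moreover have "(\<lambda>x. (if x \<in> U then a else 0) * g x + h x) = scale_fun (*) a g + h"
      by (rule ext) (simp add: g scale_fun_apply)
    ultimately show ?case by (simp only:)
  qed
qed

definition matrix_V :: "('v \<Rightarrow> 'v) \<Rightarrow> bool \<Rightarrow> bool \<Rightarrow> 'k" where
  "matrix_V g i k = c i (g (e k))"

definition matrix_W :: "('w \<Rightarrow> 'w) \<Rightarrow> bool \<Rightarrow> bool \<Rightarrow> 'k" where
  "matrix_W h i k = d i (h (f k))"

lemma c_add: "c i (v + v') = c i v + c i v'" and c_scale: "c i (sV a v) = a * c i v"
  using lin_c[of i] by (auto simp: Vector_Spaces.linear_iff)

lemma d_add: "d i (w + w') = d i w + d i w'" and d_scale: "d i (sW a w) = a * d i w"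
  using lin_d[of i] by (auto simp: Vector_Spaces.linear_iff)

lemma GL_inverse:
  assumes "g \<in> general_linear_group s"
  shows "inv g \<in> general_linear_group s" "g \<circ> inv g = id" "inv g \<circ> g = id"
proof -
  have g: "Vector_Spaces.linear s s g" "bij g" using assms by (auto simp: general_linear_group_def)
  have "Vector_Spaces.linear s s (inv g)"
    using g unfolding Vector_Spaces.linear_iff
    by (metis (no_types, lifting) bij_inv_eq_iff)
  then show "inv g \<in> general_linear_group s" using g(2) by (simp add: general_linear_group_def bij_imp_bij_inv)
  show "g \<circ> inv g = id" "inv g \<circ> g = id" using g(2) by (auto simp: fun_eq_iff bij_is_surj surj_f_inv_f bij_is_inj inv_f_f)
qed

lemma GL_linear: "g \<in> general_linear_group s \<Longrightarrow> Vector_Spaces.linear s s g"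
  by (simp add: general_linear_group_def)

lemma matrix_V_comp:
  assumes "Vector_Spaces.linear sV sV g"
  shows "mat_mult (matrix_V g) (matrix_V g') = matrix_V (g \<circ> g')"
proof (intro ext)
  interpret g: Vector_Spaces.linear sV sV g by fact
  fix i k
  have "g (g' (e k)) = g (\<Sum>j\<in>UNIV. sV (c j (g' (e k))) (e j))"
    by (simp only: expand_V[symmetric])
  then show "mat_mult (matrix_V g) (matrix_V g') i k = matrix_V (g \<circ> g') i k"
    by (simp add: mat_mult_def matrix_V_def UNIV_bool g.add g.scale c_add c_scale mult.commute)
qed

lemma matrix_W_comp:
  assumes "Vector_Spaces.linear sW sW h"
  shows "mat_mult (matrix_W h) (matrix_W h') = matrix_W (h \<circ> h')"
proof (intro ext)
  interpret h: Vector_Spaces.linear sW sW h by fact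
  fix i k
  have "h (h' (f k)) = h (\<Sum>j\<in>UNIV. sW (d j (h' (f k))) (f j))"
    by (simp only: expand_W[symmetric])
  then show "mat_mult (matrix_W h) (matrix_W h') i k = matrix_W (h \<circ> h') i k"
    by (simp add: mat_mult_def matrix_W_def UNIV_bool h.add h.scale d_add d_scale mult.commute)
qed

lemma matrix_id: "matrix_V id = mat_one" "matrix_W id = mat_one"
  by (auto simp: fun_eq_iff matrix_V_def matrix_W_def mat_one_def c_e d_f)

lemma inverse_mats_GL_V:
  assumes "g \<in> general_linear_group sV"
  shows "inverse_mats (matrix_V g) (matrix_V (inv g))"
  unfolding inverse_mats_def matrix_V_comp[OF GL_linear[OF assms]]
    matrix_V_comp[OF GL_linear[OF GL_inverse(1)[OF assms]]] GL_inverse[OF assms] matrix_id by simp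

lemma inverse_mats_GL_W:
  assumes "h \<in> general_linear_group sW"
  shows "inverse_mats (matrix_W h) (matrix_W (inv h))"
  unfolding inverse_mats_def matrix_W_comp[OF GL_linear[OF assms]]
    matrix_W_comp[OF GL_linear[OF GL_inverse(1)[OF assms]]] GL_inverse[OF assms] matrix_id by simp

definition map_V :: "(bool \<Rightarrow> bool \<Rightarrow> 'k) \<Rightarrow> 'v \<Rightarrow> 'v" where
  "map_V m v = (\<Sum>i\<in>UNIV. sV (\<Sum>k\<in>UNIV. m i k * c k v) (e i))"

definition map_W :: "(bool \<Rightarrow> bool \<Rightarrow> 'k) \<Rightarrow> 'w \<Rightarrow> 'w" where
  "map_W m w = (\<Sum>i\<in>UNIV. sW (\<Sum>k\<in>UNIV. m i k * d k w) (f i))"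

lemma map_V_props: "Vector_Spaces.linear sV sV (map_V m)" "matrix_V (map_V m) = m"
  "map_V m (map_V m' v) = map_V (mat_mult m m') v" "map_V mat_one v = v"
proof -
  show "Vector_Spaces.linear sV sV (map_V m)"
    unfolding Vector_Spaces.linear_iff map_V_def
    by (simp add: V.vector_space_axioms UNIV_bool c_add c_scale V.scale_left_distrib V.scale_right_distrib algebra_simps)
  show "matrix_V (map_V m) = m"
    by (intro ext, rename_tac i k, case_tac i; case_tac k)
      (simp_all add: matrix_V_def map_V_def UNIV_bool c_add c_scale c_e)
  show "map_V m (map_V m' v) = map_V (mat_mult m m') v"
    by (simp add: map_V_def mat_mult_def UNIV_bool c_add c_scale c_e algebra_simps)
  have "map_V mat_one v = (\<Sum>i\<in>UNIV. sV (c i v) (e i))"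
    by (simp add: map_V_def mat_one_def UNIV_bool)
  then show "map_V mat_one v = v" by (simp only: expand_V[symmetric])
qed

lemma map_W_props: "Vector_Spaces.linear sW sW (map_W m)" "matrix_W (map_W m) = m"
  "map_W m (map_W m' w) = map_W (mat_mult m m') w" "map_W mat_one w = w"
proof -
  show "Vector_Spaces.linear sW sW (map_W m)"
    unfolding Vector_Spaces.linear_iff map_W_def
    by (simp add: W.vector_space_axioms UNIV_bool d_add d_scale W.scale_left_distrib W.scale_right_distrib algebra_simps)
  show "matrix_W (map_W m) = m"
    by (intro ext, rename_tac i k, case_tac i; case_tac k)
      (simp_all add: matrix_W_def map_W_def UNIV_bool d_add d_scale d_f)
  show "map_W m (map_W m' w) = map_W (mat_mult m m') w"
    by (simp add: map_W_def mat_mult_def UNIV_bool d_add d_scale d_f algebra_simps)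
  have "map_W mat_one w = (\<Sum>i\<in>UNIV. sW (d i w) (f i))"
    by (simp add: map_W_def mat_one_def UNIV_bool)
  then show "map_W mat_one w = w" by (simp only: expand_W[symmetric])
qed

lemma GL_of_inverse_mats_V:
  assumes "inverse_mats m m'"
  shows "map_V m \<in> general_linear_group sV" "inv (map_V m) = map_V m'"
proof -
  have "mat_mult m m' = mat_one" "mat_mult m' m = mat_one"
    using assms by (simp_all add: inverse_mats_def)
  then have "map_V m \<circ> map_V m' = id" "map_V m' \<circ> map_V m = id"
    by (simp_all add: comp_def id_def map_V_props)
  then show "map_V m \<in> general_linear_group sV" "inv (map_V m) = map_V m'"
    using map_V_props(1) by (auto simp: general_linear_group_def intro: o_bij inv_unique_comp)
qed

lemma GL_of_inverse_mats_W:
  assumes "inverse_mats m m'"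
  shows "map_W m \<in> general_linear_group sW" "inv (map_W m) = map_W m'"
proof -
  have "mat_mult m m' = mat_one" "mat_mult m' m = mat_one"
    using assms by (simp_all add: inverse_mats_def)
  then have "map_W m \<circ> map_W m' = id" "map_W m' \<circ> map_W m = id"
    by (simp_all add: comp_def id_def map_W_props)
  then show "map_W m \<in> general_linear_group sW" "inv (map_W m) = map_W m'"
    using map_W_props(1) by (auto simp: general_linear_group_def intro: o_bij inv_unique_comp)
qed

lemma tensor_map_comp:
  assumes "Vector_Spaces.linear sV sV g" "Vector_Spaces.linear sV sV g'"
    and "Vector_Spaces.linear sW sW h" "Vector_Spaces.linear sW sW h'"
    and "g \<circ> g' = id" "h \<circ> h' = id"
  shows "tensor_map sT \<tau> g h \<circ> tensor_map sT \<tau> g' h' = id"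
proof (rule linear_eqI)
  note F = tensor_map_linear[OF tensor assms(1,3)] and G = tensor_map_linear[OF tensor assms(2,4)]
  show "Vector_Spaces.linear sT sT (tensor_map sT \<tau> g h \<circ> tensor_map sT \<tau> g' h')"
    using F(1) G(1) by (simp add: Vector_Spaces.linear_iff)
  show "Vector_Spaces.linear sT sT id"
    by (simp add: Vector_Spaces.linear_iff T.vector_space_axioms)
  show "(tensor_map sT \<tau> g h \<circ> tensor_map sT \<tau> g' h') (\<tau> v w) = id (\<tau> v w)" for v w
    using assms(5,6) by (simp add: F G fun_eq_iff)
qed

lemma inv_tensor_map:
  assumes "g \<in> general_linear_group sV" "h \<in> general_linear_group sW"
  shows "inv (tensor_map sT \<tau> g h) = tensor_map sT \<tau> (inv g) (inv h)"
  by (rule inv_unique_comp; rule tensor_map_comp) (simp_all add: GL_linear GL_inverse[OF assms(1)] GL_inverse[OF assms(2)] assms)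

text \<open>
  The inverse of \<open>g \<otimes> h\<close> is \<open>inv g \<otimes> inv h\<close>, and the entries of a product of linear maps are those of
  the product of their matrices.
\<close>

lemma entries_conjugate:
  assumes g: "g \<in> general_linear_group sV" and h: "h \<in> general_linear_group sW" and A: "A \<in> U"
  shows "conjugate (tensor_map sT \<tau> g h) A \<in> U"
    and "entries (conjugate (tensor_map sT \<tau> g h) A) =
      conj_V (matrix_V g) (matrix_V (inv g)) (conj_W (matrix_W h) (matrix_W (inv h)) (entries A))"
proof -
  note lin = GL_linear[OF g] GL_linear[OF h] GL_linear[OF GL_inverse(1)[OF g]] GL_linear[OF GL_inverse(1)[OF h]]
  note F = tensor_map_linear[OF tensor lin(1,2)] and F' = tensor_map_linear[OF tensor lin(3,4)]
  let ?F = "tensor_map sT \<tau> g h" and ?F' = "tensor_map sT \<tau> (inv g) (inv h)"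
  have conj: "conjugate ?F A = ?F \<circ> A \<circ> ?F'"
    by (simp add: conjugate_def inv_tensor_map[OF g h])
  show "conjugate ?F A \<in> U"
    using F(1) F'(1) A unfolding conj endomorphisms_def by (simp add: Vector_Spaces.linear_iff)
  interpret F: Vector_Spaces.linear sT sT ?F by (rule F(1))
  have F'_basis: "?F' (\<tau> (e i') (f j')) = (\<Sum>k'\<in>UNIV. \<Sum>l'\<in>UNIV.
      sT (matrix_V (inv g) k' i' * matrix_W (inv h) l' j') (\<tau> (e k') (f l')))" for i' j'
  proof -
    have "?F' (\<tau> (e i') (f j')) = \<tau> (\<Sum>k'\<in>UNIV. sV (c k' (inv g (e i'))) (e k')) (\<Sum>l'\<in>UNIV. sW (d l' (inv h (f j'))) (f l'))"
      by (simp only: F'(2) expand_V[symmetric] expand_W[symmetric])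
    then show ?thesis
      by (simp add: UNIV_bool tau_bilinear matrix_V_def matrix_W_def T.scale_right_distrib mult.commute add_ac)
  qed
  have D_F: "coord_T i j (?F (A (\<tau> (e k') (f l')))) = (\<Sum>k\<in>UNIV. \<Sum>l\<in>UNIV.
      entries A ((k, k'), (l, l')) * (matrix_V g i k * matrix_W h j l))" for i j k' l'
    unfolding apply_basis[of A]
    by (simp add: UNIV_bool F.add F.scale coord_T_add coord_T_scale F(2) coord_T(2) matrix_V_def matrix_W_def)
  show "entries (conjugate ?F A) =
      conj_V (matrix_V g) (matrix_V (inv g)) (conj_W (matrix_W h) (matrix_W (inv h)) (entries A))"
  proof
    fix p :: entry
    obtain i i' j j' where p: "p = ((i, i'), (j, j'))" by (metis prod.exhaust)
    have "entries (conjugate ?F A) p = coord_T i j (?F (A (?F' (\<tau> (e i') (f j')))))"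
      by (simp add: p entries_def conj)
    also have "\<dots> = (\<Sum>k'\<in>UNIV. \<Sum>l'\<in>UNIV. (matrix_V (inv g) k' i' * matrix_W (inv h) l' j') *
      coord_T i j (?F (A (\<tau> (e k') (f l')))))"
      by (simp add: F'_basis UNIV_bool endomorphism_linear[OF A] F.add F.scale coord_T_add coord_T_scale)
    also have "\<dots> = conj_V (matrix_V g) (matrix_V (inv g)) (conj_W (matrix_W h) (matrix_W (inv h)) (entries A)) p"
      unfolding D_F by (simp add: p conj_V_def conj_W_def swap_factors_def UNIV_bool algebra_simps)
    finally show "entries (conjugate ?F A) p =
      conj_V (matrix_V g) (matrix_V (inv g)) (conj_W (matrix_W h) (matrix_W (inv h)) (entries A)) p" .
  qed
qed

text \<open>
  Every pair of mutually inverse matrices comes from an element of the general linear group and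
  conversely, so both notions of invariance agree.
\<close>

lemma invariant_component_eq:
  "tensor_End_invariants sV sW sT \<tau> \<inter> homogeneous_functions sE U n = pullback ` matrix_invariants n"
proof (intro equalityI subsetI)
  fix F assume F: "F \<in> tensor_End_invariants sV sW sT \<tau> \<inter> homogeneous_functions sE U n"
  then obtain q where q: "q \<in> homogeneous n" "F = pullback q" unfolding homogeneous_functions_eq by blast
  have "q (conj_V m m' (conj_W r r' x)) = q x" if m: "inverse_mats m m'" and r: "inverse_mats r r'" for m m' r r' x
  proof -
    let ?a = "conjugate (tensor_map sT \<tau> (map_V m) (map_W r))"
    note GL = GL_of_inverse_mats_V[OF m] GL_of_inverse_mats_W[OF r]
    have "F (?a (from_entries x)) = F (from_entries x)"
      using F GL from_entries_in unfolding tensor_End_invariants_def invariant_functions_def by blast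
    then show ?thesis
      by (simp add: q(2) pullback_def entries_conjugate GL from_entries_in entries_from_entries map_V_props map_W_props)
  qed
  then have "q \<in> matrix_invariants n" using q by (simp add: matrix_invariants_def)
  then show "F \<in> pullback ` matrix_invariants n" using q by blast
next
  fix F assume "F \<in> pullback ` matrix_invariants n"
  then obtain q where q: "q \<in> homogeneous n" "F = pullback q" and
    inv: "\<And>m m' r r' x. inverse_mats m m' \<Longrightarrow> inverse_mats r r' \<Longrightarrow> q (conj_V m m' (conj_W r r' x)) = q x"
    by (auto simp: matrix_invariants_def)
  have hom: "F \<in> homogeneous_functions sE U n" using q by (simp add: homogeneous_functions_eq)
  have "F (conjugate (tensor_map sT \<tau> g h) A) = F A"
    if "g \<in> general_linear_group sV" "h \<in> general_linear_group sW" "A \<in> U" for g h A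
    using that by (simp add: q(2) pullback_def entries_conjugate inv inverse_mats_GL_V inverse_mats_GL_W)
  then show "F \<in> tensor_End_invariants sV sW sT \<tau> \<inter> homogeneous_functions sE U n"
    using hom homogeneous_functions_polynomial[of n]
    unfolding tensor_End_invariants_def invariant_functions_def by blast
qed

lemma dim_invariant_component:
  "int (fun_space.dim (tensor_End_invariants sV sW sT \<tau> \<inter> homogeneous_functions sE U n)) =
    int (weight_count entry_weight n (0, 0)) - int (weight_count entry_weight n (1, 0))
      - int (weight_count entry_weight n (0, 1)) + int (weight_count entry_weight n (1, 1))"
proof -
  have "fun_space.dim (pullback ` matrix_invariants n) = fun_space.dim (matrix_invariants n :: ((entry \<Rightarrow> 'k) \<Rightarrow> 'k) set)"
    by (rule fun_space.dim_injective_image[OF fun_space.vector_space_axioms pullback_linear])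
      (rule inj_on_subset[OF inj_pullback subset_UNIV])
  then show ?thesis
    by (simp add: invariant_component_eq matrix_invariants_eq dim_highest_weight_invariants)
qed

end

section \<open>Power series with Laurent polynomial coefficients\<close>

unbundle fps_syntax

text \<open>
  A ring homomorphism, applied to the coefficients of power series. It serves for the inclusion of the
  integers into the rational numbers and for that of the constants into the Laurent polynomials.
\<close>

locale coefficient_map =
  fixes h :: "'a::comm_ring_1 \<Rightarrow> 'b::comm_ring_1"
  assumes map_coeff_1: "h 1 = 1" and map_coeff_add: "h (a + b) = h a + h b" and map_coeff_mult: "h (a * b) = h a * h b"
begin

definition map_fps :: "'a fps \<Rightarrow> 'b fps" where
  "map_fps f = Abs_fps (\<lambda>n. h (f $ n))"

lemma map_coeff_0: "h 0 = 0"
  using map_coeff_add[of 0 0] by simp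

lemma map_coeff_diff: "h (a - b) = h a - h b"
  using map_coeff_add[of "a - b" b] by simp

lemma map_coeff_sum: "h (sum f A) = (\<Sum>a\<in>A. h (f a))"
  by (induction A rule: infinite_finite_induct) (simp_all add: map_coeff_0 map_coeff_add)

lemma map_fps_nth: "map_fps f $ n = h (f $ n)"
  by (simp add: map_fps_def)

lemma map_fps_add: "map_fps (f + g) = map_fps f + map_fps g"
  and map_fps_diff: "map_fps (f - g) = map_fps f - map_fps g"
  and map_fps_mult: "map_fps (f * g) = map_fps f * map_fps g"
  and map_fps_1: "map_fps 1 = 1"
  and map_fps_X: "map_fps fps_X = fps_X"
  by (simp_all add: fps_eq_iff map_fps_nth map_coeff_add map_coeff_diff map_coeff_sum map_coeff_mult map_coeff_0 map_coeff_1 fps_mult_nth fps_X_def)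

lemma map_fps_power: "map_fps (f ^ n) = map_fps f ^ n"
  by (induction n) (simp_all add: map_fps_1 map_fps_mult)

lemma map_fps_numeral: "map_fps (numeral n) = numeral n"
  by (induction n) (simp_all only: numeral.simps map_fps_1 map_fps_add)

lemmas map_fps_simps = map_fps_add map_fps_diff map_fps_mult map_fps_1 map_fps_X map_fps_power map_fps_numeral

end

interpretation of_int_rat: coefficient_map "of_int :: int \<Rightarrow> rat"
  by unfold_locales simp_all

text \<open>
  With the lexicographic order on exponents, the Laurent polynomials in two variables form an
  integral domain, and so do the power series over them. The proof method \<open>algebra\<close> relies on this.
\<close>

instance prod :: (linordered_ab_group_add, linordered_ab_group_add) ordered_ab_semigroup_add
  by intro_classes (auto simp: less_eq_prod_def)

instance prod :: (linordered_ab_group_add, linordered_ab_group_add) ordered_cancel_comm_monoid_add ..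

text \<open>
  The coefficient of \<open>x\<^sup>n\<close> is a Laurent polynomial in \<open>z\<close> and \<open>w\<close>; the exponent of \<open>z\<^sup>a w\<^sup>b\<close> is the
  pair \<open>(a, b)\<close>.
\<close>

type_synonym laurent_series = "(int \<times> int \<Rightarrow>\<^sub>0 int) fps"

definition supported :: "(int \<times> int) set \<Rightarrow> laurent_series set" where
  "supported S = {f. \<forall>n. Poly_Mapping.keys (f $ n) \<subseteq> S}"

lemma supported_add: "f \<in> supported S \<Longrightarrow> g \<in> supported S \<Longrightarrow> f + g \<in> supported S"
  using Poly_Mapping.keys_add by (fastforce simp: supported_def)

lemma supported_uminus: "f \<in> supported S \<Longrightarrow> - f \<in> supported S"
  by (simp add: supported_def)

lemma supported_diff: "f \<in> supported S \<Longrightarrow> g \<in> supported S \<Longrightarrow> f - g \<in> supported S"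
  using supported_add[of f S "- g"] supported_uminus[of g S] by simp

lemma keys_sum_subset:
  assumes "\<And>a. a \<in> A \<Longrightarrow> Poly_Mapping.keys (f a) \<subseteq> S"
  shows "Poly_Mapping.keys (sum f A) \<subseteq> S"
  using Poly_Mapping.keys_sum[of f A] assms by blast

lemma supported_mult:
  assumes "f \<in> supported S" "g \<in> supported T" "\<And>p q. p \<in> S \<Longrightarrow> q \<in> T \<Longrightarrow> p + q \<in> U"
  shows "f * g \<in> supported U"
  unfolding supported_def mem_Collect_eq fps_mult_nth
proof (intro allI keys_sum_subset)
  fix n i
  show "Poly_Mapping.keys (f $ i * g $ (n - i)) \<subseteq> U"
    using Poly_Mapping.keys_mult[of "f $ i" "g $ (n - i)"] assms unfolding supported_def by blast
qed

text \<open>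
  The coefficients of the inverse are sums of products of earlier ones with coefficients of \<open>f\<close>, so
  their exponents stay in \<open>S\<close>.
\<close>

lemma supported_left_inverse:
  assumes "f \<in> supported S" "f $ 0 = 1" "0 \<in> S" "\<And>p q. p \<in> S \<Longrightarrow> q \<in> S \<Longrightarrow> p + q \<in> S"
  shows "\<exists>g \<in> supported S. g * f = 1"
proof -
  let ?g = "fps_left_inverse f 1"
  have "Poly_Mapping.keys (?g $ n) \<subseteq> S" for n
  proof (induction n rule: less_induct)
    case (less n)
    show ?case
    proof (cases n)
      case 0
      then show ?thesis using assms(3) by simp
    next
      case (Suc m)
      have "Poly_Mapping.keys (\<Sum>i = 0..m. ?g $ i * f $ (Suc m - i)) \<subseteq> S"
      proof (rule keys_sum_subset)
        fix i assume "i \<in> {0..m}"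
        then have "Poly_Mapping.keys (?g $ i) \<subseteq> S" using less Suc by simp
        then show "Poly_Mapping.keys (?g $ i * f $ (Suc m - i)) \<subseteq> S"
          using Poly_Mapping.keys_mult[of "?g $ i" "f $ (Suc m - i)"] assms unfolding supported_def by blast
      qed
      then show ?thesis by (simp add: Suc)
    qed
  qed
  then have "?g \<in> supported S" by (simp add: supported_def)
  moreover have "?g * f = 1" by (rule fps_left_inverse) (use assms(2) in simp)
  ultimately show ?thesis by blast
qed

definition const_term :: "laurent_series \<Rightarrow> int fps" where
  "const_term f = Abs_fps (\<lambda>n. Poly_Mapping.lookup (f $ n) 0)"

lemma const_term_add: "const_term (f + g) = const_term f + const_term g"
  by (simp add: const_term_def fps_eq_iff lookup_add)

lemma const_term_supported: "f \<in> supported S \<Longrightarrow> 0 \<notin> S \<Longrightarrow> const_term f = 0"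
  unfolding const_term_def supported_def fps_eq_iff
  by (simp add: not_in_keys_iff_lookup_eq_zero[symmetric]) blast

interpretation const_embed: coefficient_map "Poly_Mapping.single 0 :: int \<Rightarrow> int \<times> int \<Rightarrow>\<^sub>0 int"
  by unfold_locales (simp_all add: Poly_Mapping.single_add mult_single)

lemma lookup_single_zero_mult:
  "Poly_Mapping.lookup (Poly_Mapping.single 0 a * f) p = a * Poly_Mapping.lookup (f :: int \<times> int \<Rightarrow>\<^sub>0 int) p"
  unfolding mult_map_scale_conv_mult[symmetric] by (simp add: Poly_Mapping.map.rep_eq when_def)

lemma const_term_const_embed_mult: "const_term (const_embed.map_fps c * f) = c * const_term f"
  by (simp add: const_embed.map_fps_nth fps_eq_iff fps_mult_nth const_term_def lookup_sum lookup_single_zero_mult)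

definition mon :: "int \<times> int \<Rightarrow> laurent_series" where
  "mon p = fps_const (Poly_Mapping.single p 1)"

lemma mon_mult: "mon p * mon q = mon (p + q)"
  by (simp add: mon_def mult_single)

lemma mon_0: "mon 0 = 1"
  by (simp add: mon_def)

lemma supported_mon: "p \<in> S \<Longrightarrow> mon p \<in> supported S"
  by (simp add: mon_def supported_def fps_const_def)

lemma supported_X: "0 \<in> S \<Longrightarrow> fps_X \<in> supported S"
  by (simp add: fps_X_def supported_def)

lemma supported_const_embed: "0 \<in> S \<Longrightarrow> const_embed.map_fps c \<in> supported S"
  by (simp add: const_embed.map_fps_nth supported_def)

lemma supported_numeral: "0 \<in> S \<Longrightarrow> numeral n \<in> supported S"
  using supported_const_embed[of S "numeral n"] by (simp add: const_embed.map_fps_numeral)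

lemma supported_1: "0 \<in> S \<Longrightarrow> 1 \<in> supported S"
  using supported_const_embed[of S 1] by (simp add: const_embed.map_fps_1)

definition submonoid :: "(int \<times> int) set \<Rightarrow> bool" where
  "submonoid S \<longleftrightarrow> 0 \<in> S \<and> (\<forall>p\<in>S. \<forall>q\<in>S. p + q \<in> S)"

lemma supported_ring_mult:
  "submonoid S \<Longrightarrow> f \<in> supported S \<Longrightarrow> g \<in> supported S \<Longrightarrow> f * g \<in> supported S"
  by (rule supported_mult) (auto simp: submonoid_def)

lemma supported_ring_power: "submonoid S \<Longrightarrow> f \<in> supported S \<Longrightarrow> f ^ n \<in> supported S"
  by (induction n) (auto intro: supported_ring_mult supported_1 simp: submonoid_def)

lemma supported_ring_const:
  assumes "submonoid S"
  shows "fps_X \<in> supported S" "1 \<in> supported S" "numeral n \<in> supported S"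
  using assms by (auto simp: submonoid_def intro: supported_X supported_1 supported_numeral)

section \<open>The constant term of the weight series\<close>

text \<open>
  The four entries with a given pair of indices for \<open>V\<close> contribute to the generating function the
  factors \<open>1 - t w\<close>, \<open>1 - t / w\<close> and twice \<open>1 - t\<close>, where the parameter \<open>t\<close> is one of \<open>x, x, x z, x / z\<close>.
  With \<open>y = z + 1/z\<close> the product of the four factors \<open>1 - t w\<close> is \<open>quartic x y w\<close>, and that of the
  factors \<open>1 - t / w\<close> is its value at \<open>1/w\<close>.
\<close>

definition quartic :: "'a::comm_ring_1 \<Rightarrow> 'a \<Rightarrow> 'a \<Rightarrow> 'a" where
  "quartic x y w = (1 - x*w)^2 * (1 - x*y*w + x^2*w^2)"

text \<open>
  The product of \<open>1 - s t\<close> over all unordered pairs of the four parameters, repetitions included,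
  divided by the product of the four factors \<open>1 - t\<close> and by a further factor \<open>1 - x\<^sup>2\<close> that cancels.
  It is the denominator that arises when the poles inside the unit circle are separated from those
  outside.
\<close>

definition inner_den :: "'a::comm_ring_1 \<Rightarrow> 'a \<Rightarrow> 'a" where
  "inner_den x y = (1 - x^2) * (1 + x)^2 * (1 - x^2*y + x^4)^2 * (1 + x*y + x^2)"

definition inner_num :: "'a::comm_ring_1 \<Rightarrow> 'a \<Rightarrow> 'a" where
  "inner_num x y = 1 + x^2 + 2*x^3 + x^3*y + x^4 + x^6"

definition inner_pos :: "'a::comm_ring_1 \<Rightarrow> 'a \<Rightarrow> 'a \<Rightarrow> 'a" where
  "inner_pos x y w =
     (2*x + x*y + 2*x^2 + 2*x^2*y + 2*x^3 + x^3*y + 2*x^4 + 2*x^4*y + 2*x^5 + x^5*y)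
     + (- (2*x^2 + 2*x^2*y + 2*x^3 + x^3*y + 2*x^4 + 2*x^4*y + 4*x^5 + 6*x^5*y + 2*x^5*y^2 + 4*x^6 + 4*x^6*y + x^6*y^2)) * w
     + (2*x^3 + x^3*y + x^4 + 2*x^5 + x^5*y + 5*x^6 + 4*x^6*y + x^6*y^2 + 4*x^7 + 2*x^7*y + x^8 + 2*x^9 + x^9*y + x^10) * w^2
     + (- (x^4 + x^6 + 2*x^7 + x^7*y + x^8 + x^10)) * w^3"

definition inner_neg :: "'a::comm_ring_1 \<Rightarrow> 'a \<Rightarrow> 'a \<Rightarrow> 'a" where
  "inner_neg x y w =
     (- (1 + x^2 + 2*x^3 + x^3*y + x^4 + x^6))
     + (2*x^4 - 2*x^2 - 2*x^2*y + 2*x^4*y + x^4*y^2 + 2*x^7 + x^7*y) * w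
     + (2*x^3 + x^3*y + 2*x^6 + 2*x^6*y + x^6*y^2 - 2*x^8 - 2*x^8*y) * w^2
     + (- (x^4 + x^6 + 2*x^7 + x^7*y + x^8 + x^10)) * w^3"

text \<open>
  Divided by both quartics this is the decomposition of \<open>(1 - 1/w) inner_den / (A(w) A(1/w))\<close>, where
  \<open>A\<close> is the quartic, into a part constant in \<open>w\<close>, a part with positive powers of \<open>w\<close> and a part with
  negative powers. The numerators are determined by this: the sum of the terms with positive powers
  of \<open>w\<close>, multiplied by \<open>A(w)\<close>, is a polynomial, namely \<open>w\<close> times \<open>inner_pos\<close>.
\<close>

lemma inner_partial_fractions:
  fixes x y w w' :: "'a::idom"
  assumes "w * w' = 1"
  shows "(1 - w') * inner_den x y =
    inner_num x y * (quartic x y w * quartic x y w')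
    + w * inner_pos x y w * quartic x y w' + w' * inner_neg x y w' * quartic x y w"
proof -
  have nz: "w \<noteq> 0" using assms by auto
  define q where "q = (w - x)^2 * (w^2 - x*y*w + x^2)"
  have q: "w^4 * quartic x y w' = q"
    unfolding q_def quartic_def using assms by algebra
  define n where "n = 2*x^3*w - w^3 - 2*x^2*w^2 - x^2*w^3 - 2*x^2*y*w^2 - 2*x^3*w^3 + x^3*y*w - x^3*y*w^3 - x^4 + 2*x^4*w^2 - x^4*w^3 + 2*x^4*y*w^2 + x^4*y^2*w^2 - x^6 + 2*x^6*w - x^6*w^3 + 2*x^6*y*w + x^6*y^2*w - 2*x^7 + 2*x^7*w^2 - x^7*y + x^7*y*w^2 - x^8 - 2*x^8*w - 2*x^8*y*w - x^10"
  have n: "w^4 * (w' * inner_neg x y w') = n"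
    unfolding n_def inner_neg_def using assms by algebra
  \<comment> \<open>Multiplying by \<open>w\<^sup>4\<close> clears the negative powers of \<open>w\<close> and leaves an identity of polynomials.\<close>
  have "w^4 * ((1 - w') * inner_den x y) = w^3 * (w - 1) * inner_den x y"
    using assms by algebra
  also have "\<dots> = inner_num x y * (quartic x y w * q) + w * inner_pos x y w * q + n * quartic x y w"
    unfolding inner_den_def inner_num_def quartic_def inner_pos_def n_def q_def by algebra
  also have "\<dots> = w^4 * (inner_num x y * (quartic x y w * quartic x y w')
    + w * inner_pos x y w * quartic x y w' + w' * inner_neg x y w' * quartic x y w)"
    unfolding q[symmetric] n[symmetric] by algebra
  finally show ?thesis using nz by simp
qed

text \<open>
  The denominator left after the first step, \<open>inner_den x y\<close> times the square of
  \<open>(1 - x)\<^sup>2 (1 - x y + x\<^sup>2)\<close>, is a polynomial in \<open>x\<close> times \<open>quintic x z * quintic x (1/z)\<close>.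
\<close>

definition quintic :: "'a::comm_ring_1 \<Rightarrow> 'a \<Rightarrow> 'a" where
  "quintic x z = (1 - x*z)^2 * (1 + x*z) * (1 - x^2*z)^2"

definition outer_den :: "'a::comm_ring_1 \<Rightarrow> 'a" where
  "outer_den x = (1 + x) * (1 - x^3)^3 * (1 - x^4)^2"

definition outer_num :: "'a::comm_ring_1 \<Rightarrow> 'a" where
  "outer_num x = 1 - x^2 - x^3 + 2*x^4 + 2*x^5 + 2*x^6 - x^7 - x^8 + x^10"

definition outer_pos :: "'a::comm_ring_1 \<Rightarrow> 'a \<Rightarrow> 'a" where
  "outer_pos x z =
     (x + x^2 + 2*x^3 + x^4 + 2*x^5 + x^6 + 2*x^7 + x^8 + x^9)
     + (x^2 - x^3 - x^5 - 3*x^7 - 2*x^8 - 5*x^9 - 3*x^10 - 2*x^11) * z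
     + (2*x^6 - x^3 - 2*x^4 + x^7 - 3*x^8 - 6*x^9 - 5*x^10 + 3*x^12 + 2*x^13 + x^14) * z^2
     + (2*x^5 + x^6 - x^7 - 3*x^8 + 2*x^9 + 5*x^10 + 8*x^11 + 2*x^12 - x^13 - 2*x^14 + x^15 + x^16 + x^17) * z^3
     + (x^9 - x^7 + x^10 - 2*x^11 - 2*x^12 - 2*x^13 + x^14 + x^15 - x^17) * z^4"

definition outer_neg :: "'a::comm_ring_1 \<Rightarrow> 'a \<Rightarrow> 'a" where
  "outer_neg x z =
     (x^2 - 1 + x^3 - 2*x^4 - 2*x^5 - 2*x^6 + x^7 + x^8 - x^10)
     + (x^2 - 3*x^3 - 4*x^4 - 2*x^5 + 5*x^6 + 4*x^7 + 2*x^8 - 4*x^9 - 2*x^10 + x^11 + 2*x^12) * z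
     + (2*x^5 - x^3 - 2*x^4 + 5*x^6 + 2*x^7 - 2*x^8 - 2*x^9 + 2*x^10 + 5*x^11 + 2*x^12 - 2*x^13 - x^14) * z^2
     + (2*x^5 + x^6 - 2*x^7 - 4*x^8 + 2*x^9 + 4*x^10 + 5*x^11 - 2*x^12 - 4*x^13 - 3*x^14 + x^15) * z^3
     + (x^9 - x^7 + x^10 - 2*x^11 - 2*x^12 - 2*x^13 + x^14 + x^15 - x^17) * z^4"

text \<open>
  The decomposition of \<open>(1 - 1/z) inner_num outer_den / (B(z) B(1/z))\<close> by the sign of the exponent of
  \<open>z\<close>, where \<open>B\<close> is the quintic. The part constant in \<open>z\<close> is the numerator of the Hilbert series.
\<close>

lemma outer_partial_fractions:
  fixes x z z' :: "'a::idom"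
  assumes "z * z' = 1"
  shows "(1 - z') * inner_num x (z + z') * outer_den x =
    outer_num x * (quintic x z * quintic x z')
    + z * outer_pos x z * quintic x z' + z' * outer_neg x z' * quintic x z"
proof -
  have nz: "z \<noteq> 0" using assms by auto
  define q where "q = (z - x)^2 * (z + x) * (z - x^2)^2"
  have q: "z^5 * quintic x z' = q"
    unfolding q_def quintic_def using assms by algebra
  define n where "n = x^2*z^3 - z^4 + x^2*z^4 - x^3*z^2 - 3*x^3*z^3 + x^3*z^4 - 2*x^4*z^2 - 4*x^4*z^3 - 2*x^4*z^4 + 2*x^5*z + 2*x^5*z^2 - 2*x^5*z^3 - 2*x^5*z^4 + x^6*z + 5*x^6*z^2 + 5*x^6*z^3 - 2*x^6*z^4 - x^7 - 2*x^7*z + 2*x^7*z^2 + 4*x^7*z^3 + x^7*z^4 - 4*x^8*z - 2*x^8*z^2 + 2*x^8*z^3 + x^8*z^4 + x^9 + 2*x^9*z - 2*x^9*z^2 - 4*x^9*z^3 + x^10 + 4*x^10*z + 2*x^10*z^2 - 2*x^10*z^3 - x^10*z^4 - 2*x^11 + 5*x^11*z + 5*x^11*z^2 + x^11*z^3 - 2*x^12 - 2*x^12*z + 2*x^12*z^2 + 2*x^12*z^3 - 2*x^13 - 4*x^13*z - 2*x^13*z^2 + x^14 - 3*x^14*z - x^14*z^2 + x^15 + x^15*z - x^17"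
  have n: "z^5 * (z' * outer_neg x z') = n"
    unfolding n_def outer_neg_def using assms by algebra
  \<comment> \<open>Multiplying by \<open>z\<^sup>5\<close> clears the negative powers of \<open>z\<close> and leaves an identity of polynomials.\<close>
  have "z^5 * ((1 - z') * inner_num x (z + z') * outer_den x)
      = z^3 * (z - 1) * (z * (1 + x^2 + 2*x^3 + x^4 + x^6) + x^3 * (z^2 + 1)) * outer_den x"
    unfolding inner_num_def using assms by algebra
  also have "\<dots> = outer_num x * (quintic x z * q) + z * outer_pos x z * q + n * quintic x z"
    unfolding outer_den_def outer_num_def quintic_def outer_pos_def n_def q_def by algebra
  also have "\<dots> = z^5 * (outer_num x * (quintic x z * quintic x z')
    + z * outer_pos x z * quintic x z' + z' * outer_neg x z' * quintic x z)"
    unfolding q[symmetric] n[symmetric] by algebra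
  finally show ?thesis using nz by simp
qed

text \<open>
  The factors of the product are those of the generating function of monomials, sorted by weight. All
  inverses are taken among the series whose exponents lie in a half plane or a half line. Thus the
  positive and negative parts of the partial fraction decompositions have exponents on one side of a
  line through 0 and do not contribute to the constant term.
\<close>

lemma const_term_inverse_product:
  fixes z z' w w' x :: laurent_series
  defines "x \<equiv> fps_X" and "z \<equiv> mon (1, 0)" and "z' \<equiv> mon (-1, 0)"
    and "w \<equiv> mon (0, 1)" and "w' \<equiv> mon (0, -1)"
  assumes P: "P * ((1 - x)^4 * (1 - x*z)^2 * (1 - x*z')^2 * (1 - x*w)^2 * (1 - x*w')^2 *
    (1 - x*(z*w)) * (1 - x*(z*w')) * (1 - x*(z'*w)) * (1 - x*(z'*w'))) = 1"
  shows "const_term ((1 - z') * (1 - w') * P) *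
    ((1 - fps_X) * (1 - fps_X^2)^4 * (1 - fps_X^3)^3 * (1 - fps_X^4)^2) = outer_num fps_X"
proof -
  have zz: "z * z' = 1" and ww: "w * w' = 1"
    by (simp_all add: z_def z'_def w_def w'_def mon_mult mon_0 zero_prod_def[symmetric])
  define y where "y = z + z'"
  let ?Z = "{p :: int \<times> int. snd p = 0}" and ?Zp = "{p :: int \<times> int. snd p = 0 \<and> fst p \<ge> 0}"
    and ?Zn = "{p :: int \<times> int. snd p = 0 \<and> fst p \<le> 0}"
    and ?Wp = "{p :: int \<times> int. snd p \<ge> 0}" and ?Wn = "{p :: int \<times> int. snd p \<le> 0}"
  have mon: "submonoid ?Z" "submonoid ?Zp" "submonoid ?Zn" "submonoid ?Wp" "submonoid ?Wn"
    by (auto simp: submonoid_def)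
  note ring = supported_add supported_diff supported_uminus
    supported_ring_mult[OF mon(1)] supported_ring_power[OF mon(1)] supported_ring_const[OF mon(1)]
    supported_ring_mult[OF mon(2)] supported_ring_power[OF mon(2)] supported_ring_const[OF mon(2)]
    supported_ring_mult[OF mon(3)] supported_ring_power[OF mon(3)] supported_ring_const[OF mon(3)]
    supported_ring_mult[OF mon(4)] supported_ring_power[OF mon(4)] supported_ring_const[OF mon(4)]
    supported_ring_mult[OF mon(5)] supported_ring_power[OF mon(5)] supported_ring_const[OF mon(5)]
  have vars: "z \<in> supported ?Z" "z' \<in> supported ?Z" "y \<in> supported ?Z" "z \<in> supported ?Zp" "z' \<in> supported ?Zn"
    "y \<in> supported ?Wp" "y \<in> supported ?Wn" "w \<in> supported ?Wp" "w' \<in> supported ?Wn"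
    by (auto simp: y_def z_def z'_def w_def w'_def intro!: supported_mon supported_add)
  \<comment> \<open>The product of the four factors \<open>1 - t\<close>, each of which occurs twice in the generating function.\<close>
  define T where "T = (1 - x)^2 * (1 - x*y + x^2)"
  have inv: "\<exists>g \<in> supported S. g * f = 1" if "submonoid S" "f \<in> supported S" "f $ 0 = 1" for f S
    by (rule supported_left_inverse) (use that in \<open>auto simp: submonoid_def\<close>)
  have "\<exists>g \<in> supported ?Wp. g * quartic x y w = 1"
    by (rule inv[OF mon(4)]) (unfold quartic_def x_def, (intro ring vars)+, simp add: fps_power_zeroth)
  then obtain IA where IA: "IA \<in> supported ?Wp" "IA * quartic x y w = 1" ..
  have "\<exists>g \<in> supported ?Wn. g * quartic x y w' = 1"
    by (rule inv[OF mon(5)]) (unfold quartic_def x_def, (intro ring vars)+, simp add: fps_power_zeroth)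
  then obtain IB where IB: "IB \<in> supported ?Wn" "IB * quartic x y w' = 1" ..
  have "\<exists>g \<in> supported ?Z. g * inner_den x y = 1"
    by (rule inv[OF mon(1)]) (unfold inner_den_def x_def, (intro ring vars)+, simp add: fps_power_zeroth)
  then obtain G where G: "G \<in> supported ?Z" "G * inner_den x y = 1" ..
  have "\<exists>g \<in> supported ?Z. g * T = 1"
    by (rule inv[OF mon(1)]) (unfold T_def x_def, (intro ring vars)+, simp add: fps_power_zeroth)
  then obtain H where H: "H \<in> supported ?Z" "H * T = 1" ..
  have "\<exists>g \<in> supported ?Zp. g * quintic x z = 1"
    by (rule inv[OF mon(2)]) (unfold quintic_def x_def, (intro ring vars)+, simp add: fps_power_zeroth)
  then obtain IQ where IQ: "IQ \<in> supported ?Zp" "IQ * quintic x z = 1" ..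
  have "\<exists>g \<in> supported ?Zn. g * quintic x z' = 1"
    by (rule inv[OF mon(3)]) (unfold quintic_def x_def, (intro ring vars)+, simp add: fps_power_zeroth)
  then obtain IQ' where IQ': "IQ' \<in> supported ?Zn" "IQ' * quintic x z' = 1" ..
  have poly: "inner_pos x y w \<in> supported ?Wp" "inner_neg x y w' \<in> supported ?Wn"
    "outer_pos x z \<in> supported ?Zp" "outer_neg x z' \<in> supported ?Zn"
    unfolding inner_pos_def inner_neg_def outer_pos_def outer_neg_def x_def by (intro ring vars)+

  have single: "w \<in> supported {(0, 1)}" "w' \<in> supported {(0, -1)}"
    "z \<in> supported {(1, 0)}" "z' \<in> supported {(-1, 0)}"
    by (auto simp: z_def z'_def w_def w'_def intro: supported_mon)

  \<comment> \<open>The part of the denominator of the second step that depends on \<open>x\<close> only; together with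
    \<open>outer_den x\<close> it makes up the denominator of the Hilbert series.\<close>
  define \<kappa> where "\<kappa> = (1 - x^2) * (1 + x)^2 * (1 - x)^4"
  have quad: "(1 - s*z) * (1 - s*z') = 1 - s*y + s^2" for s
  proof -
    have "(1 - s*z) * (1 - s*z') = 1 - s*(z + z') + s^2*(z*z')" by algebra
    then show ?thesis by (simp add: zz y_def)
  qed
  have y: "1 - x*y + x^2 = (1 - x*z) * (1 - x*z')" "1 + x*y + x^2 = (1 + x*z) * (1 + x*z')"
    "1 - x^2*y + x^4 = (1 - x^2*z) * (1 - x^2*z')"
    "1 - x*y*u + x^2*u^2 = (1 - x*(z*u)) * (1 - x*(z'*u))" for u
    using quad[of x] quad[of "- x"] quad[of "x^2"] quad[of "x*u"]
    by (simp_all add: mult_ac power_mult_distrib)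
  have den: "inner_den x y * T ^ 2 = \<kappa> * (quintic x z * quintic x z')"
    unfolding inner_den_def T_def quintic_def \<kappa>_def y by algebra
  have "quartic x y w * quartic x y w' * T ^ 2 =
    (1 - x)^4 * (1 - x*z)^2 * (1 - x*z')^2 * (1 - x*w)^2 * (1 - x*w')^2 *
    (1 - x*(z*w)) * (1 - x*(z*w')) * (1 - x*(z'*w)) * (1 - x*(z'*w'))"
    unfolding quartic_def T_def y by algebra
  then have "P * (quartic x y w * quartic x y w' * T ^ 2) = 1"
    using P by simp
  moreover have "P = P * (IA * quartic x y w) * (IB * quartic x y w') * (H * T)^2"
    by (simp add: IA IB H)
  moreover have "\<dots> = P * (quartic x y w * quartic x y w' * T ^ 2) * (IA * IB * H^2)"
    by algebra
  ultimately have PE: "P = IA * IB * H^2"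
    by simp
  define R where "R = H^2 * G"
  have "\<kappa> * R = \<kappa> * (H^2 * G) * (IQ * quintic x z) * (IQ' * quintic x z')"
    by (simp add: IQ IQ' R_def)
  also have "\<dots> = (\<kappa> * (quintic x z * quintic x z')) * H^2 * G * (IQ * IQ')"
    by algebra
  also have "\<dots> = (G * inner_den x y) * (H * T)^2 * (IQ * IQ')"
    unfolding den[symmetric] by algebra
  finally have R: "\<kappa> * R = IQ * IQ'"
    by (simp add: G H)

  have "(1 - w') * P = (1 - w') * P * (G * inner_den x y)"
    by (simp add: G)
  also have "\<dots> = ((1 - w') * inner_den x y) * (IA * IB * R)"
    unfolding R_def PE by algebra
  also have "\<dots> = inner_num x y * R * (IA * quartic x y w) * (IB * quartic x y w')
      + w * (inner_pos x y w * IA) * R * (IB * quartic x y w')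
      + w' * (inner_neg x y w' * IB) * R * (IA * quartic x y w)"
    unfolding inner_partial_fractions[OF ww] by algebra
  finally have inner: "(1 - w') * P = inner_num x y * R
      + w * (inner_pos x y w * IA) * R + w' * (inner_neg x y w' * IB) * R"
    by (simp add: IA IB)
  \<comment> \<open>The terms with positive and with negative powers of \<open>w\<close>.\<close>
  define Rp where "Rp = (1 - z') * R * (w * (inner_pos x y w * IA))"
  define Rn where "Rn = (1 - z') * R * (w' * (inner_neg x y w' * IB))"
  have split: "(1 - z') * (1 - w') * P = (1 - z') * inner_num x y * R + Rp + Rn"
    unfolding Rp_def Rn_def mult.assoc inner by algebra
  have Z: "(1 - z') * R \<in> supported ?Z"
    unfolding R_def by (intro ring vars G H)+
  have "w * (inner_pos x y w * IA) \<in> supported {p. snd p > 0}"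
    by (rule supported_mult[OF single(1) supported_ring_mult[OF mon(4) poly(1) IA(1)]]) auto
  then have "Rp \<in> supported {p. snd p > 0}"
    unfolding Rp_def by (rule supported_mult[OF Z]) auto
  then have Rp: "const_term Rp = 0" by (rule const_term_supported) simp
  have "w' * (inner_neg x y w' * IB) \<in> supported {p. snd p < 0}"
    by (rule supported_mult[OF single(2) supported_ring_mult[OF mon(5) poly(2) IB(1)]]) auto
  then have "Rn \<in> supported {p. snd p < 0}"
    unfolding Rn_def by (rule supported_mult[OF Z]) auto
  then have Rn: "const_term Rn = 0" by (rule const_term_supported) simp

  have "outer_den x * \<kappa> * ((1 - z') * inner_num x y * R)
      = ((1 - z') * inner_num x y * outer_den x) * (\<kappa> * R)"
    by algebra
  also have "\<dots> = outer_num x * (IQ * quintic x z) * (IQ' * quintic x z')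
      + z * (outer_pos x z * IQ) * (IQ' * quintic x z') + z' * (outer_neg x z' * IQ') * (IQ * quintic x z)"
    unfolding R outer_partial_fractions[OF zz, of x, folded y_def] by algebra
  finally have outer: "outer_den x * \<kappa> * ((1 - z') * inner_num x y * R) =
      outer_num x + z * (outer_pos x z * IQ) + z' * (outer_neg x z' * IQ')"
    by (simp add: IQ IQ')
  have "z * (outer_pos x z * IQ) \<in> supported {p. fst p > 0}"
    by (rule supported_mult[OF single(3) supported_ring_mult[OF mon(2) poly(3) IQ(1)]]) auto
  then have Qp: "const_term (z * (outer_pos x z * IQ)) = 0" by (rule const_term_supported) simp
  have "z' * (outer_neg x z' * IQ') \<in> supported {p. fst p < 0}"
    by (rule supported_mult[OF single(4) supported_ring_mult[OF mon(3) poly(4) IQ'(1)]]) auto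
  then have Qn: "const_term (z' * (outer_neg x z' * IQ')) = 0" by (rule const_term_supported) simp

  let ?D = "(1 - fps_X) * (1 - fps_X^2)^4 * (1 - fps_X^3)^3 * (1 - fps_X^4)^2 :: int fps"
  have D: "const_embed.map_fps ?D = outer_den x * \<kappa>"
    unfolding const_embed.map_fps_simps outer_den_def \<kappa>_def x_def[symmetric] by algebra
  have N: "outer_num x = const_embed.map_fps (outer_num fps_X)"
    by (simp add: const_embed.map_fps_simps outer_num_def x_def)
  have one: "const_term 1 = 1"
    by (simp add: const_term_def fps_eq_iff lookup_one)
  have "?D * const_term ((1 - z') * (1 - w') * P) = const_term (const_embed.map_fps ?D * ((1 - z') * inner_num x y * R))"
    unfolding split const_term_const_embed_mult by (simp add: const_term_add Rp Rn)
  also have "\<dots> = const_term (outer_num x)"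
    unfolding D outer by (simp add: const_term_add Qp Qn)
  also have "\<dots> = outer_num fps_X"
    unfolding N using const_term_const_embed_mult[of "outer_num fps_X" 1] by (simp add: one)
  finally show ?thesis by (simp add: mult.commute)
qed

definition weight_series :: "('i \<Rightarrow> int \<times> int) \<Rightarrow> 'i set \<Rightarrow> laurent_series" where
  "weight_series wt J =
    Abs_fps (\<lambda>n. \<Sum>M | size M = n \<and> set_mset M \<subseteq> J. Poly_Mapping.single (weight wt M) 1)"

text \<open>
  A monomial either avoids the variable \<open>i\<close> or is \<open>i\<close> times another monomial.
\<close>

lemma weight_series_insert:
  assumes "finite J" "i \<notin> J"
  shows "weight_series wt (insert i J) * (1 - fps_X * mon (wt i)) = weight_series wt J"
proof -
  let ?s = "\<lambda>M. Poly_Mapping.single (weight wt M) 1 :: int \<times> int \<Rightarrow>\<^sub>0 int"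
  have "weight_series wt (insert i J) = weight_series wt J + fps_X * (mon (wt i) * weight_series wt (insert i J))"
  proof (rule fps_ext)
    fix n
    show "weight_series wt (insert i J) $ n = (weight_series wt J + fps_X * (mon (wt i) * weight_series wt (insert i J))) $ n"
    proof (cases n)
      case 0
      have "{M. size M = 0 \<and> set_mset M \<subseteq> K} = {{#}}" for K :: "'a set" by auto
      then show ?thesis using 0 by (simp add: weight_series_def)
    next
      case (Suc m)
      let ?A = "{M. size M = Suc m \<and> set_mset M \<subseteq> J}"
      let ?B = "{M. size M = m \<and> set_mset M \<subseteq> insert i J}"
      have split: "{M. size M = Suc m \<and> set_mset M \<subseteq> insert i J} = ?A \<union> add_mset i ` ?B"
      proof (intro equalityI subsetI)
        fix M assume M: "M \<in> {M. size M = Suc m \<and> set_mset M \<subseteq> insert i J}"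
        show "M \<in> ?A \<union> add_mset i ` ?B"
        proof (cases "i \<in># M")
          case True
          then obtain M' where "M = add_mset i M'" by (metis insert_DiffM)
          then show ?thesis using M by auto
        qed (use M in auto)
      qed auto
      have "(\<Sum>M | size M = Suc m \<and> set_mset M \<subseteq> insert i J. ?s M) = sum ?s ?A + sum ?s (add_mset i ` ?B)"
        unfolding split by (rule sum.union_disjoint)
          (use assms finite_multisets_of_size[of J] finite_multisets_of_size[of "insert i J"] in auto)
      also have "sum ?s (add_mset i ` ?B) = (\<Sum>M\<in>?B. Poly_Mapping.single (wt i) 1 * ?s M)"
        by (subst sum.reindex) (auto simp: mult_single inj_on_def)
      finally show ?thesis
        by (simp add: weight_series_def Suc mon_def sum_distrib_left)
    qed
  qed
  then show ?thesis by (simp add: algebra_simps)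
qed

lemma weight_series_inverse:
  assumes "finite J"
  shows "weight_series wt J * (\<Prod>i\<in>J. 1 - fps_X * mon (wt i)) = 1"
  using assms
proof (induction J rule: finite_induct)
  case empty
  have "{M. size M = n \<and> M = {#}} = (if n = 0 then {{#}} else {})" for n by auto
  then show ?case by (auto simp: weight_series_def fps_eq_iff)
next
  case (insert i J)
  then show ?case
    using weight_series_insert[of J i wt] by (simp add: mult.assoc[symmetric])
qed

lemma lookup_weight_series:
  "Poly_Mapping.lookup (weight_series wt (UNIV :: 'i::finite set) $ n) p = int (weight_count wt n p)"
proof -
  have "Poly_Mapping.lookup (weight_series wt (UNIV :: 'i set) $ n) p =
      (\<Sum>M\<in>{M. size M = n}. if weight wt M = p then 1 else 0)"
    by (simp add: weight_series_def lookup_sum lookup_single when_def eq_commute)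
  also have "\<dots> = int (weight_count wt n p)"
    using finite_multisets_of_size[of "UNIV :: 'i set" n]
    by (simp add: weight_count_def sum.If_cases Int_def)
  finally show ?thesis .
qed

lemma const_term_mon_mult: "const_term (mon p * f) $ n = Poly_Mapping.lookup (f $ n) (- p)"
proof -
  have "Poly_Mapping.lookup (Poly_Mapping.single p 1 * g) 0 = Poly_Mapping.lookup g (- p)" for g :: "int \<times> int \<Rightarrow>\<^sub>0 int"
  proof -
    have 1: "(1 when p = l) * c = (c when l = p)" for l and c :: int
      by (simp add: when_def)
    have 2: "0 = p + q \<longleftrightarrow> q = - p" for q
      by (metis add.inverse_inverse add.right_inverse minus_unique)
    show ?thesis
      unfolding lookup_mult lookup_single 1 Sum_any_when_equal 2 ..
  qed
  then show ?thesis by (simp add: const_term_def mon_def)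
qed

text \<open>
  Multiplication by \<open>1/z\<close> moves the coefficient of weight \<open>(1, 0)\<close> into the constant term, so the four
  numbers are the constant terms of the four products in \<open>(1 - 1/z) (1 - 1/w) P\<close>.
\<close>

lemma entry_weight_series:
  "Abs_fps (\<lambda>n. int (weight_count entry_weight n (0, 0)) - int (weight_count entry_weight n (1, 0))
      - int (weight_count entry_weight n (0, 1)) + int (weight_count entry_weight n (1, 1))) *
    ((1 - fps_X) * (1 - fps_X^2)^4 * (1 - fps_X^3)^3 * (1 - fps_X^4)^2) = outer_num fps_X"
proof -
  let ?P = "weight_series entry_weight UNIV"
  have "(\<Prod>i\<in>UNIV. 1 - fps_X * mon (entry_weight i)) =
     (1 - fps_X)^4 * (1 - fps_X*mon (1,0))^2 * (1 - fps_X*mon (-1,0))^2 * (1 - fps_X*mon (0,1))^2 * (1 - fps_X*mon (0,-1))^2 *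
    (1 - fps_X*(mon (1,0)*mon (0,1))) * (1 - fps_X*(mon (1,0)*mon (0,-1))) * (1 - fps_X*(mon (-1,0)*mon (0,1))) * (1 - fps_X*(mon (-1,0)*mon (0,-1)))"
    unfolding UNIV_Times_UNIV[symmetric]
    by (simp add: prod.cartesian_product[symmetric] case_prod_unfold UNIV_bool entry_weight_def mon_mult
        mon_0[unfolded zero_prod_def] power2_eq_square power4_eq_xxxx mult_ac)
  then have "const_term ((1 - mon (-1, 0)) * (1 - mon (0, -1)) * ?P) *
    ((1 - fps_X) * (1 - fps_X^2)^4 * (1 - fps_X^3)^3 * (1 - fps_X^4)^2) = outer_num fps_X"
    by (intro const_term_inverse_product) (use weight_series_inverse[of UNIV entry_weight] in simp)
  moreover have "const_term ((1 - mon (-1, 0)) * (1 - mon (0, -1)) * ?P) $ n =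
     int (weight_count entry_weight n (0, 0)) - int (weight_count entry_weight n (1, 0))
      - int (weight_count entry_weight n (0, 1)) + int (weight_count entry_weight n (1, 1))" for n
  proof -
    have "(1 - mon (-1, 0)) * (1 - mon (0, -1)) * ?P =
        mon 0 * ?P - mon (-1, 0) * ?P - mon (0, -1) * ?P + mon (-1, -1) * ?P"
      using mon_mult[of "(-1, 0)" "(0, -1)"] by (simp add: algebra_simps mon_0)
    moreover have "const_term (a - b - c + d) $ n = const_term a $ n - const_term b $ n - const_term c $ n + const_term d $ n"
      for a b c d by (simp add: const_term_def lookup_minus lookup_add)
    ultimately show ?thesis by (simp add: const_term_mon_mult lookup_weight_series zero_prod_def)
  qed
  then have "const_term ((1 - mon (-1, 0)) * (1 - mon (0, -1)) * ?P) =
    Abs_fps (\<lambda>n. int (weight_count entry_weight n (0, 0)) - int (weight_count entry_weight n (1, 0))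
      - int (weight_count entry_weight n (0, 1)) + int (weight_count entry_weight n (1, 1)))"
    by (simp add: fps_eq_iff)
  ultimately show ?thesis by simp
qed

section \<open>The Hilbert series\<close>

theorem theorem1p2:
  fixes sV :: "'k::field_char_0 \<Rightarrow> 'v::ab_group_add \<Rightarrow> 'v"
    and sW :: "'k \<Rightarrow> 'w::ab_group_add \<Rightarrow> 'w"
    and sT :: "'k \<Rightarrow> 't::ab_group_add \<Rightarrow> 't"
    and \<tau> :: "'v \<Rightarrow> 'w \<Rightarrow> 't"
  assumes "vector_space sV" and "vector_space.dim sV UNIV = 2"
    and "vector_space sW" and "vector_space.dim sW UNIV = 2"
    and "vector_space sT" and "is_tensor_product sV sW sT \<tau>"
  shows "Abs_fps (\<lambda>n. rat_of_int (fps_nth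
             (hilbert_series (scale_fun sT) (endomorphisms sT)
               (tensor_End_invariants sV sW sT \<tau>)) n)) =
         (1 - fps_X^2 - fps_X^3 + 2 * fps_X^4 + 2 * fps_X^5 + 2 * fps_X^6
            - fps_X^7 - fps_X^8 + fps_X^10) /
         ((1 - fps_X) * (1 - fps_X^2)^4 * (1 - fps_X^3)^3 * (1 - fps_X^4)^2)"
proof -
  obtain e c where V: "\<And>i. Vector_Spaces.linear sV (*) (c i)"
    "\<And>v. v = (\<Sum>i\<in>UNIV. sV (c i v) (e i))" "\<And>i j. c (i :: bool) (e j) = of_bool (i = j)"
    using vector_space.two_dim_coordinates[OF assms(1,2)] by auto
  obtain f d where W: "\<And>i. Vector_Spaces.linear sW (*) (d i)"
    "\<And>w. w = (\<Sum>i\<in>UNIV. sW (d i w) (f i))" "\<And>i j. d (i :: bool) (f j) = of_bool (i = j)"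
    using vector_space.two_dim_coordinates[OF assms(3,4)] by auto
  interpret tensor_with_coordinates sV sW sT \<tau> e c f d
    by (rule tensor_with_coordinates.intro[OF assms(6) V(1) V(3) V(2) W(1) W(3) W(2)])
  let ?H = "hilbert_series (scale_fun sT) (endomorphisms sT) (tensor_End_invariants sV sW sT \<tau>)"
  let ?D = "(1 - fps_X) * (1 - fps_X^2)^4 * (1 - fps_X^3)^3 * (1 - fps_X^4)^2"
  have "?H * ?D = outer_num fps_X"
    using entry_weight_series by (simp only: hilbert_series_def dim_invariant_component)
  then have "of_int_rat.map_fps (?H * ?D) = of_int_rat.map_fps (outer_num fps_X)"
    by (rule arg_cong)
  then have "of_int_rat.map_fps ?H * ?D = outer_num fps_X"
    by (simp only: of_int_rat.map_fps_simps outer_num_def)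
  moreover have "?D $ 0 = (1 :: rat)"
    by (simp add: fps_power_zeroth)
  then have "?D \<noteq> (0 :: rat fps)"
    by (intro notI) (simp only: fps_zero_nth zero_neq_one)
  ultimately have "of_int_rat.map_fps ?H = outer_num fps_X / ?D"
    by (metis nonzero_mult_div_cancel_right)
  then show ?thesis
    by (simp only: of_int_rat.map_fps_def outer_num_def)
qed

end
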